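(* Let $n\ge 2$ and let $\mathbf{p}=(\mathbf{p}_1,\dots,\mathbf{p}_N)$, $\mathbf{q}=(\mathbf{q}_1,\dots,\mathbf{q}_N)$ be configurations in $\mathbb{E}^n$ with $|\mathbf{p}_i-\mathbf{p}_j|\le|\mathbf{q}_i-\mathbf{q}_j|$ for all $1\le i<j\le N$. Then there exists $r_0>0$ such that for every $r\ge r_0$ $$\mathrm{Vol}_{n-1}\Big[\mathrm{Bdry}\Big[\bigcup_{i=1}^N B_n(\mathbf{p}_i,r)\Big]\Big]\le \mathrm{Vol}_{n-1}\Big[\mathrm{Bdry}\Big[\bigcup_{i=1}^N B_n(\mathbf{q}_i,r)\Big]\Big]$$ and $$\mathrm{Vol}_{n-1}\Big[\mathrm{Bdry}\Big[\bigcap_{i=1}^N B_n(\mathbf{p}_i,r)\Big]\Big]\ge \mathrm{Vol}_{n-1}\Big[\mathrm{Bdry}\Big[\bigcap_{i=1}^N B_n(\mathbf{q}_i,r)\Big]\Big],$$ and if $\mathbf{p}$ and $\mathbf{q}$ are not congruent, both inequalities are strict.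
   Context: $B_n(\mathbf{x},r)$ is the closed ball of radius $r$ centered at $\mathbf{x}$, $\mathrm{Bdry}[X]$ is the topological boundary of $X\subset\mathbb{E}^n$, and $\mathrm{Vol}_{n-1}$ is $(n-1)$-dimensional (surface) measure. Congruent means there is an isometry of $\mathbb{E}^n$ mapping $\mathbf{p}_i$ to $\mathbf{q}_i$ for every $i$. *)

theory Defs
  imports "HOL-Analysis.Analysis"
begin

text \<open>Normalising constant of the s-dimensional Hausdorff measure:
  the volume of the unit ball in dimension s divided by 2^s.\<close>
definition hausdorff_const :: "real \<Rightarrow> real" where
  "hausdorff_const s = pi powr (s / 2) / Gamma (s / 2 + 1) / 2 powr s"

text \<open>The size-delta approximating outer measure (covers by bounded sets, since the
  library's diameter is 0 on unbounded sets).\<close>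
definition hausdorff_pre :: "real \<Rightarrow> real \<Rightarrow> 'a::metric_space set \<Rightarrow> ennreal" where
  "hausdorff_pre s \<delta> A =
     (INF C \<in> {C :: nat \<Rightarrow> 'a set. A \<subseteq> (\<Union>i. C i) \<and> (\<forall>i. bounded (C i) \<and> diameter (C i) \<le> \<delta>)}.
        (\<Sum>i. ennreal (hausdorff_const s * diameter (C i) powr s)))"

text \<open>The s-dimensional Hausdorff (outer) measure; for s = n - 1 in E^n this is the
  (n-1)-dimensional surface measure.\<close>
definition hausdorff_measure :: "real \<Rightarrow> 'a::metric_space set \<Rightarrow> ennreal" where
  "hausdorff_measure s A = (SUP \<delta> \<in> {0<..}. hausdorff_pre s \<delta> A)"

definition congruent_conf :: "nat \<Rightarrow> (nat \<Rightarrow> 'a::metric_space) \<Rightarrow> (nat \<Rightarrow> 'a) \<Rightarrow> bool" where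
  "congruent_conf N p q \<longleftrightarrow>
     (\<exists>f. (\<forall>x y. dist (f x) (f y) = dist x y) \<and> (\<forall>i<N. f (p i) = q i))"

end

theory Submission
  imports Defs "HOL-Real_Asymp.Real_Asymp"
begin

text \<open>
  The Hausdorff measure on the unit sphere is rotation invariant, hence a multiple of the cone
  measure. Therefore the boundary of a union (intersection) of balls of radius \<open>r\<close> has, up to a constant, measure
  \<open>r\<^sup>n\<^sup>-\<^sup>1\<close> times the total angle \<open>G(r)\<close> under which the nearest (farthest) point Voronoi
  cells are seen at distance \<open>r\<close> from their centres. Cells are star-shaped (or co-star-shaped), so \<open>G\<close> is
  monotone and squeezed between difference quotients of the volume, whose expansion
  \<open>\<omega> r\<^sup>n \<plusminus> n W r\<^sup>n\<^sup>-\<^sup>1 + O(r\<^sup>n\<^sup>-\<^sup>2)\<close> has the mean width \<open>W\<close> of the configuration as its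
  second coefficient. Hence \<open>r (G(r) - \<omega>)\<close> tends to \<open>\<plusminus> (n - 1) W\<close>, and everything reduces to
  \<open>W(p) < W(q)\<close>.

  For the latter, rotate \<open>(p\<^sub>i, 0)\<close> to \<open>(0, q\<^sub>i)\<close> through \<open>(cos \<theta> p\<^sub>i, sin \<theta> q\<^sub>i)\<close> in dimension
  \<open>2n\<close>, replacing the maximum of the linear forms by a softmax of inverse temperature \<open>\<beta>\<close>. After
  integration by parts the derivative of the width is a sum over pairs of nonnegative multiples of
  \<open>|q\<^sub>i - q\<^sub>j|\<^sup>2 - |p\<^sub>i - p\<^sub>j|\<^sup>2\<close>, and it stays bounded below as \<open>\<beta>\<close> grows if this is positive for some edge
  of the convex hull of the points \<open>(p\<^sub>i, q\<^sub>i)\<close>. If all edges were isotropic for the form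
  \<open>|x|\<^sup>2 - |y|\<^sup>2\<close>, expanding differences in the edges at a vertex would make all of them isotropic,
  so \<open>p\<close> and \<open>q\<close> would be congruent.
\<close>

section \<open>Hausdorff measure as a Borel measure\<close>

text \<open>Both surface measures share their leading term in r, so the coefficient of relative
  order 1/r has to decide, and strictness of the theorem needs strictness there. An expanding motion
  from p to q inside the given space need not exist; in the doubled space the rotation always
  expands, because the squared distances along it are cos^2 \<theta> |p_i - p_j|^2 + sin^2 \<theta>
  |q_i - q_j|^2. Nothing is lost by doubling: width is integrated against a radial weight, and
  integrating out the block that a configuration does not see leaves its own width times a factor
  common to p and q. The weight is a truncated quadratic, so every integral lives on one fixed box
  while an integration by parts of Gaussian type is still available. The bound that survives large
  \<beta> comes from a balance: the two ends of an edge compete on a slab of thickness of order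
  1/\<beta>, where the integrand has order \<beta>. For a pair of points that spans no edge such a
  slab need not exist.\<close>

lemma metric_outer_measure_closed:
  fixes \<mu> :: "'a::metric_space set \<Rightarrow> ennreal"
  assumes mono: "\<And>A B. A \<subseteq> B \<Longrightarrow> \<mu> A \<le> \<mu> B"
    and empty: "\<mu> {} = 0"
    and subadd: "\<And>A::nat \<Rightarrow> 'a set. \<mu> (\<Union>i. A i) \<le> (\<Sum>i. \<mu> (A i))"
    and sep: "\<And>A B d. d > 0 \<Longrightarrow> (\<And>x y. x \<in> A \<Longrightarrow> y \<in> B \<Longrightarrow> dist x y \<ge> d) \<Longrightarrow> \<mu> A + \<mu> B \<le> \<mu> (A \<union> B)"
    and F: "closed F"
  shows "\<mu> (X \<inter> F) + \<mu> (X - F) \<le> \<mu> X"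
proof -
  consider "F = {}" | "\<mu> X = \<infinity>" | "F \<noteq> {}" "\<mu> X < \<infinity>" by (metis infinity_ennreal_def top.not_eq_extremum)
  then show ?thesis
  proof cases
    case 3
    \<comment> \<open>\<open>R k\<close> is the shell of points of \<open>X\<close> with
      \<open>infdist\<close> in [1/(k+2), 1/(k+1)). Neighbouring shells may touch, but shells whose
      indices differ by at least two are a positive distance apart; hence even and odd indices are
      summed separately, each sum staying below \<open>\<mu> X\<close>. So the measures of the
      shells are summable, and \<open>Y m\<close> misses only a small tail.\<close>
    define Y where "Y k = {x \<in> X. infdist x F \<ge> 1 / (real k + 1)}" for k :: nat
    define R where "R k = Y (Suc k) - Y k" for k
    have RX: "R k \<subseteq> X" for k by (auto simp: R_def Y_def)
    have dist_infdist: "dist x y \<ge> infdist x F - infdist y F" for x y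
      using infdist_triangle[of x F y] by linarith
    have partial: "(\<Sum>k<m. \<mu> (R (2 * k + a))) \<le> \<mu> (\<Union>k<m. R (2 * k + a))" for m a
    proof (induction m)
      case (Suc m)
      show ?case
      \<comment> \<open>For \<open>m = 0\<close> and \<open>a = 0\<close> the gap used below would
        involve \<open>1 / 0\<close>, which is 0; a single shell needs no separation.\<close>
      proof (cases "m = 0")
        case False
        have "\<mu> (\<Union>k<m. R (2 * k + a)) + \<mu> (R (2 * m + a)) \<le> \<mu> ((\<Union>k<m. R (2 * k + a)) \<union> R (2 * m + a))"
        proof (rule sep)
          show "1 / real (2 * m + a) - 1 / real (2 * m + a + 1) > 0" using False by (simp add: frac_less2)
          fix x y assume "x \<in> (\<Union>k<m. R (2 * k + a))" and y: "y \<in> R (2 * m + a)"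
          then obtain k where k: "k < m" "x \<in> R (2 * k + a)" by blast
          have "infdist x F \<ge> 1 / (real (Suc (2 * k + a)) + 1)" using k by (simp add: R_def Y_def)
          moreover have "1 / (real (Suc (2 * k + a)) + 1) \<ge> 1 / real (2 * m + a)"
            using k(1) by (intro frac_le) auto
          moreover have "infdist y F < 1 / real (2 * m + a + 1)" using y by (auto simp: R_def Y_def add_ac)
          ultimately show "dist x y \<ge> 1 / real (2 * m + a) - 1 / real (2 * m + a + 1)"
            using dist_infdist[of x y] by linarith
        qed
        also have "(\<Union>k<m. R (2 * k + a)) \<union> R (2 * m + a) = (\<Union>k<Suc m. R (2 * k + a))"
          by (auto simp: lessThan_Suc)
        finally show ?thesis using Suc.IH by (simp add: add_mono order_trans[rotated])
      qed (simp add: lessThan_Suc)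
    qed (simp add: empty)
    have partial': "(\<Sum>k<m. \<mu> (R (2 * k + a))) \<le> \<mu> X" for m a
      using RX by (intro order_trans[OF partial] mono) auto
    have even_odd: "(\<Sum>k<2 * m. \<mu> (R k)) = (\<Sum>k<m. \<mu> (R (2 * k + 0))) + (\<Sum>k<m. \<mu> (R (2 * k + 1)))" for m
      by (induction m) (auto simp: algebra_simps)
    have finR: "\<mu> (R k) < \<infinity>" for k using mono[OF RX] 3(2) by (rule le_less_trans)
    define c where "c k = enn2real (\<mu> (R k))" for k
    have c: "\<mu> (R k) = ennreal (c k)" "c k \<ge> 0" for k using finR[of k] by (simp_all add: c_def)
    have "summable c"
    proof (rule summableI_nonneg_bounded)
      fix m
      have "ennreal (\<Sum>k<m. c k) = (\<Sum>k<m. \<mu> (R k))" using c by (simp add: sum_ennreal)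
      also have "\<dots> \<le> (\<Sum>k<2 * m. \<mu> (R k))" by (intro sum_mono2) auto
      also have "\<dots> \<le> \<mu> X + \<mu> X" unfolding even_odd by (intro add_mono partial')
      finally show "(\<Sum>k<m. c k) \<le> enn2real (\<mu> X + \<mu> X)"
        using 3(2) by (metis enn2real_ennreal enn2real_mono c(2) sum_nonneg ennreal_add_less_top infinity_ennreal_def)
    qed (rule c)
    show ?thesis
    proof (rule ennreal_le_epsilon)
      fix e :: real assume "e > 0"
      then obtain m where m: "(\<Sum>k. c (k + m)) < e"
        using suminf_exist_split[OF \<open>e > 0\<close> \<open>summable c\<close>] by (metis abs_ge_self le_less_trans order_refl real_norm_def)
      have "X - F \<subseteq> Y m \<union> (\<Union>k. R (k + m))"
      proof
        fix x assume x: "x \<in> X - F"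
        then have "infdist x F > 0" using F 3(1) by (simp add: infdist_pos_not_in_closed)
        then obtain n where "1 / (real n + 1) < infdist x F"
          using reals_Archimedean by (metis inverse_eq_divide of_nat_Suc add.commute)
        then have ex: "x \<in> Y n" using x by (simp add: Y_def)
        define l where "l = (LEAST n. x \<in> Y n)"
        have l: "x \<in> Y l" unfolding l_def using ex by (rule LeastI)
        show "x \<in> Y m \<union> (\<Union>k. R (k + m))"
        proof (cases "l \<le> m")
          case True
          have "1 / (real m + 1) \<le> 1 / (real l + 1)" using True by (intro frac_le) auto
          then show ?thesis using l by (auto simp: Y_def)
        next
          case False
          then obtain k where k: "l = Suc (k + m)" by (metis less_iff_Suc_add not_le add.commute)
          have "x \<notin> Y (k + m)" using not_less_Least[of "k + m" "\<lambda>n. x \<in> Y n"] k by (simp add: l_def)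
          then show ?thesis using l k by (auto simp: R_def)
        qed
      qed
      moreover have "Y m \<union> (\<Union>k. R (k + m)) \<subseteq> (\<Union>i. case i of 0 \<Rightarrow> Y m | Suc k \<Rightarrow> R (k + m))"
      proof (intro Un_least UN_least)
        show "Y m \<subseteq> (\<Union>i. case i of 0 \<Rightarrow> Y m | Suc k \<Rightarrow> R (k + m))" by (rule subset_trans[OF _ UN_upper[of 0]]) auto
        show "R (k + m) \<subseteq> (\<Union>i. case i of 0 \<Rightarrow> Y m | Suc k \<Rightarrow> R (k + m))" for k
          by (rule subset_trans[OF _ UN_upper[of "Suc k"]]) auto
      qed
      ultimately have "\<mu> (X - F) \<le> \<mu> (\<Union>i. case i of 0 \<Rightarrow> Y m | Suc k \<Rightarrow> R (k + m))"
        by (intro mono) (rule subset_trans)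
      also have "\<dots> \<le> (\<Sum>i. \<mu> (case i of 0 \<Rightarrow> Y m | Suc k \<Rightarrow> R (k + m)))" by (rule subadd)
      also have "\<dots> = \<mu> (Y m) + (\<Sum>k. \<mu> (R (k + m)))"
        by (subst suminf_offset[where i = 1]) (auto simp: add.commute)
      also have "(\<Sum>k. \<mu> (R (k + m))) = ennreal (\<Sum>k. c (k + m))"
        unfolding c(1) by (rule suminf_ennreal2) (use c \<open>summable c\<close> in \<open>auto simp: summable_iff_shift\<close>)
      also have "\<dots> \<le> ennreal e" using m by (simp add: ennreal_leI)
      finally have "\<mu> (X - F) \<le> \<mu> (Y m) + ennreal e" by (simp add: add_left_mono)
      then have "\<mu> (X \<inter> F) + \<mu> (X - F) \<le> \<mu> (X \<inter> F) + \<mu> (Y m) + ennreal e"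
        by (simp add: add.assoc add_left_mono)
      also have "\<mu> (X \<inter> F) + \<mu> (Y m) \<le> \<mu> (X \<inter> F \<union> Y m)"
      proof (rule sep[of "1 / (real m + 1)"])
        fix x y assume "x \<in> X \<inter> F" "y \<in> Y m"
        then show "dist x y \<ge> 1 / (real m + 1)"
          using dist_infdist[of y x] by (simp add: Y_def dist_commute)
      qed simp
      also have "\<mu> (X \<inter> F \<union> Y m) \<le> \<mu> X" by (intro mono) (auto simp: Y_def)
      finally show "\<mu> (X \<inter> F) + \<mu> (X - F) \<le> \<mu> X + ennreal e" by (simp add: add_right_mono)
    qed
  qed (simp_all add: empty)
qed

text \<open>Caratheodory's criterion: the sets that split every \<open>X\<close> additively form a
  sigma-algebra that contains the closed sets, hence all Borel sets.\<close>

lemma metric_outer_measure_borel: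
  fixes \<mu> :: "'a::metric_space set \<Rightarrow> ennreal"
  assumes mono: "\<And>A B. A \<subseteq> B \<Longrightarrow> \<mu> A \<le> \<mu> B"
    and empty: "\<mu> {} = 0"
    and subadd: "\<And>A::nat \<Rightarrow> 'a set. \<mu> (\<Union>i. A i) \<le> (\<Sum>i. \<mu> (A i))"
    and sep: "\<And>A B d. d > 0 \<Longrightarrow> (\<And>x y. x \<in> A \<Longrightarrow> y \<in> B \<Longrightarrow> dist x y \<ge> d) \<Longrightarrow> \<mu> A + \<mu> B \<le> \<mu> (A \<union> B)"
  shows "measure_space UNIV (sets borel) \<mu>"
proof -
  interpret P: sigma_algebra UNIV "Pow UNIV :: 'a set set" by (rule sigma_algebra_Pow)
  let ?L = "lambda_system UNIV (Pow UNIV) \<mu>"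
  have "outer_measure_space (Pow UNIV) \<mu>"
    unfolding outer_measure_space_def positive_def increasing_def countably_subadditive_def
    using mono empty subadd by auto
  then have L: "measure_space UNIV ?L \<mu>" using P.caratheodory_lemma by blast
  have two: "\<mu> X \<le> \<mu> (X \<inter> l) + \<mu> (X - l)" for X l
  proof -
    have "\<mu> X \<le> \<mu> (\<Union>i::nat. if i = 0 then X \<inter> l else if i = 1 then X - l else {})"
    proof (rule mono, rule subsetI)
      fix x assume "x \<in> X"
      then show "x \<in> (\<Union>i::nat. if i = 0 then X \<inter> l else if i = 1 then X - l else {})"
        by (cases "x \<in> l") (auto intro!: UN_I[of 0] UN_I[of 1] split: if_splits)
    qed
    also have "\<dots> \<le> (\<Sum>i::nat. \<mu> (if i = 0 then X \<inter> l else if i = 1 then X - l else {}))" by (rule subadd)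
    also have "\<dots> = (\<Sum>i\<in>{0,1::nat}. \<mu> (if i = 0 then X \<inter> l else if i = 1 then X - l else {}))"
      by (rule suminf_finite) (auto simp: empty)
    finally show ?thesis by simp
  qed
  have "F \<in> ?L" if "closed F" for F
    unfolding P.lambda_system_eq using metric_outer_measure_closed[OF mono empty subadd sep that] two
    by (auto intro: antisym)
  then have "sigma_sets UNIV {F. closed F} \<subseteq> ?L"
    using L by (intro sigma_algebra.sigma_sets_subset) (auto simp: measure_space_def)
  then have "sets borel \<subseteq> ?L" by (simp add: borel_eq_closed)
  then show ?thesis
    using L sets.sigma_algebra_axioms[of "borel :: 'a measure"]
    unfolding measure_space_def positive_def countably_additive_def by (auto simp: subset_iff)
qed

section \<open>Hausdorff measure is a metric outer measure\<close>

lemma hausdorff_pre_antimono: "\<delta> \<le> \<delta>' \<Longrightarrow> hausdorff_pre s \<delta>' A \<le> hausdorff_pre s \<delta> A"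
  unfolding hausdorff_pre_def by (rule INF_superset_mono) (auto intro: order_trans)

lemma hausdorff_pre_mono: "A \<subseteq> B \<Longrightarrow> hausdorff_pre s \<delta> A \<le> hausdorff_pre s \<delta> B"
  unfolding hausdorff_pre_def by (rule INF_superset_mono) auto

lemma hausdorff_measure_mono: "A \<subseteq> B \<Longrightarrow> hausdorff_measure s A \<le> hausdorff_measure s B"
  unfolding hausdorff_measure_def by (intro SUP_mono) (auto intro: hausdorff_pre_mono)

text \<open>The cover by empty sets is free: \<open>diameter {} = 0\<close>, and
  \<open>0 powr s = 0\<close> for every \<open>s\<close>, including \<open>s = 0\<close>. The same
  convention later lets discarded cover sets be replaced by \<open>{}\<close>.\<close>

lemma hausdorff_pre_empty: "\<delta> > 0 \<Longrightarrow> hausdorff_pre s \<delta> {} = 0"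
  unfolding hausdorff_pre_def
  by (rule antisym[OF INF_lower2[of "\<lambda>_. {}"]]) (auto simp: diameter_empty)

lemma hausdorff_measure_empty: "hausdorff_measure s {} = 0"
  unfolding hausdorff_measure_def by (simp add: hausdorff_pre_empty)

lemma hausdorff_pre_subadd: "hausdorff_pre s \<delta> (\<Union>i. A i) \<le> (\<Sum>i. hausdorff_pre s \<delta> (A i))"
  for A :: "nat \<Rightarrow> 'a::metric_space set"
proof (rule ennreal_le_epsilon)
  fix e :: real assume e: "e > 0" and fin: "(\<Sum>i. hausdorff_pre s \<delta> (A i)) < top"
  let ?v = "\<lambda>C::'a set. ennreal (hausdorff_const s * diameter C powr s)"
  have "\<exists>C. A i \<subseteq> (\<Union>j. C j) \<and> (\<forall>j. bounded (C j) \<and> diameter (C j) \<le> \<delta>) \<and>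
     (\<Sum>j. ?v (C j)) \<le> hausdorff_pre s \<delta> (A i) + ennreal (e * (1 / 2) ^ Suc i)" for i :: nat
  proof -
    have "hausdorff_pre s \<delta> (A i) \<noteq> \<infinity>" using ennreal_suminf_lessD[OF fin, of i] by simp
    then obtain C where "A i \<subseteq> (\<Union>j. C j) \<and> (\<forall>j. bounded (C j) \<and> diameter (C j) \<le> \<delta>)"
      "(\<Sum>j. ?v (C j)) < hausdorff_pre s \<delta> (A i) + ennreal (e * (1 / 2) ^ Suc i)"
      using INF_approx_ennreal[of "e * (1 / 2) ^ Suc i" "hausdorff_pre s \<delta> (A i)", OF _ hausdorff_pre_def] e
      by auto
    then show ?thesis by (intro exI[of _ C]) (simp add: less_imp_le)
  qed
  then obtain C where C: "\<And>i. A i \<subseteq> (\<Union>j. C i j)" "\<And>i j. bounded (C i j)" "\<And>i j. diameter (C i j) \<le> \<delta>"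
     "\<And>i. (\<Sum>j. ?v (C i j)) \<le> hausdorff_pre s \<delta> (A i) + ennreal (e * (1 / 2) ^ Suc i)"
    by metis
  define D where "D n = (case prod_decode n of (i, j) \<Rightarrow> C i j)" for n
  have "hausdorff_pre s \<delta> (\<Union>i. A i) \<le> (\<Sum>n. ?v (D n))"
    unfolding hausdorff_pre_def
  proof (rule INF_lower, clarsimp, intro conjI)
    show "(\<Union>i. A i) \<subseteq> (\<Union>n. D n)"
    proof clarify
      fix x i assume "x \<in> A i"
      then obtain j where "x \<in> C i j" using C(1) by blast
      then have "x \<in> D (prod_encode (i, j))" by (simp add: D_def)
      then show "x \<in> (\<Union>n. D n)" by blast
    qed
  qed (auto simp: D_def C split: prod.splits)
  also have "\<dots> = (\<Sum>i. \<Sum>j. ?v (C i j))"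
    using suminf_ennreal_2dimen[where f = "\<lambda>(i, j). ?v (C i j)" and g = "\<lambda>i. \<Sum>j. ?v (C i j)"]
    by (simp add: D_def case_prod_unfold)
  also have "\<dots> \<le> (\<Sum>i. hausdorff_pre s \<delta> (A i) + ennreal (e * (1 / 2) ^ Suc i))"
    by (intro suminf_le C(4)) auto
  also have "\<dots> = (\<Sum>i. hausdorff_pre s \<delta> (A i)) + (\<Sum>i. ennreal (e * (1 / 2) ^ Suc i))"
    by (intro suminf_add[symmetric]) auto
  also have "(\<Sum>i. ennreal (e * (1 / 2) ^ Suc i)) = ennreal e"
    using sums_mult[OF power_half_series, of e] e by (intro sums_unique[symmetric]) (simp add: sums_ennreal)
  finally show "hausdorff_pre s \<delta> (\<Union>i. A i) \<le> (\<Sum>i. hausdorff_pre s \<delta> (A i)) + ennreal e" .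
qed

lemma hausdorff_measure_subadd: "hausdorff_measure s (\<Union>i. A i) \<le> (\<Sum>i. hausdorff_measure s (A i))"
  for A :: "nat \<Rightarrow> 'a::metric_space set"
  unfolding hausdorff_measure_def[of s "\<Union>i. A i"]
proof (rule SUP_least)
  fix \<delta> :: real assume "\<delta> \<in> {0<..}"
  then have "hausdorff_pre s \<delta> (A i) \<le> hausdorff_measure s (A i)" for i
    unfolding hausdorff_measure_def by (rule SUP_upper)
  then show "hausdorff_pre s \<delta> (\<Union>i. A i) \<le> (\<Sum>i. hausdorff_measure s (A i))"
    by (intro order_trans[OF hausdorff_pre_subadd] suminf_le) auto
qed

text \<open>A set of diameter at most \<open>\<delta> < d\<close> cannot meet both \<open>A\<close>
  and \<open>B\<close>, so a cover of the union splits into two covers with the same total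
  cost.\<close>

lemma hausdorff_pre_separated:
  fixes A B :: "'a::metric_space set"
  assumes d: "0 < \<delta>" "\<delta> < d" and sep: "\<And>x y. x \<in> A \<Longrightarrow> y \<in> B \<Longrightarrow> dist x y \<ge> d"
  shows "hausdorff_pre s \<delta> A + hausdorff_pre s \<delta> B \<le> hausdorff_pre s \<delta> (A \<union> B)"
  unfolding hausdorff_pre_def[of s \<delta> "A \<union> B"]
proof (rule INF_greatest, clarify)
  fix C :: "nat \<Rightarrow> 'a set" assume C: "A \<union> B \<subseteq> (\<Union>i. C i)" "\<forall>i. bounded (C i) \<and> diameter (C i) \<le> \<delta>"
  let ?v = "\<lambda>C::'a set. ennreal (hausdorff_const s * diameter C powr s)"
  define C1 where "C1 i = (if C i \<inter> A \<noteq> {} then C i else {})" for i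
  define C2 where "C2 i = (if C i \<inter> A \<noteq> {} then {} else C i)" for i
  have A: "A \<subseteq> (\<Union>i. C1 i)"
  proof
    fix x assume "x \<in> A"
    moreover obtain i where "x \<in> C i" using C(1) \<open>x \<in> A\<close> by blast
    ultimately have "x \<in> C1 i" by (auto simp: C1_def)
    then show "x \<in> (\<Union>i. C1 i)" by blast
  qed
  have B: "B \<subseteq> (\<Union>i. C2 i)"
  proof
    fix y assume y: "y \<in> B"
    then obtain i where i: "y \<in> C i" using C(1) by blast
    have "C i \<inter> A = {}"
    proof (rule ccontr)
      assume "C i \<inter> A \<noteq> {}"
      then obtain x where x: "x \<in> C i" "x \<in> A" by blast
      have "dist x y \<le> diameter (C i)" using C(2) x(1) i by (intro diameter_bounded_bound) auto
      then show False using sep[OF x(2) y] C(2)[rule_format, of i] d by linarith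
    qed
    then have "y \<in> C2 i" using i by (simp add: C2_def)
    then show "y \<in> (\<Union>i. C2 i)" by blast
  qed
  have "hausdorff_pre s \<delta> A \<le> (\<Sum>i. ?v (C1 i))"
    unfolding hausdorff_pre_def using A C d by (intro INF_lower) (auto simp: C1_def diameter_empty)
  moreover have "hausdorff_pre s \<delta> B \<le> (\<Sum>i. ?v (C2 i))"
    unfolding hausdorff_pre_def using B C d by (intro INF_lower) (auto simp: C2_def diameter_empty)
  ultimately have "hausdorff_pre s \<delta> A + hausdorff_pre s \<delta> B \<le> (\<Sum>i. ?v (C1 i)) + (\<Sum>i. ?v (C2 i))"
    by (rule add_mono)
  also have "\<dots> = (\<Sum>i. ?v (C1 i) + ?v (C2 i))" by (intro suminf_add) auto
  also have "(\<lambda>i. ?v (C1 i) + ?v (C2 i)) = (\<lambda>i. ?v (C i))"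
    by (auto simp: fun_eq_iff C1_def C2_def diameter_empty)
  finally show "hausdorff_pre s \<delta> A + hausdorff_pre s \<delta> B \<le> (\<Sum>i. ?v (C i))" .
qed

text \<open>The approximating measures are antitone in \<open>\<delta>\<close>: this merges the two
  suprema into one and allows \<open>\<delta>\<close> to be cut down below \<open>d\<close>.\<close>

lemma hausdorff_measure_separated:
  fixes A B :: "'a::metric_space set"
  assumes d: "0 < d" and sep: "\<And>x y. x \<in> A \<Longrightarrow> y \<in> B \<Longrightarrow> dist x y \<ge> d"
  shows "hausdorff_measure s A + hausdorff_measure s B \<le> hausdorff_measure s (A \<union> B)"
proof -
  have "hausdorff_measure s A + hausdorff_measure s B = (SUP \<delta>\<in>{0<..}. hausdorff_pre s \<delta> A + hausdorff_pre s \<delta> B)"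
    unfolding hausdorff_measure_def
  proof (rule SUP_add_directed_ennreal[symmetric])
    fix i j :: real assume "i \<in> {0<..}" "j \<in> {0<..}"
    then show "\<exists>k\<in>{0<..}. hausdorff_pre s i A + hausdorff_pre s j B \<le> hausdorff_pre s k A + hausdorff_pre s k B"
      by (intro bexI[of _ "min i j"] add_mono hausdorff_pre_antimono) auto
  qed
  also have "\<dots> \<le> hausdorff_measure s (A \<union> B)"
  proof (rule SUP_least)
    fix \<delta> :: real assume "\<delta> \<in> {0<..}"
    then have m: "min \<delta> (d / 2) > 0" "min \<delta> (d / 2) < d" using d by auto
    have "hausdorff_pre s \<delta> A + hausdorff_pre s \<delta> B \<le> hausdorff_pre s (min \<delta> (d / 2)) A + hausdorff_pre s (min \<delta> (d / 2)) B"
      by (intro add_mono hausdorff_pre_antimono) auto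
    also have "\<dots> \<le> hausdorff_pre s (min \<delta> (d / 2)) (A \<union> B)" by (rule hausdorff_pre_separated[OF m sep])
    also have "\<dots> \<le> hausdorff_measure s (A \<union> B)"
      unfolding hausdorff_measure_def using m by (intro SUP_upper) auto
    finally show "hausdorff_pre s \<delta> A + hausdorff_pre s \<delta> B \<le> hausdorff_measure s (A \<union> B)" .
  qed
  finally show ?thesis .
qed

definition hausdorff_borel :: "real \<Rightarrow> 'a::metric_space measure" where
  "hausdorff_borel s = measure_of UNIV (sets borel) (hausdorff_measure s)"

lemma sets_hausdorff_borel [simp, measurable_cong]: "sets (hausdorff_borel s) = sets borel"
  unfolding hausdorff_borel_def using sets.sigma_sets_eq[of borel] by simp

lemma space_hausdorff_borel [simp]: "space (hausdorff_borel s) = UNIV"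
  unfolding hausdorff_borel_def by (simp add: space_measure_of_conv)

lemma emeasure_hausdorff_borel:
  assumes "A \<in> sets borel"
  shows "emeasure (hausdorff_borel s) A = hausdorff_measure s A"
proof -
  have "measure_space UNIV (sets borel) (hausdorff_measure s :: 'a set \<Rightarrow> ennreal)"
    by (rule metric_outer_measure_borel)
      (auto intro: hausdorff_measure_mono hausdorff_measure_empty hausdorff_measure_subadd hausdorff_measure_separated)
  then show ?thesis
    unfolding hausdorff_borel_def measure_space_def using assms
    by (intro emeasure_measure_of_sigma) auto
qed

section \<open>Hausdorff measure under similarities\<close>

text \<open>The images of a \<open>\<delta> / r\<close> cover form a \<open>\<delta>\<close> cover
  of cost multiplied by \<open>r powr s\<close>. The factor is first moved to the left as
  \<open>1 / r powr s\<close>, so that the infimum on the right can be bounded cover by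
  cover.\<close>

lemma hausdorff_measure_similarity_le:
  fixes f :: "'a::real_normed_vector \<Rightarrow> 'b::real_normed_vector"
  assumes f: "\<And>x y. dist (f x) (f y) = r * dist x y" and r: "r > 0"
  shows "hausdorff_measure s (f ` A) \<le> ennreal (r powr s) * hausdorff_measure s A"
  unfolding hausdorff_measure_def[of s "f ` A"]
proof (rule SUP_least)
  fix \<delta> :: real assume \<delta>: "\<delta> \<in> {0<..}"
  have diam: "bounded (f ` C) \<and> diameter (f ` C) = r * diameter C" if "bounded C" for C
  proof
    show b: "bounded (f ` C)"
    proof -
      obtain a M where M: "\<forall>y\<in>C. dist a y \<le> M" using \<open>bounded C\<close> unfolding bounded_def by blast
      show ?thesis unfolding bounded_def using M r
        by (intro exI[of _ "f a"] exI[of _ "r * M"]) (auto simp: f intro: mult_left_mono)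
    qed
    show "diameter (f ` C) = r * diameter C"
    proof (rule antisym)
      show "diameter (f ` C) \<le> r * diameter C"
      proof (rule diameter_le)
        show "f ` C \<noteq> {} \<or> 0 \<le> r * diameter C" using diameter_ge_0[OF that] r by simp
        fix x y assume "x \<in> f ` C" "y \<in> f ` C"
        then show "norm (x - y) \<le> r * diameter C"
          using diameter_bounded_bound[OF that] r by (auto simp: f simp flip: dist_norm intro!: mult_left_mono)
      qed
      have "diameter C \<le> diameter (f ` C) / r"
      proof (rule diameter_le)
        show "C \<noteq> {} \<or> 0 \<le> diameter (f ` C) / r" using diameter_ge_0[OF b] r by simp
        fix x y assume "x \<in> C" "y \<in> C"
        then have "r * dist x y \<le> diameter (f ` C)" using diameter_bounded_bound[OF b, of "f x" "f y"] by (simp add: f)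
        then show "norm (x - y) \<le> diameter (f ` C) / r" using r by (simp add: field_simps flip: dist_norm)
      qed
      then show "r * diameter C \<le> diameter (f ` C)" using r by (simp add: field_simps)
    qed
  qed
  let ?v = "\<lambda>d. ennreal (hausdorff_const s * d powr s)"
  have rs: "ennreal (1 / r powr s) * ennreal (r powr s) = 1"
    using r by (simp flip: ennreal_mult ennreal_1)
  have "ennreal (1 / r powr s) * hausdorff_pre s \<delta> (f ` A) \<le> hausdorff_pre s (\<delta> / r) A"
    unfolding hausdorff_pre_def[of s "\<delta> / r"]
  proof (rule INF_greatest, clarify)
    fix C :: "nat \<Rightarrow> 'a set" assume C: "A \<subseteq> (\<Union>i. C i)" "\<forall>i. bounded (C i) \<and> diameter (C i) \<le> \<delta> / r"
    have "hausdorff_pre s \<delta> (f ` A) \<le> (\<Sum>i. ?v (diameter (f ` C i)))"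
      unfolding hausdorff_pre_def
    proof (rule INF_lower, clarsimp, intro conjI allI)
      show "f ` A \<subseteq> (\<Union>i. f ` C i)" using C(1) by blast
      show "bounded (f ` C i)" for i using diam C(2) by blast
      show "diameter (f ` C i) \<le> \<delta>" for i using diam[of "C i"] C(2)[rule_format, of i] r by (simp add: field_simps)
    qed
    also have "\<dots> = (\<Sum>i. ennreal (r powr s) * ?v (diameter (C i)))"
    proof (rule arg_cong[where f = suminf], rule ext)
      fix i
      have "diameter (C i) \<ge> 0" using C(2) by (intro diameter_ge_0) auto
      then have "hausdorff_const s * (r * diameter (C i)) powr s = r powr s * (hausdorff_const s * diameter (C i) powr s)"
        using r by (simp add: powr_mult)
      then show "?v (diameter (f ` C i)) = ennreal (r powr s) * ?v (diameter (C i))"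
        using diam[THEN conjunct2, of "C i"] C(2) by (simp only: ennreal_mult' powr_ge_zero)
    qed
    also have "\<dots> = ennreal (r powr s) * (\<Sum>i. ?v (diameter (C i)))" by simp
    finally have "ennreal (1 / r powr s) * hausdorff_pre s \<delta> (f ` A) \<le> ennreal (1 / r powr s) * (ennreal (r powr s) * (\<Sum>i. ?v (diameter (C i))))"
      by (rule mult_left_mono) simp
    then show "ennreal (1 / r powr s) * hausdorff_pre s \<delta> (f ` A) \<le> (\<Sum>i. ?v (diameter (C i)))"
      unfolding mult.assoc[symmetric] rs by simp
  qed
  then have "ennreal (r powr s) * (ennreal (1 / r powr s) * hausdorff_pre s \<delta> (f ` A)) \<le> ennreal (r powr s) * hausdorff_pre s (\<delta> / r) A"
    by (rule mult_left_mono) simp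
  then have "hausdorff_pre s \<delta> (f ` A) \<le> ennreal (r powr s) * hausdorff_pre s (\<delta> / r) A"
    unfolding mult.assoc[symmetric] mult.commute[of "ennreal (r powr s)" "ennreal (1 / r powr s)"] rs by simp
  also have "\<dots> \<le> ennreal (r powr s) * hausdorff_measure s A"
    unfolding hausdorff_measure_def using \<delta> r by (intro mult_left_mono SUP_upper) auto
  finally show "hausdorff_pre s \<delta> (f ` A) \<le> ennreal (r powr s) * hausdorff_measure s A" .
qed

text \<open>The reverse inequality is the previous one for \<open>inv f\<close>, which is a
  similarity of ratio \<open>1 / r\<close> on the whole space because \<open>f\<close> is
  onto.\<close>

lemma hausdorff_measure_similarity:
  fixes f :: "'a::real_normed_vector \<Rightarrow> 'b::real_normed_vector"
  assumes f: "\<And>x y. dist (f x) (f y) = r * dist x y" and r: "r > 0" and surj: "surj f"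
  shows "hausdorff_measure s (f ` A) = ennreal (r powr s) * hausdorff_measure s A"
proof (rule antisym)
  show "hausdorff_measure s (f ` A) \<le> ennreal (r powr s) * hausdorff_measure s A"
    by (rule hausdorff_measure_similarity_le[OF f r])
  have inj: "inj f"
  proof (rule injI)
    fix x y assume "f x = f y"
    then show "x = y" using f[of x y] r by simp
  qed
  have g: "dist (inv f x) (inv f y) = (1 / r) * dist x y" for x y
    using f[of "inv f x" "inv f y"] r surj by (simp add: surj_f_inv_f)
  have "hausdorff_measure s A = hausdorff_measure s (inv f ` f ` A)" using inj by (simp add: image_inv_f_f)
  also have "\<dots> \<le> ennreal ((1 / r) powr s) * hausdorff_measure s (f ` A)"
    using r by (intro hausdorff_measure_similarity_le[OF g]) auto
  finally have "ennreal (r powr s) * hausdorff_measure s A \<le> ennreal (r powr s) * (ennreal ((1 / r) powr s) * hausdorff_measure s (f ` A))"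
    by (rule mult_left_mono) simp
  also have "\<dots> = hausdorff_measure s (f ` A)"
    unfolding mult.assoc[symmetric] using r by (simp add: powr_mult[symmetric] flip: ennreal_mult)
  finally show "ennreal (r powr s) * hausdorff_measure s A \<le> hausdorff_measure s (f ` A)" .
qed

section \<open>The cone measure on the sphere and polar coordinates\<close>

lemma borel_measurable_sgn_euclidean [measurable]: "(sgn :: 'a::euclidean_space \<Rightarrow> 'a) \<in> borel_measurable borel"
proof -
  have "(sgn :: 'a \<Rightarrow> 'a) = (\<lambda>x. inverse (norm x) *\<^sub>R x)" by (auto simp: sgn_div_norm)
  then show ?thesis by simp
qed

text \<open>This is the surface measure of the unit sphere divided by the dimension:
  \<open>A\<close> receives the volume of the cone over it inside the unit ball. The origin, where
  \<open>sgn\<close> is 0, is a null set.\<close>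

definition cone_measure :: "'a::euclidean_space measure" where
  "cone_measure = distr (density lborel (indicator (cball 0 1))) borel sgn"

abbreviation unit_ball_vol :: "'a::euclidean_space itself \<Rightarrow> real" where
  "unit_ball_vol T \<equiv> measure lborel (cball (0::'a) 1)"

lemma sets_cone_measure [simp, measurable_cong]: "sets cone_measure = sets borel"
  and space_cone_measure [simp]: "space cone_measure = UNIV"
  by (simp_all add: cone_measure_def)

lemma emeasure_cone_measure:
  assumes [measurable]: "A \<in> sets borel"
  shows "emeasure cone_measure A = emeasure lborel {x::'a::euclidean_space. norm x \<le> 1 \<and> sgn x \<in> A}"
proof -
  have [measurable]: "{x::'a. sgn x \<in> A} \<in> sets borel"
    using measurable_sets[OF borel_measurable_sgn_euclidean assms] by (simp add: vimage_def)
  have "emeasure cone_measure A = emeasure (density lborel (indicator (cball 0 1))) {x::'a. sgn x \<in> A}"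
    unfolding cone_measure_def by (subst emeasure_distr) (auto simp: vimage_def)
  also have "\<dots> = (\<integral>\<^sup>+x. indicator (cball 0 1) x * indicator {x::'a. sgn x \<in> A} x \<partial>lborel)"
    by (rule emeasure_density) (auto intro!: borel_measurable_indicator borel_closed)
  also have "\<dots> = (\<integral>\<^sup>+x. indicator {x::'a. norm x \<le> 1 \<and> sgn x \<in> A} x \<partial>lborel)"
    by (intro nn_integral_cong) (auto simp: indicator_def)
  also have "\<dots> = emeasure lborel {x::'a. norm x \<le> 1 \<and> sgn x \<in> A}"
  proof (rule nn_integral_indicator)
    have "{x::'a. norm x \<le> 1 \<and> sgn x \<in> A} = cball 0 1 \<inter> {x. sgn x \<in> A}" by auto
    then show "{x::'a. norm x \<le> 1 \<and> sgn x \<in> A} \<in> sets lborel" by simp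
  qed
  finally show ?thesis .
qed

lemma emeasure_lborel_scaled:
  fixes A :: "'a::euclidean_space set"
  assumes "A \<in> sets borel" "(\<lambda>x. r *\<^sub>R x) ` A \<in> sets borel" "r > 0"
  shows "emeasure lborel ((\<lambda>x. r *\<^sub>R x) ` A) = ennreal (r ^ DIM('a)) * emeasure lborel A"
proof -
  have "emeasure lebesgue ((\<lambda>x. r *\<^sub>R x + 0) ` A) = ennreal (r ^ DIM('a)) * emeasure lebesgue A"
    using emeasure_lebesgue_affine[of r 0 A] assms(3) by simp
  then show ?thesis using assms by simp
qed

lemma sgn_in_measurable [measurable]:
  "A \<in> sets borel \<Longrightarrow> {x::'a::euclidean_space. norm x \<le> t \<and> sgn x \<in> A} \<in> sets borel"
proof -
  assume [measurable]: "A \<in> sets borel"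
  have "{x::'a. sgn x \<in> A} \<in> sets borel"
    using measurable_sets[OF borel_measurable_sgn_euclidean \<open>A \<in> sets borel\<close>] by (simp add: vimage_def)
  moreover have "{x::'a. norm x \<le> t \<and> sgn x \<in> A} = cball 0 t \<inter> {x. sgn x \<in> A}" by auto
  ultimately show ?thesis by simp
qed

lemma emeasure_sector:
  assumes A: "A \<in> sets borel" and t: "t \<ge> 0"
  shows "emeasure lborel {x::'a::euclidean_space. norm x \<le> t \<and> sgn x \<in> A} = ennreal (t ^ DIM('a)) * emeasure cone_measure A"
proof (cases "t = 0")
  case True
  have "emeasure lborel {x::'a. norm x \<le> t \<and> sgn x \<in> A} \<le> emeasure lborel {0::'a}"
    using True by (intro emeasure_mono) auto
  then show ?thesis using True by (simp add: zero_power)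
next
  case False
  then have t: "t > 0" using assms by simp
  have "(\<lambda>x. t *\<^sub>R x) ` {x::'a. norm x \<le> 1 \<and> sgn x \<in> A} = {x. norm x \<le> t \<and> sgn x \<in> A}" (is "?f ` ?B = ?C")
  proof (rule set_eqI, rule iffI)
    fix y assume "y \<in> ?f ` ?B"
    then show "y \<in> ?C" using t by (auto simp: sgn_scaleR mult_left_le)
  next
    fix y assume y: "y \<in> ?C"
    have "y = ?f (y /\<^sub>R t)" using t by simp
    moreover have "y /\<^sub>R t \<in> ?B" using y t by (auto simp: sgn_scaleR field_simps)
    ultimately show "y \<in> ?f ` ?B" by blast
  qed
  then show ?thesis
    using emeasure_lborel_scaled[of ?B t] t A by (simp add: emeasure_cone_measure)
qed

lemma finite_measure_cone_measure: "finite_measure (cone_measure :: 'a::euclidean_space measure)"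
proof
  have "emeasure lborel {x::'a. norm x \<le> 1} = emeasure lborel (cball (0::'a) 1)"
    by (rule arg_cong[where f = "emeasure lborel"]) auto
  then show "emeasure (cone_measure :: 'a measure) (space cone_measure) \<noteq> \<infinity>"
    using emeasure_lborel_cball_finite[of "0::'a" 1] by (simp add: emeasure_cone_measure)
qed

lemma emeasure_cone_UNIV: "emeasure (cone_measure :: 'a::euclidean_space measure) UNIV = ennreal (unit_ball_vol TYPE('a))"
proof -
  have "emeasure (cone_measure :: 'a measure) UNIV = emeasure lborel {x::'a. norm x \<le> 1}"
    by (simp add: emeasure_cone_measure)
  also have "{x::'a. norm x \<le> 1} = cball 0 1" by auto
  also have "emeasure lborel (cball (0::'a) 1) = ennreal (unit_ball_vol TYPE('a))"
    using emeasure_lborel_cball_finite[of "0::'a" 1] by (intro emeasure_eq_ennreal_measure) auto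
  finally show ?thesis .
qed

lemma unit_ball_vol_pos: "unit_ball_vol TYPE('a::euclidean_space) > 0"
  using content_cball_pos[of 1 "0::'a"] by simp

lemma emeasure_cone_sphere: "emeasure (cone_measure :: 'a::euclidean_space measure) (- sphere 0 1) = 0"
proof -
  have "emeasure (cone_measure :: 'a measure) (- sphere 0 1) = emeasure lborel {x::'a. norm x \<le> 1 \<and> sgn x \<in> - sphere 0 1}"
    by (intro emeasure_cone_measure) auto
  also have "\<dots> \<le> emeasure lborel {0::'a}"
    by (intro emeasure_mono) (auto simp: norm_sgn)
  finally show ?thesis by simp
qed

lemma AE_cone_sphere: "AE u in (cone_measure :: 'a::euclidean_space measure). norm u = 1"
  by (rule AE_I[OF _ emeasure_cone_sphere]) auto

section \<open>Polar coordinates as a product of measures\<close>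

text \<open>Its density would be n \<omega> t^(n-1). Working with the masses of the sets
  \<open>{..t}\<close> instead gives polar coordinates without a change of variables.\<close>

definition radial_measure :: "'a::euclidean_space itself \<Rightarrow> real measure" where
  "radial_measure T = distr (lborel :: 'a measure) borel norm"

lemma sets_radial_measure [simp, measurable_cong]: "sets (radial_measure T) = sets borel"
  and space_radial_measure [simp]: "space (radial_measure T) = UNIV"
  by (simp_all add: radial_measure_def)

lemma emeasure_radial: "B \<in> sets borel \<Longrightarrow> emeasure (radial_measure TYPE('a::euclidean_space)) B = emeasure lborel {x::'a. norm x \<in> B}"
  unfolding radial_measure_def by (subst emeasure_distr) (auto simp: vimage_def)

lemma emeasure_radial_atMost:
  "t \<ge> 0 \<Longrightarrow> emeasure (radial_measure TYPE('a::euclidean_space)) {..t} = ennreal (unit_ball_vol TYPE('a) * t ^ DIM('a))"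
  "t < 0 \<Longrightarrow> emeasure (radial_measure TYPE('a::euclidean_space)) {..t} = 0"
proof -
  show "emeasure (radial_measure TYPE('a::euclidean_space)) {..t} = ennreal (unit_ball_vol TYPE('a) * t ^ DIM('a))" if "t \<ge> 0"
    using emeasure_sector[OF _ that, of "UNIV :: 'a set"] that
    by (simp add: emeasure_radial emeasure_cone_UNIV ennreal_mult' mult.commute)
  show "emeasure (radial_measure TYPE('a::euclidean_space)) {..t} = 0" if "t < 0"
  proof -
    have "{x::'a. norm x \<le> t} = {}" using that by (auto simp: not_le intro: less_le_trans)
    then show ?thesis by (simp add: emeasure_radial)
  qed
qed

lemma sigma_finite_radial: "sigma_finite_measure (radial_measure TYPE('a::euclidean_space))"
proof
  let ?A = "range (\<lambda>i::nat. {..real i})"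
  have "\<Union>?A = UNIV" by (auto intro: real_arch_simple)
  moreover have "emeasure (radial_measure TYPE('a)) {..real i} \<noteq> \<infinity>" for i
    by (simp add: emeasure_radial_atMost)
  ultimately show "\<exists>A. countable A \<and> A \<subseteq> sets (radial_measure TYPE('a)) \<and> \<Union>A = space (radial_measure TYPE('a)) \<and>
       (\<forall>a\<in>A. emeasure (radial_measure TYPE('a)) a \<noteq> \<infinity>)"
    by (intro exI[of _ ?A]) auto
qed

text \<open>For fixed \<open>A\<close> both sides are measures in \<open>B\<close>, compared on the
  half-lines \<open>{..t}\<close>. The factor \<open>unit_ball_vol\<close> appears because each of
  the two measures on the left is already normalised by the volume of the unit ball.\<close>

lemma polar_rectangle:
  assumes A [measurable]: "A \<in> sets (borel :: 'a::euclidean_space measure)" and B [measurable]: "B \<in> sets borel"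
  shows "emeasure cone_measure A * emeasure (radial_measure TYPE('a)) B =
    ennreal (unit_ball_vol TYPE('a)) * emeasure lborel {x::'a. norm x \<in> B \<and> sgn x \<in> A}"
proof -
  let ?S = "{x::'a. sgn x \<in> A}"
  have S [measurable]: "?S \<in> sets borel"
    using measurable_sets[OF borel_measurable_sgn_euclidean A] by (simp add: vimage_def)
  let ?M = "scale_measure (emeasure cone_measure A) (radial_measure TYPE('a))"
  let ?N = "scale_measure (ennreal (unit_ball_vol TYPE('a))) (distr (density lborel (indicator ?S)) borel norm)"
  have N: "emeasure ?N C = ennreal (unit_ball_vol TYPE('a)) * emeasure lborel {x::'a. norm x \<in> C \<and> sgn x \<in> A}"
    if C [measurable]: "C \<in> sets borel" for C
  proof -
    have "emeasure (distr (density lborel (indicator ?S)) borel norm) C = emeasure (density lborel (indicator ?S)) {x. norm x \<in> C}"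
      by (subst emeasure_distr) (auto simp: vimage_def)
    also have "\<dots> = (\<integral>\<^sup>+x. indicator ?S x * indicator {x. norm x \<in> C} x \<partial>lborel)"
      by (rule emeasure_density) (auto intro!: borel_measurable_indicator)
    also have "\<dots> = (\<integral>\<^sup>+x. indicator {x::'a. norm x \<in> C \<and> sgn x \<in> A} x \<partial>lborel)"
      by (intro nn_integral_cong) (auto simp: indicator_def)
    also have "\<dots> = emeasure lborel {x::'a. norm x \<in> C \<and> sgn x \<in> A}"
      by (rule nn_integral_indicator) measurable
    finally show ?thesis by (simp add: emeasure_scale_measure)
  qed
  have "?M = ?N"
  proof (rule measure_eqI_generator_eq[where E = "range atMost" and \<Omega> = UNIV and A = "\<lambda>i. {..real i}"])
    show "Int_stable (range atMost :: real set set)"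
      by (auto simp: Int_stable_def intro!: image_eqI[of _ _ "min _ _"])
    show "sets ?M = sigma_sets UNIV (range atMost)" "sets ?N = sigma_sets UNIV (range atMost)"
      by (simp_all add: borel_eq_atMost)
    show "(\<Union>i. {..real i}) = UNIV" by (auto intro: real_arch_simple)
    show "emeasure ?M {..real i} \<noteq> \<infinity>" for i
      using finite_measure.emeasure_finite[OF finite_measure_cone_measure, of A]
      by (simp add: emeasure_scale_measure emeasure_radial_atMost ennreal_mult_eq_top_iff)
    fix X :: "real set" assume "X \<in> range atMost"
    then obtain t where X: "X = {..t}" by auto
    show "emeasure ?M X = emeasure ?N X"
    proof (cases "t \<ge> 0")
      case True
      then show ?thesis unfolding X N[OF borel_closed[OF closed_atMost]]
        using emeasure_sector[OF A True]
        by (simp add: emeasure_scale_measure emeasure_radial_atMost ennreal_mult' mult_ac)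
    next
      case False
      then have "{x::'a. norm x \<le> t \<and> sgn x \<in> A} = {}" by (auto simp: not_le intro: less_le_trans)
      then have "emeasure lborel {x::'a. norm x \<le> t \<and> sgn x \<in> A} = 0" by (simp only: emeasure_empty)
      then show ?thesis unfolding X N[OF borel_closed[OF closed_atMost]]
        using False by (simp add: emeasure_scale_measure emeasure_radial_atMost)
    qed
  qed auto
  then have "emeasure ?M B = emeasure ?N B" by simp
  then show ?thesis unfolding N[OF B] by (simp add: emeasure_scale_measure)
qed

lemma polar_pair_measure:
  "(cone_measure :: 'a::euclidean_space measure) \<Otimes>\<^sub>M radial_measure TYPE('a) =
   scale_measure (ennreal (unit_ball_vol TYPE('a))) (distr lborel (borel \<Otimes>\<^sub>M borel) (\<lambda>x. (sgn x, norm x)))"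
proof (rule pair_measure_eqI)
  show "sigma_finite_measure (cone_measure :: 'a measure)"
    using finite_measure_cone_measure finite_measure.axioms(1) by blast
  show "sigma_finite_measure (radial_measure TYPE('a))" by (rule sigma_finite_radial)
  show "sets (cone_measure \<Otimes>\<^sub>M radial_measure TYPE('a)) =
    sets (scale_measure (ennreal (unit_ball_vol TYPE('a))) (distr (lborel::'a measure) (borel \<Otimes>\<^sub>M borel) (\<lambda>x. (sgn x, norm x))))"
    by (simp cong: sets_pair_measure_cong)
  fix A B assume "A \<in> sets (cone_measure :: 'a measure)" "B \<in> sets (radial_measure TYPE('a))"
  then have [measurable]: "A \<in> sets borel" "B \<in> sets borel" by auto
  have "emeasure (distr (lborel::'a measure) (borel \<Otimes>\<^sub>M borel) (\<lambda>x. (sgn x, norm x))) (A \<times> B) =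
    emeasure lborel {x::'a. norm x \<in> B \<and> sgn x \<in> A}"
    by (subst emeasure_distr) (auto intro!: arg_cong[where f = "emeasure lborel"])
  then show "emeasure cone_measure A * emeasure (radial_measure TYPE('a)) B =
    emeasure (scale_measure (ennreal (unit_ball_vol TYPE('a))) (distr lborel (borel \<Otimes>\<^sub>M borel) (\<lambda>x. (sgn x, norm x)))) (A \<times> B)"
    by (simp add: emeasure_scale_measure polar_rectangle)
qed

lemma polar_nn_integral:
  assumes [measurable]: "f \<in> borel_measurable (borel \<Otimes>\<^sub>M borel)"
  shows "ennreal (unit_ball_vol TYPE('a::euclidean_space)) * (\<integral>\<^sup>+x. f (sgn x, norm (x::'a)) \<partial>lborel) =
    (\<integral>\<^sup>+u. \<integral>\<^sup>+t. f (u, t) \<partial>radial_measure TYPE('a) \<partial>(cone_measure :: 'a measure))"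
proof -
  interpret R: sigma_finite_measure "radial_measure TYPE('a)" by (rule sigma_finite_radial)
  have "(\<integral>\<^sup>+u. \<integral>\<^sup>+t. f (u, t) \<partial>radial_measure TYPE('a) \<partial>(cone_measure :: 'a measure)) =
     (\<integral>\<^sup>+z. f z \<partial>(cone_measure \<Otimes>\<^sub>M radial_measure TYPE('a)))"
    by (rule R.nn_integral_fst) (simp cong: measurable_cong_sets sets_pair_measure_cong)
  also have "\<dots> = ennreal (unit_ball_vol TYPE('a)) * (\<integral>\<^sup>+x. f (sgn x, norm (x::'a)) \<partial>lborel)"
    unfolding polar_pair_measure by (subst nn_integral_scale_measure) (auto simp: nn_integral_distr)
  finally show ?thesis by simp
qed

text \<open>Along a unit direction \<open>u\<close> the body is a segment of length
  \<open>g u\<close>, to which \<open>radial_measure\<close> gives \<omega> times the n-th power of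
  that length; this \<omega> cancels the one in the polar formula.\<close>

lemma emeasure_star_body:
  fixes g :: "'a::euclidean_space \<Rightarrow> real"
  assumes [measurable]: "g \<in> borel_measurable borel" and g: "\<And>u. norm u = 1 \<Longrightarrow> g u \<ge> 0"
  shows "emeasure lborel {x. norm x \<le> g (sgn x)} = (\<integral>\<^sup>+u. ennreal (g u ^ DIM('a)) \<partial>(cone_measure :: 'a measure))"
proof -
  let ?\<omega> = "unit_ball_vol TYPE('a)"
  have "ennreal ?\<omega> * emeasure lborel {x. norm x \<le> g (sgn x)} =
     ennreal ?\<omega> * (\<integral>\<^sup>+x. indicator {z. snd z \<le> g (fst z)} (sgn x, norm (x::'a)) \<partial>lborel)"
  proof -
    have "emeasure lborel {x. norm x \<le> g (sgn x)} = (\<integral>\<^sup>+x. indicator {x. norm x \<le> g (sgn x)} x \<partial>lborel)"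
      by (rule nn_integral_indicator[symmetric]) measurable
    also have "\<dots> = (\<integral>\<^sup>+x. indicator {z. snd z \<le> g (fst z)} (sgn x, norm (x::'a)) \<partial>lborel)"
      by (intro nn_integral_cong) (auto simp: indicator_def)
    finally show ?thesis by simp
  qed
  also have "\<dots> = (\<integral>\<^sup>+u. \<integral>\<^sup>+t. indicator {z. snd z \<le> g (fst z)} (u, t) \<partial>radial_measure TYPE('a) \<partial>(cone_measure :: 'a measure))"
    by (rule polar_nn_integral) measurable
  also have "\<dots> = (\<integral>\<^sup>+u. ennreal ?\<omega> * ennreal (g u ^ DIM('a)) \<partial>(cone_measure :: 'a measure))"
  proof (rule nn_integral_cong_AE, rule AE_mp[OF AE_cone_sphere], rule AE_I2, rule impI)
    fix u :: 'a assume "norm u = 1"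
    have "(\<integral>\<^sup>+t. indicator {z. snd z \<le> g (fst z)} (u, t) \<partial>radial_measure TYPE('a)) = (\<integral>\<^sup>+t. indicator {..g u} t \<partial>radial_measure TYPE('a))"
      by (intro nn_integral_cong) (auto simp: indicator_def)
    also have "\<dots> = ennreal ?\<omega> * ennreal (g u ^ DIM('a))"
      using g[OF \<open>norm u = 1\<close>] by (simp add: emeasure_radial_atMost ennreal_mult')
    finally show "(\<integral>\<^sup>+t. indicator {z. snd z \<le> g (fst z)} (u, t) \<partial>radial_measure TYPE('a)) = ennreal ?\<omega> * ennreal (g u ^ DIM('a))" .
  qed
  also have "\<dots> = ennreal ?\<omega> * (\<integral>\<^sup>+u. ennreal (g u ^ DIM('a)) \<partial>(cone_measure :: 'a measure))"
    by (rule nn_integral_cmult) simp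
  finally show ?thesis
    using unit_ball_vol_pos[where 'a = 'a] by (simp add: ennreal_mult_cancel_left)
qed


text \<open>Christensen's argument for the uniqueness of uniformly distributed measures: integrate the density
  of one measure in small balls against the other (Fatou and Fubini).\<close>
lemma uniform_measure_le_liminf:
  fixes \<mu> \<nu> :: "'a::euclidean_space measure"
  assumes "sigma_finite_measure \<mu>" "sigma_finite_measure \<nu>"
    and sets [measurable_cong]: "sets \<mu> = sets borel" "sets \<nu> = sets borel"
    and S [measurable]: "S \<in> sets borel" and null: "emeasure \<mu> (- S) = 0" "emeasure \<nu> (- S) = 0"
    and g: "\<And>x r. x \<in> S \<Longrightarrow> r > 0 \<Longrightarrow> emeasure \<mu> (ball x r) = ennreal (g r)"
    and h: "\<And>x r. x \<in> S \<Longrightarrow> r > 0 \<Longrightarrow> emeasure \<nu> (ball x r) = ennreal (h r)"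
    and pos: "\<And>r. r > 0 \<Longrightarrow> g r > 0" "\<And>r. r > 0 \<Longrightarrow> h r > 0"
    and U: "open U"
  shows "emeasure \<mu> U \<le> liminf (\<lambda>k. ennreal (g (1 / (real k + 1)) / h (1 / (real k + 1))) * emeasure \<nu> U)"
proof -
  interpret M: sigma_finite_measure \<mu> by fact
  interpret N: sigma_finite_measure \<nu> by fact
  interpret P: pair_sigma_finite \<mu> \<nu> ..
  have [measurable]: "U \<in> sets borel" using U by simp
  define r where "r k = 1 / (real k + 1)" for k :: nat
  have r: "r k > 0" for k by (simp add: r_def)
  let ?I = "\<lambda>k x. indicator (U \<inter> S) x * (\<integral>\<^sup>+y. indicator {z. dist (fst z) (snd z) < r k \<and> snd z \<in> U} (x, y) \<partial>\<nu>)"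
  have inner: "(\<integral>\<^sup>+y. indicator {z. dist (fst z) (snd z) < r k \<and> snd z \<in> U} (x, y) \<partial>\<nu>) = emeasure \<nu> (ball x (r k) \<inter> U)" for x k
  proof -
    have "(\<integral>\<^sup>+y. indicator {z. dist (fst z) (snd z) < r k \<and> snd z \<in> U} (x, y) \<partial>\<nu>) = (\<integral>\<^sup>+y. indicator (ball x (r k) \<inter> U) y \<partial>\<nu>)"
      by (intro nn_integral_cong) (auto simp: indicator_def)
    then show ?thesis using sets by simp
  qed
  have AES: "AE x in \<mu>. x \<in> S" "AE x in \<nu>. x \<in> S"
    using sets null by (auto intro!: AE_I[of _ _ "- S"])
  have "emeasure \<mu> U = (\<integral>\<^sup>+x. indicator U x \<partial>\<mu>)" using sets by simp
  \<comment> \<open>Small balls about a point of the open set \<open>U\<close> lie inside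
    \<open>U\<close>, so the normalised \<open>\<nu>\<close>-mass in the integrand is eventually 1
    there. Fatou's lemma then moves the liminf outside.\<close>
  also have "\<dots> \<le> (\<integral>\<^sup>+x. liminf (\<lambda>k. ennreal (1 / h (r k)) * ?I k x) \<partial>\<mu>)"
  proof (rule nn_integral_mono_AE, rule AE_mp[OF AES(1)], rule AE_I2, rule impI)
    fix x assume x: "x \<in> S"
    show "indicator U x \<le> liminf (\<lambda>k. ennreal (1 / h (r k)) * ?I k x)"
    proof (cases "x \<in> U")
      case True
      then obtain e where e: "e > 0" "ball x e \<subseteq> U" using U by (meson openE)
      have "eventually (\<lambda>k. r k < e) sequentially"
        unfolding r_def using e(1) by real_asymp
      then have "eventually (\<lambda>k. ennreal (1 / h (r k)) * ?I k x = 1) sequentially"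
      proof eventually_elim
        case (elim k)
        then have "ball x (r k) \<inter> U = ball x (r k)" using e(2) by (auto simp: subset_iff)
        then show ?case using x True h[OF x r] pos(2)[OF r, of k] by (simp add: inner flip: ennreal_mult')
      qed
      then have "liminf (\<lambda>k. ennreal (1 / h (r k)) * ?I k x) = liminf (\<lambda>k. 1)"
        by (rule Liminf_eq)
      then show ?thesis using True by (simp add: Liminf_const)
    qed simp
  qed
  also have "\<dots> \<le> liminf (\<lambda>k. \<integral>\<^sup>+x. ennreal (1 / h (r k)) * ?I k x \<partial>\<mu>)"
    by (rule nn_integral_liminf) measurable
  also have "\<dots> \<le> liminf (\<lambda>k. ennreal (g (r k) / h (r k)) * emeasure \<nu> U)"
  proof (rule Liminf_mono, rule always_eventually, rule allI)
    fix k
    have "(\<integral>\<^sup>+x. ennreal (1 / h (r k)) * ?I k x \<partial>\<mu>) = ennreal (1 / h (r k)) * (\<integral>\<^sup>+x. ?I k x \<partial>\<mu>)"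
      by (rule nn_integral_cmult) measurable
    \<comment> \<open>Without the indicator in \<open>x\<close> the relation between
      \<open>x\<close> and \<open>y\<close> is symmetric up to the condition on \<open>y\<close>;
      after the exchange of integrals the inner one is the \<open>\<mu>\<close>-mass of a ball about
      \<open>y\<close>, which is the same for all \<open>y\<close> in \<open>S\<close>.\<close>
    also have "(\<integral>\<^sup>+x. ?I k x \<partial>\<mu>) \<le> (\<integral>\<^sup>+x. (\<integral>\<^sup>+y. indicator {z. dist (fst z) (snd z) < r k \<and> snd z \<in> U} (x, y) \<partial>\<nu>) \<partial>\<mu>)"
      by (intro nn_integral_mono) (auto simp: indicator_def)
    also have "\<dots> = (\<integral>\<^sup>+y. (\<integral>\<^sup>+x. indicator {z. dist (fst z) (snd z) < r k \<and> snd z \<in> U} (x, y) \<partial>\<mu>) \<partial>\<nu>)"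
      by (rule P.Fubini'[symmetric]) measurable
    also have "\<dots> = (\<integral>\<^sup>+y. ennreal (g (r k)) * indicator U y \<partial>\<nu>)"
    proof (rule nn_integral_cong_AE, rule AE_mp[OF AES(2)], rule AE_I2, rule impI)
      fix y assume y: "y \<in> S"
      have "(\<integral>\<^sup>+x. indicator {z. dist (fst z) (snd z) < r k \<and> snd z \<in> U} (x, y) \<partial>\<mu>) = (\<integral>\<^sup>+x. indicator U y * indicator (ball y (r k)) x \<partial>\<mu>)"
        by (intro nn_integral_cong) (auto simp: indicator_def dist_commute)
      also have "\<dots> = indicator U y * emeasure \<mu> (ball y (r k))"
        using sets by (subst nn_integral_cmult) (auto intro!: borel_measurable_indicator)
      finally show "(\<integral>\<^sup>+x. indicator {z. dist (fst z) (snd z) < r k \<and> snd z \<in> U} (x, y) \<partial>\<mu>) = ennreal (g (r k)) * indicator U y"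
        using g[OF y r] by (simp add: mult.commute)
    qed
    also have "\<dots> = ennreal (g (r k)) * emeasure \<nu> U" using sets by (subst nn_integral_cmult) auto
    finally have "(\<integral>\<^sup>+x. ennreal (1 / h (r k)) * ?I k x \<partial>\<mu>) \<le> ennreal (1 / h (r k)) * (ennreal (g (r k)) * emeasure \<nu> U)"
      by (simp add: mult_left_mono)
    also have "\<dots> = ennreal (g (r k) / h (r k)) * emeasure \<nu> U"
      using pos[OF r, of k] by (simp add: mult.assoc[symmetric] flip: ennreal_mult')
    finally show "(\<integral>\<^sup>+x. ennreal (1 / h (r k)) * ?I k x \<partial>\<mu>) \<le> ennreal (g (r k) / h (r k)) * emeasure \<nu> U" .
  qed
  finally show ?thesis by (simp add: r_def)
qed

text \<open>Applied to the whole space in both directions, the comparison forces the ratio of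
  \<open>g\<close> and \<open>h\<close> at the radii 1/(k+1) to converge to the quotient of the
  total masses. With a convergent ratio the two comparisons give equality on every open set, and
  open sets determine the measures.\<close>

lemma uniform_measures_proportional:
  fixes \<mu> \<nu> :: "'a::euclidean_space measure"
  assumes fin: "finite_measure \<mu>" "finite_measure \<nu>"
    and sets: "sets \<mu> = sets borel" "sets \<nu> = sets borel"
    and S: "S \<in> sets borel" and null: "emeasure \<mu> (- S) = 0" "emeasure \<nu> (- S) = 0"
    and g: "\<And>x r. x \<in> S \<Longrightarrow> r > 0 \<Longrightarrow> emeasure \<mu> (ball x r) = ennreal (g r)"
    and h: "\<And>x r. x \<in> S \<Longrightarrow> r > 0 \<Longrightarrow> emeasure \<nu> (ball x r) = ennreal (h r)"
    and pos: "\<And>r. r > 0 \<Longrightarrow> g r > 0" "\<And>r. r > 0 \<Longrightarrow> h r > 0"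
    and nz: "emeasure \<mu> UNIV \<noteq> 0" "emeasure \<nu> UNIV \<noteq> 0"
  obtains c where "c > 0" "\<And>A. A \<in> sets borel \<Longrightarrow> emeasure \<mu> A = ennreal c * emeasure \<nu> A"
proof -
  interpret M: finite_measure \<mu> by fact
  interpret N: finite_measure \<nu> by fact
  define m where "m = measure \<mu> UNIV"
  define v where "v = measure \<nu> UNIV"
  have mv: "emeasure \<mu> UNIV = ennreal m" "emeasure \<nu> UNIV = ennreal v"
    by (simp_all add: m_def v_def M.emeasure_eq_measure N.emeasure_eq_measure)
  have mv0: "m > 0" "v > 0" using nz mv by (auto simp: m_def v_def zero_less_measure_iff M.emeasure_eq_measure N.emeasure_eq_measure)
  define a where "a k = g (1 / (real k + 1)) / h (1 / (real k + 1))" for k :: nat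
  have a0: "a k > 0" for k unfolding a_def by (intro divide_pos_pos pos) auto
  have le1: "emeasure \<mu> U \<le> liminf (\<lambda>k. ennreal (a k) * emeasure \<nu> U)" if "open U" for U
    unfolding a_def by (rule uniform_measure_le_liminf[OF M.sigma_finite_measure_axioms N.sigma_finite_measure_axioms sets S null g h pos that])
  have le2: "emeasure \<nu> U \<le> liminf (\<lambda>k. ennreal (1 / a k) * emeasure \<mu> U)" if "open U" for U
    using uniform_measure_le_liminf[OF N.sigma_finite_measure_axioms M.sigma_finite_measure_axioms sets(2,1) S null(2,1) h g pos(2,1) that] by (simp add: a_def)
  have lim: "a \<longlonglongrightarrow> m / v"
  proof (rule order_tendstoI)
    fix y assume y: "y < m / v"
    show "\<forall>\<^sub>F k in sequentially. y < a k"
    proof (cases "y > 0")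
      case True
      have "ennreal (y * v) < emeasure \<mu> UNIV" using y mv0 True by (simp add: mv ennreal_lessI field_simps)
      then have "ennreal (y * v) < liminf (\<lambda>k. ennreal (a k) * emeasure \<nu> UNIV)" using le1[OF open_UNIV] by (rule less_le_trans)
      then have "\<forall>\<^sub>F k in sequentially. ennreal (y * v) < ennreal (a k) * emeasure \<nu> UNIV" by (rule less_LiminfD)
      then show ?thesis
      proof eventually_elim
        case (elim k)
        then have "ennreal (y * v) < ennreal (a k * v)" using a0[of k] by (simp add: mv ennreal_mult')
        then show ?case using mv0 True by (simp add: ennreal_less_iff)
      qed
    next
      case False
      then show ?thesis using a0 by (intro always_eventually allI) (metis le_less_trans not_less)
    qed
  next
    fix y assume y: "y > m / v"
    then have y0: "y > 0" using mv0 by (meson divide_pos_pos less_trans)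
    have "ennreal (m / y) < emeasure \<nu> UNIV" using y mv0 y0 by (simp add: mv ennreal_lessI field_simps)
    then have "ennreal (m / y) < liminf (\<lambda>k. ennreal (1 / a k) * emeasure \<mu> UNIV)" using le2[OF open_UNIV] by (rule less_le_trans)
    then have "\<forall>\<^sub>F k in sequentially. ennreal (m / y) < ennreal (1 / a k) * emeasure \<mu> UNIV" by (rule less_LiminfD)
    then show "\<forall>\<^sub>F k in sequentially. a k < y"
    proof eventually_elim
      case (elim k)
      then have "ennreal (m / y) < ennreal (m / a k)" using a0[of k] by (simp add: mv flip: ennreal_mult')
      then have "m / y < m / a k" using mv0 y0 by (subst (asm) ennreal_less_iff) auto
      then show ?case using mv0 y0 a0[of k] by (simp add: field_simps)
    qed
  qed
  have eqU: "emeasure \<mu> U = ennreal (m / v) * emeasure \<nu> U" if U: "open U" for U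
  proof (rule antisym)
    have "(\<lambda>k. ennreal (a k) * emeasure \<nu> U) \<longlonglongrightarrow> ennreal (m / v) * emeasure \<nu> U"
      using lim by (intro tendsto_mult_ennreal tendsto_ennrealI tendsto_const) auto
    then show "emeasure \<mu> U \<le> ennreal (m / v) * emeasure \<nu> U"
      using le1[OF U] lim_imp_Liminf[OF sequentially_bot] by metis
    have "(\<lambda>k. 1 / a k) \<longlonglongrightarrow> 1 / (m / v)" using lim mv0 by (intro tendsto_divide) auto
    then have "(\<lambda>k. ennreal (1 / a k) * emeasure \<mu> U) \<longlonglongrightarrow> ennreal (1 / (m / v)) * emeasure \<mu> U"
      by (intro tendsto_mult_ennreal tendsto_ennrealI tendsto_const) auto
    then have "liminf (\<lambda>k. ennreal (1 / a k) * emeasure \<mu> U) = ennreal (1 / (m / v)) * emeasure \<mu> U"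
      by (rule lim_imp_Liminf[OF sequentially_bot])
    then have "emeasure \<nu> U \<le> ennreal (v / m) * emeasure \<mu> U" using le2[OF U] by simp
    then have "ennreal (m / v) * emeasure \<nu> U \<le> ennreal (m / v) * (ennreal (v / m) * emeasure \<mu> U)" by (rule mult_left_mono) simp
    also have "\<dots> = emeasure \<mu> U" using mv0 by (simp add: mult.assoc[symmetric] flip: ennreal_mult')
    finally show "ennreal (m / v) * emeasure \<nu> U \<le> emeasure \<mu> U" .
  qed
  have "\<mu> = scale_measure (ennreal (m / v)) \<nu>"
  proof (rule measure_eqI_generator_eq[where E = "{U. open U}" and \<Omega> = UNIV and A = "\<lambda>_. UNIV"])
    show "Int_stable {U::'a set. open U}" by (auto simp: Int_stable_def)
    show "sets \<mu> = sigma_sets UNIV {U. open U}" "sets (scale_measure (ennreal (m / v)) \<nu>) = sigma_sets UNIV {U. open U}"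
      using sets by (simp_all add: borel_def)
  qed (auto simp: emeasure_scale_measure eqU mv)
  then have "emeasure \<mu> A = ennreal (m / v) * emeasure \<nu> A" for A by (metis emeasure_scale_measure)
  then show thesis using that[of "m / v"] mv0 by simp
qed

section \<open>The Hausdorff measure of the sphere is positive and finite\<close>

lemma hausdorff_const_pos: "s \<ge> 0 \<Longrightarrow> hausdorff_const s > 0"
  unfolding hausdorff_const_def by (intro divide_pos_pos Gamma_real_pos) auto

lemma hausdorff_pre_finite_cover:
  fixes A :: "'a::metric_space set"
  assumes T: "finite T" "A \<subseteq> (\<Union>t\<in>T. C t)" and C: "\<And>t. t \<in> T \<Longrightarrow> bounded (C t) \<and> diameter (C t) \<le> \<delta>" and \<delta>: "\<delta> > 0"
  shows "hausdorff_pre s \<delta> A \<le> (\<Sum>t\<in>T. ennreal (hausdorff_const s * diameter (C t) powr s))"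
proof -
  let ?v = "\<lambda>C::'a set. ennreal (hausdorff_const s * diameter C powr s)"
  obtain f where f: "bij_betw f {..<card T} T" using T(1) bij_betw_from_nat_into_finite by blast
  define D where "D i = (if i < card T then C (f i) else {})" for i
  have "A \<subseteq> (\<Union>i. D i)"
  proof
    fix x assume "x \<in> A"
    then obtain t where t: "t \<in> T" "x \<in> C t" using T(2) by blast
    then have "t \<in> f ` {..<card T}" using f by (simp add: bij_betw_def)
    then obtain i where "i < card T" "f i = t" by auto
    then have "x \<in> D i" using t by (simp add: D_def)
    then show "x \<in> (\<Union>i. D i)" by blast
  qed
  then have "hausdorff_pre s \<delta> A \<le> (\<Sum>i. ?v (D i))"
    unfolding hausdorff_pre_def using C f \<delta>
    by (intro INF_lower) (auto simp: D_def diameter_empty bij_betw_def)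
  also have "\<dots> = (\<Sum>i<card T. ?v (D i))" by (rule suminf_finite) (auto simp: D_def diameter_empty)
  also have "\<dots> = (\<Sum>i<card T. ?v (C (f i)))" by (simp add: D_def)
  also have "\<dots> = (\<Sum>t\<in>T. ?v (C t))" by (rule sum.reindex_bij_betw[OF f])
  finally show ?thesis .
qed

lemma power_Suc_diff_le:
  fixes a b :: real
  assumes "0 \<le> b" "b \<le> a"
  shows "a ^ Suc m - b ^ Suc m \<le> Suc m * (a - b) * a ^ m"
proof (induction m)
  case (Suc m)
  have "a ^ Suc (Suc m) - b ^ Suc (Suc m) = a * (a ^ Suc m - b ^ Suc m) + b ^ Suc m * (a - b)"
    by (simp add: algebra_simps)
  also have "\<dots> \<le> a * (Suc m * (a - b) * a ^ m) + a ^ Suc m * (a - b)"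
    using assms Suc by (intro add_mono mult_left_mono mult_right_mono power_mono) auto
  also have "\<dots> = Suc (Suc m) * (a - b) * a ^ Suc m" by (simp add: algebra_simps)
  finally show ?case .
qed simp

lemma measure_lborel_cball_scaled:
  fixes c :: "'a::euclidean_space"
  assumes "r \<ge> 0" shows "measure lborel (cball c r) = unit_ball_vol TYPE('a) * r ^ DIM('a)"
  using content_ball_conv_unit_ball[of r c] assms by (simp add: content_cball_conv_ball)

text \<open>The balls of radius \<open>\<delta> / 2\<close> about the points are disjoint and lie in
  a shell of thickness \<open>\<delta>\<close> around the sphere, whose volume is only of order
  \<open>\<delta>\<close>. This saves one power of \<open>\<delta>\<close> and produces the exponent
  \<open>DIM('a) - 1\<close>.\<close>

lemma sphere_separated_card:
  fixes T :: "'a::euclidean_space set" and \<delta> :: real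
  assumes \<delta>: "0 < \<delta>" "\<delta> \<le> 1" and T: "finite T" "T \<subseteq> sphere 0 1" and sep: "\<And>x y. x \<in> T \<Longrightarrow> y \<in> T \<Longrightarrow> x \<noteq> y \<Longrightarrow> dist x y > \<delta>"
  shows "card T * \<delta> ^ (DIM('a) - 1) \<le> real DIM('a) * 4 ^ DIM('a)"
proof -
  obtain m where m: "DIM('a) = Suc m" using DIM_positive[where 'a = 'a] by (metis Suc_pred)
  let ?\<omega> = "unit_ball_vol TYPE('a)"
  have \<omega>: "?\<omega> > 0" by (rule unit_ball_vol_pos)
  let ?B = "\<lambda>t::'a. cball t (\<delta> / 2)"
  let ?A = "cball (0::'a) (1 + \<delta> / 2) - ball 0 (1 - \<delta> / 2)"
  have disj: "disjoint_family_on ?B T"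
    unfolding disjoint_family_on_def
  proof (intro ballI impI)
    fix x y assume xy: "x \<in> T" "y \<in> T" "x \<noteq> y"
    show "?B x \<inter> ?B y = {}"
    proof (rule ccontr)
      assume "?B x \<inter> ?B y \<noteq> {}"
      then obtain z where "dist x z \<le> \<delta> / 2" "dist y z \<le> \<delta> / 2" by auto
      then show False using sep[OF xy] dist_triangle2[of x y z] by linarith
    qed
  qed
  have sub: "(\<Union>t\<in>T. ?B t) \<subseteq> ?A"
  proof clarify
    fix t x assume t: "t \<in> T" and x: "x \<in> ?B t"
    have nt: "norm t = 1" using T(2) t by auto
    have "norm (t - x) \<le> \<delta> / 2" using x by (simp add: dist_norm)
    then have "norm x \<le> 1 + \<delta> / 2" "norm x \<ge> 1 - \<delta> / 2"
      using nt norm_triangle_ineq4[of t "t - x"] norm_triangle_ineq[of x "t - x"] by auto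
    then show "x \<in> ?A" by simp
  qed
  have fm: "cball x r \<in> fmeasurable lborel" "ball x r \<in> fmeasurable lborel" for x :: 'a and r
    using emeasure_lborel_cball_finite[of x r] emeasure_lborel_ball_finite[of x r] by (auto intro!: fmeasurableI)
  have "card T * (?\<omega> * (\<delta> / 2) ^ DIM('a)) = (\<Sum>t\<in>T. measure lborel (?B t))"
    using \<delta> by (simp add: measure_lborel_cball_scaled[of "\<delta> / 2"])
  also have "\<dots> = measure lborel (\<Union>t\<in>T. ?B t)"
  proof (rule measure_finite_Union[symmetric, OF T(1) _ disj])
    show "emeasure lborel (?B t) \<noteq> \<infinity>" for t using emeasure_lborel_cball_finite[of t "\<delta> / 2"] by simp
  qed auto
  also have "\<dots> \<le> measure lborel ?A"
    by (rule measure_mono_fmeasurable[OF sub])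
      (use T(1) fm in \<open>auto intro!: fmeasurable_Diff sets.finite_UN\<close>)
  also have "\<dots> = measure lborel (cball (0::'a) (1 + \<delta> / 2)) - measure lborel (ball (0::'a) (1 - \<delta> / 2))"
    by (rule measurable_measure_Diff[OF fm(1)]) (use \<delta> in auto)
  also have "measure lborel (ball (0::'a) (1 - \<delta> / 2)) = measure lborel (cball (0::'a) (1 - \<delta> / 2))"
    by (simp add: content_cball_conv_ball)
  also have "measure lborel (cball (0::'a) (1 + \<delta> / 2)) - measure lborel (cball (0::'a) (1 - \<delta> / 2)) =
     ?\<omega> * ((1 + \<delta> / 2) ^ Suc m - (1 - \<delta> / 2) ^ Suc m)"
    using \<delta> by (simp add: measure_lborel_cball_scaled[of "1 + \<delta> / 2"] measure_lborel_cball_scaled[of "1 - \<delta> / 2"] m right_diff_distrib)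
  also have "\<dots> \<le> ?\<omega> * (Suc m * ((1 + \<delta> / 2) - (1 - \<delta> / 2)) * (1 + \<delta> / 2) ^ m)"
    using \<delta> \<omega> by (intro mult_left_mono power_Suc_diff_le) auto
  also have "\<dots> \<le> ?\<omega> * (Suc m * \<delta> * 2 ^ m)"
    using \<delta> \<omega> by (intro mult_left_mono mult_mono power_mono) auto
  finally have "?\<omega> * (card T * (\<delta> / 2) ^ Suc m) \<le> ?\<omega> * (Suc m * \<delta> * 2 ^ m)"
    by (simp only: m mult.left_commute)
  then have "card T * (\<delta> / 2) ^ Suc m \<le> Suc m * \<delta> * 2 ^ m"
    using \<omega> by (simp only: mult_le_cancel_left_pos)
  then have "card T * \<delta> ^ m * \<delta> \<le> (real (Suc m) * (2 ^ m * 2 ^ Suc m)) * \<delta>"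
    by (simp add: power_divide field_simps)
  then have "card T * \<delta> ^ m \<le> real (Suc m) * (2 ^ m * 2 ^ Suc m)"
    using \<delta> by (simp only: mult_le_cancel_right_pos)
  also have "\<dots> \<le> real (Suc m) * 4 ^ Suc m"
  proof -
    have "2 ^ m * 2 ^ m = (4::real) ^ m" by (simp flip: power_mult_distrib)
    then have "(2::real) ^ m * 2 ^ Suc m \<le> 4 ^ Suc m" by simp
    then show ?thesis by (intro mult_left_mono) auto
  qed
  finally show ?thesis by (simp add: m)
qed

text \<open>A separated set of maximal cardinality is a net, since a point farther than
  \<open>\<delta>\<close> from all its members could be added. The maximum exists by the uniform
  bound on the cardinalities.\<close>

lemma sphere_ex_net:
  fixes \<delta> :: real
  assumes \<delta>: "0 < \<delta>" "\<delta> \<le> 1"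
  obtains T :: "'a::euclidean_space set" where "finite T" "sphere 0 1 \<subseteq> (\<Union>t\<in>T. cball t \<delta>)"
    "card T * \<delta> ^ (DIM('a) - 1) \<le> real DIM('a) * 4 ^ DIM('a)"
proof -
  define Sep where "Sep T \<longleftrightarrow> finite T \<and> T \<subseteq> sphere (0::'a) 1 \<and> (\<forall>x\<in>T. \<forall>y\<in>T. x \<noteq> y \<longrightarrow> dist x y > \<delta>)" for T
  have bound: "card T * \<delta> ^ (DIM('a) - 1) \<le> real DIM('a) * 4 ^ DIM('a)" if "Sep T" for T
    by (rule sphere_separated_card[OF \<delta>]) (use that in \<open>auto simp: Sep_def\<close>)
  define b where "b = nat \<lceil>real DIM('a) * 4 ^ DIM('a) / \<delta> ^ (DIM('a) - 1)\<rceil>"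
  have "card T \<le> b" if "Sep T" for T
  proof -
    have "real (card T) \<le> real DIM('a) * 4 ^ DIM('a) / \<delta> ^ (DIM('a) - 1)"
      using bound[OF that] \<delta> by (simp add: field_simps)
    then show ?thesis unfolding b_def by linarith
  qed
  moreover have "Sep {}" by (simp add: Sep_def)
  ultimately obtain T where T: "Sep T" "\<And>T'. Sep T' \<Longrightarrow> card T' \<le> card T"
    using ex_has_greatest_nat[of Sep "{}" card "Suc b"] by (auto simp: less_Suc_eq_le)
  have "sphere 0 1 \<subseteq> (\<Union>t\<in>T. cball t \<delta>)"
  proof (rule ccontr)
    assume "\<not> ?thesis"
    then obtain x where x0: "x \<in> sphere (0::'a) 1" "x \<notin> (\<Union>t\<in>T. cball t \<delta>)" by blast
    then have x: "x \<in> sphere (0::'a) 1" "\<And>t. t \<in> T \<Longrightarrow> dist t x > \<delta>" by (auto simp: not_le)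
    then have "Sep (insert x T)" using T(1) by (auto simp: Sep_def dist_commute)
    then have "card (insert x T) \<le> card T" by (rule T(2))
    moreover have "x \<notin> T" using x(2) \<delta> by fastforce
    ultimately show False using T(1) by (simp add: Sep_def)
  qed
  then show thesis using that T bound by (auto simp: Sep_def)
qed

lemma hausdorff_measure_sphere_finite:
  "hausdorff_measure (real DIM('a) - 1) (sphere (0::'a::euclidean_space) 1) < \<infinity>"
proof -
  let ?s = "real DIM('a) - 1" 
  have sr: "?s = real (DIM('a) - 1)" using DIM_positive[where 'a = 'a] by (simp add: of_nat_diff)
  have hc: "hausdorff_const ?s > 0" unfolding sr by (intro hausdorff_const_pos) simp
  define K where "K = hausdorff_const ?s * 2 powr ?s * (real DIM('a) * 4 ^ DIM('a))"
  have "hausdorff_measure ?s (sphere (0::'a) 1) \<le> ennreal K"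
    unfolding hausdorff_measure_def
  proof (rule SUP_least)
    fix d :: real assume "d \<in> {0<..}"
    define \<delta> where "\<delta> = min 1 (d / 2)"
    have \<delta>: "0 < \<delta>" "\<delta> \<le> 1" "2 * \<delta> \<le> d" using \<open>d \<in> {0<..}\<close> by (auto simp: \<delta>_def)
    obtain T :: "'a set" where T: "finite T" "sphere 0 1 \<subseteq> (\<Union>t\<in>T. cball t \<delta>)"
      "card T * \<delta> ^ (DIM('a) - 1) \<le> real DIM('a) * 4 ^ DIM('a)" using sphere_ex_net[OF \<delta>(1,2)] by blast
    have diam: "diameter (cball t \<delta>) = 2 * \<delta>" for t :: 'a using \<delta> by simp
    have "hausdorff_pre ?s d (sphere (0::'a) 1) \<le> (\<Sum>t\<in>T. ennreal (hausdorff_const ?s * diameter (cball t \<delta>) powr ?s))"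
      using \<delta> by (intro hausdorff_pre_finite_cover T) (auto simp: diam)
    also have "\<dots> = ennreal (card T * (hausdorff_const ?s * (2 * \<delta>) powr ?s))"
      unfolding diam using hc by (simp add: ennreal_of_nat_eq_real_of_nat ennreal_mult')
    also have "\<dots> \<le> ennreal K"
    proof (rule ennreal_leI)
      have "\<delta> powr ?s = \<delta> ^ (DIM('a) - 1)" unfolding sr by (rule powr_realpow[OF \<delta>(1)])
      then have "card T * (hausdorff_const ?s * (2 * \<delta>) powr ?s) = hausdorff_const ?s * 2 powr ?s * (card T * \<delta> ^ (DIM('a) - 1))"
        using \<delta> by (simp add: powr_mult)
      also have "\<dots> \<le> K" unfolding K_def using hc by (intro mult_left_mono T(3)) auto
      finally show "card T * (hausdorff_const ?s * (2 * \<delta>) powr ?s) \<le> K" .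
    qed
    finally show "hausdorff_pre ?s d (sphere (0::'a) 1) \<le> ennreal K" .
  qed
  also have "\<dots> < \<infinity>" by simp
  finally show ?thesis .
qed

section \<open>Lower bound for the Hausdorff measure of the sphere\<close>

text \<open>The cone over a set inside \<open>cball u d\<close> is a thin rod around the segment
  from 0 to \<open>u\<close>, covered by about \<open>1 / d\<close> balls of radius
  \<open>2 * d\<close>, each of volume of order \<open>d ^ DIM('a)\<close>. For \<open>d > 1\<close>
  the total mass is already small enough.\<close>

lemma cone_measure_small:
  fixes C :: "'a::euclidean_space set"
  assumes C: "C \<in> sets borel" "C \<subseteq> cball u d" and d: "d > 0"
  shows "emeasure cone_measure C \<le> ennreal (3 * 2 ^ DIM('a) * unit_ball_vol TYPE('a) * d ^ (DIM('a) - 1))"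
proof -
  obtain m where m: "DIM('a) = Suc m" using DIM_positive[where 'a = 'a] by (metis Suc_pred)
  let ?\<omega> = "unit_ball_vol TYPE('a)"
  have \<omega>: "?\<omega> > 0" by (rule unit_ball_vol_pos)
  show ?thesis
  proof (cases "d \<le> 1")
    case False
    have "emeasure cone_measure C \<le> emeasure (cone_measure :: 'a measure) UNIV"
      by (intro emeasure_mono) auto
    also have "\<dots> = ennreal ?\<omega>" by (rule emeasure_cone_UNIV)
    also have "\<dots> \<le> ennreal (3 * 2 ^ DIM('a) * ?\<omega> * d ^ (DIM('a) - 1))"
    proof (rule ennreal_leI)
      have "1 \<le> (3 * 2 ^ DIM('a)) * d ^ (DIM('a) - 1)"
        using False by (intro mult_ge1_I one_le_power) (auto intro: order_trans[of _ "3 * 1"])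
      then have "1 * ?\<omega> \<le> ((3 * 2 ^ DIM('a)) * d ^ (DIM('a) - 1)) * ?\<omega>" using \<omega> by (intro mult_right_mono) auto
      then show "?\<omega> \<le> 3 * 2 ^ DIM('a) * ?\<omega> * d ^ (DIM('a) - 1)" by (simp add: mult_ac)
    qed
    finally show ?thesis .
  next
    case True
    \<comment> \<open>The segment is cut into \<open>M\<close> steps with
      \<open>1 / M \<le> d\<close>. Of the radius \<open>2 * d\<close>, one half pays for rounding
      \<open>norm x\<close> to a multiple of \<open>1 / M\<close>, the other for replacing
      \<open>sgn x\<close> by \<open>u\<close>. There are \<open>M + 1 \<le> 3 / d\<close> balls,
      whence the constant 3.\<close>
    define M where "M = nat \<lceil>1 / d\<rceil>"
    have "1 / d \<ge> 1" using True d by simp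
    then have M: "1 / d \<le> M" "M \<le> 1 / d + 1" "M > 0" unfolding M_def by linarith+
    have "{x::'a. norm x \<le> 1 \<and> sgn x \<in> C} \<subseteq> (\<Union>k\<le>M. cball ((k / M) *\<^sub>R u) (2 * d))"
    proof clarify
      fix x :: 'a assume x: "norm x \<le> 1" "sgn x \<in> C"
      define k where "k = nat \<lfloor>norm x * M\<rfloor>"
      have k: "real k \<le> norm x * M" "norm x * M < real k + 1" unfolding k_def by (auto simp: of_nat_nat)
      have kM: "k \<le> M"
      proof -
        have "real k \<le> 1 * real M" using k(1) x(1) by (meson mult_right_mono of_nat_0_le_iff order_trans)
        then show ?thesis by simp
      qed
      have "x = norm x *\<^sub>R sgn x" by (cases "x = 0") (simp_all add: sgn_div_norm)
      then have "x - (k / M) *\<^sub>R u = (norm x - k / M) *\<^sub>R sgn x + (k / M) *\<^sub>R (sgn x - u)"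
        by (simp add: algebra_simps)
      then have "norm (x - (k / M) *\<^sub>R u) \<le> \<bar>norm x - k / M\<bar> * norm (sgn x) + (k / M) * norm (sgn x - u)"
        using norm_triangle_ineq[of "(norm x - k / M) *\<^sub>R sgn x" "(k / M) *\<^sub>R (sgn x - u)"] by simp
      also have "\<dots> \<le> d * 1 + 1 * d"
      proof (intro add_mono mult_mono)
        have "norm x - k / M = (norm x * M - k) / M" using M(3) by (simp add: field_simps)
        also have "\<bar>\<dots>\<bar> \<le> 1 / M" using k M(3) by (simp add: divide_right_mono)
        finally have "\<bar>norm x - k / M\<bar> \<le> 1 / M" .
        also have "1 / M \<le> d" using M d by (simp add: field_simps)
        finally show "\<bar>norm x - k / M\<bar> \<le> d" .
        show "norm (sgn x) \<le> 1" by (simp add: norm_sgn)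
        show "norm (sgn x - u) \<le> d" using x(2) C(2) by (auto simp: dist_norm norm_minus_commute)
      qed (use kM M d in auto)
      finally have "x \<in> cball ((k / M) *\<^sub>R u) (2 * d)" by (simp add: dist_norm norm_minus_commute)
      then show "x \<in> (\<Union>k\<le>M. cball ((k / M) *\<^sub>R u) (2 * d))" using kM by blast
    qed
    then have "emeasure cone_measure C \<le> emeasure lborel (\<Union>k\<le>M. cball ((k / M) *\<^sub>R u) (2 * d))"
      unfolding emeasure_cone_measure[OF C(1)] by (intro emeasure_mono) auto
    also have "\<dots> \<le> (\<Sum>k\<le>M. emeasure lborel (cball ((k / M) *\<^sub>R u) (2 * d)))"
      by (intro emeasure_subadditive_finite) auto
    also have "\<dots> = (\<Sum>k\<le>M. ennreal (?\<omega> * (2 * d) ^ DIM('a)))"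
    proof (intro sum.cong refl)
      fix k
      have "emeasure lborel (cball ((k / M) *\<^sub>R u) (2 * d)) = ennreal (measure lborel (cball ((k / M) *\<^sub>R u) (2 * d)))"
        using emeasure_lborel_cball_finite[of "(k / M) *\<^sub>R u" "2 * d"] by (intro emeasure_eq_ennreal_measure) auto
      then show "emeasure lborel (cball ((k / M) *\<^sub>R u) (2 * d)) = ennreal (?\<omega> * (2 * d) ^ DIM('a))"
        using d by (simp add: measure_lborel_cball_scaled[of "2 * d"])
    qed
    also have "\<dots> = ennreal ((real M + 1) * (?\<omega> * (2 * d) ^ DIM('a)))"
      using \<omega> d by (simp add: ennreal_of_nat_eq_real_of_nat ennreal_mult' ennreal_plus[symmetric] add_ac del: ennreal_plus)
    also have "\<dots> \<le> ennreal (3 * 2 ^ DIM('a) * ?\<omega> * d ^ (DIM('a) - 1))"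
    proof (rule ennreal_leI)
      have "real M + 1 \<le> 3 / d" using M(2) \<open>1 / d \<ge> 1\<close> by linarith
      then have "(real M + 1) * (?\<omega> * (2 * d) ^ DIM('a)) \<le> 3 / d * (?\<omega> * (2 * d) ^ DIM('a))"
        using \<omega> d by (intro mult_right_mono) auto
      also have "\<dots> = 3 * 2 ^ DIM('a) * ?\<omega> * d ^ (DIM('a) - 1)"
        using d by (simp add: m power_mult_distrib field_simps)
      finally show "(real M + 1) * (?\<omega> * (2 * d) ^ DIM('a)) \<le> 3 * 2 ^ DIM('a) * ?\<omega> * d ^ (DIM('a) - 1)" .
    qed
    finally show ?thesis .
  qed
qed

lemma cone_measure_diameter:
  fixes C :: "'a::euclidean_space set"
  assumes dim: "DIM('a) \<ge> 2" and C: "closed C" "bounded C"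
  shows "emeasure cone_measure C \<le> ennreal (3 * 2 ^ DIM('a) * unit_ball_vol TYPE('a) * diameter C powr (real DIM('a) - 1))"
proof (cases "C = {}")
  case False
  then obtain u where u: "u \<in> C" by blast
  define K where "K = 3 * 2 ^ DIM('a) * unit_ball_vol TYPE('a)"
  have K: "K > 0" using unit_ball_vol_pos[where 'a = 'a] by (simp add: K_def)
  have sr: "real DIM('a) - 1 = real (DIM('a) - 1)" using dim by (simp add: of_nat_diff)
  have sub: "C \<subseteq> cball u (diameter C)" using diameter_bounded_bound[OF C(2) u] by auto
  have d0: "diameter C \<ge> 0" by (rule diameter_ge_0[OF C(2)])
  show ?thesis
  proof (cases "diameter C = 0")
    case False
    then have "diameter C > 0" using d0 by simp
    then show ?thesis
      using cone_measure_small[OF borel_closed[OF C(1)] sub] powr_realpow[of "diameter C" "DIM('a) - 1"]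
      by (simp only: sr)
  next
    \<comment> \<open>Here the right-hand side is 0 because \<open>0 powr s = 0\<close>, so the
      single point in \<open>C\<close> must be shown to be null by shrinking the radius. This needs
      dimension at least 2: otherwise \<open>d ^ (DIM('a) - 1)\<close> would stay 1.\<close>
    case True
    have "emeasure cone_measure C \<le> 0"
    proof (rule ennreal_le_epsilon)
      fix e :: real assume e: "e > 0"
      define d where "d = min 1 (e / K)"
      have d: "d > 0" "d \<le> 1" "K * d \<le> e" using e K by (auto simp: d_def min_def field_simps)
      have "C \<subseteq> cball u d" using sub True d by auto
      then have "emeasure cone_measure C \<le> ennreal (K * d ^ (DIM('a) - 1))"
        unfolding K_def using C d by (intro cone_measure_small) auto
      also have "\<dots> \<le> ennreal e"
      proof (rule ennreal_leI)
        have "d ^ (DIM('a) - 1) \<le> d ^ 1" using d dim by (intro power_decreasing) auto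
        then show "K * d ^ (DIM('a) - 1) \<le> e" using d(3) K by (smt (verit) mult_left_mono power_one_right)
      qed
      finally show "emeasure cone_measure C \<le> 0 + ennreal e" by simp
    qed
    then show ?thesis by simp
  qed
qed simp

text \<open>Mass distribution principle: the pieces of any cover together carry the full cone
  measure, and each carries at most a constant times the (n-1)-th power of its diameter, so the
  total cost is bounded below. Closures make the pieces Borel without changing their
  diameters.\<close>

lemma hausdorff_measure_sphere_pos:
  assumes dim: "DIM('a::euclidean_space) \<ge> 2"
  shows "hausdorff_measure (real DIM('a) - 1) (sphere (0::'a) 1) > 0"
proof -
  let ?s = "real DIM('a) - 1"
  let ?\<omega> = "unit_ball_vol TYPE('a)"
  define K where "K = 3 * 2 ^ DIM('a) * ?\<omega>"
  have K: "K > 0" using unit_ball_vol_pos[where 'a = 'a] by (simp add: K_def)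
  have hc: "hausdorff_const ?s > 0" using dim by (intro hausdorff_const_pos) simp
  define c where "c = hausdorff_const ?s / K"
  have c: "c > 0" using hc K by (simp add: c_def)
  have "ennreal (c * ?\<omega>) \<le> hausdorff_pre ?s 1 (sphere (0::'a) 1)"
    unfolding hausdorff_pre_def
  proof (rule INF_greatest, clarify)
    fix C :: "nat \<Rightarrow> 'a set" assume C: "sphere 0 1 \<subseteq> (\<Union>i. C i)" "\<forall>i. bounded (C i) \<and> diameter (C i) \<le> 1"
    have "ennreal ?\<omega> = emeasure (cone_measure :: 'a measure) UNIV" by (simp add: emeasure_cone_UNIV)
    also have "\<dots> \<le> emeasure (cone_measure :: 'a measure) (- sphere 0 1 \<union> (\<Union>i. closure (C i)))"
      using C(1) closure_subset by (intro emeasure_mono) (auto intro!: sets.countable_UN borel_closed simp: subset_iff, blast)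
    also have "\<dots> \<le> emeasure (cone_measure :: 'a measure) (- sphere 0 1) + emeasure cone_measure (\<Union>i. closure (C i))"
      by (intro emeasure_subadditive) (auto intro!: sets.countable_UN borel_closed)
    also have "\<dots> = emeasure cone_measure (\<Union>i. closure (C i))" by (simp add: emeasure_cone_sphere)
    also have "\<dots> \<le> (\<Sum>i. emeasure cone_measure (closure (C i)))"
      by (intro emeasure_subadditive_countably) (auto intro!: borel_closed)
    also have "\<dots> \<le> (\<Sum>i. ennreal (K * diameter (C i) powr ?s))"
    proof (intro suminf_le)
      fix i
      have b: "bounded (C i)" using C(2) by blast
      show "emeasure cone_measure (closure (C i)) \<le> ennreal (K * diameter (C i) powr ?s)"
        using cone_measure_diameter[OF dim closed_closure bounded_closure[OF b]] diameter_closure[OF b]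
        by (simp add: K_def)
    qed auto
    finally have "ennreal c * ennreal ?\<omega> \<le> ennreal c * (\<Sum>i. ennreal (K * diameter (C i) powr ?s))"
      by (rule mult_left_mono) simp
    also have "\<dots> = (\<Sum>i. ennreal c * ennreal (K * diameter (C i) powr ?s))" by simp
    also have "\<dots> = (\<Sum>i. ennreal (hausdorff_const ?s * diameter (C i) powr ?s))"
      using c K by (simp add: c_def flip: ennreal_mult')
    finally show "ennreal (c * ?\<omega>) \<le> (\<Sum>i. ennreal (hausdorff_const ?s * diameter (C i) powr ?s))"
      using c by (simp add: ennreal_mult')
  qed
  also have "\<dots> \<le> hausdorff_measure ?s (sphere (0::'a) 1)"
    unfolding hausdorff_measure_def by (rule SUP_upper) simp
  finally show ?thesis using c unit_ball_vol_pos[where 'a = 'a]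
    by (metis ennreal_less_zero_iff less_le_trans mult_pos_pos)
qed

section \<open>Hausdorff measure of level sets of the distance to a configuration\<close>

text \<open>Finitely many balls of the common measure \<open>v\<close> cover the compact carrier, so
  \<open>v = 0\<close> would make the whole measure vanish.\<close>

lemma uniform_ball_nonzero:
  fixes \<mu> :: "'a::euclidean_space measure"
  assumes sets: "sets \<mu> = sets borel" and S: "compact S" and null: "emeasure \<mu> (- S) = 0" and nz: "emeasure \<mu> UNIV \<noteq> 0"
    and ball: "\<And>x. x \<in> S \<Longrightarrow> emeasure \<mu> (ball x r) = v" and r: "r > 0"
  shows "v \<noteq> 0"
proof
  assume v: "v = 0"
  obtain T where T: "T \<subseteq> S" "finite T" "S \<subseteq> (\<Union>x\<in>T. ball x r)"
    using compactE_image[OF S, of S "\<lambda>x. ball x r"] r by (metis (no_types, lifting) UN_iff centre_in_ball open_ball subsetI)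
  have b: "- S \<in> sets \<mu>" "(\<Union>x\<in>T. ball x r) \<in> sets \<mu>"
    unfolding sets using borel_compact[OF S] by (auto intro!: borel_comp borel_open open_UN)
  have "emeasure \<mu> UNIV \<le> emeasure \<mu> (- S \<union> (\<Union>x\<in>T. ball x r))"
    using T(3) b by (intro emeasure_mono sets.Un) auto
  also have "\<dots> \<le> emeasure \<mu> (- S) + emeasure \<mu> (\<Union>x\<in>T. ball x r)"
    using b by (intro emeasure_subadditive)
  also have "emeasure \<mu> (\<Union>x\<in>T. ball x r) \<le> (\<Sum>x\<in>T. emeasure \<mu> (ball x r))"
    by (rule emeasure_subadditive_finite[OF T(2)]) (auto simp: sets)
  also have "(\<Sum>x\<in>T. emeasure \<mu> (ball x r)) = 0"
  proof (rule sum.neutral, rule ballI)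
    fix x assume "x \<in> T"
    then show "emeasure \<mu> (ball x r) = 0" using ball[of x] T(1) v by blast
  qed
  finally show False using null nz by simp
qed

section \<open>Rotation invariance and proportionality of the two measures on the sphere\<close>

lemma orthogonal_transformation_sgn:
  fixes f :: "real^'n \<Rightarrow> real^'n"
  assumes "orthogonal_transformation f" shows "sgn (f x) = f (sgn x)"
  using assms by (simp add: sgn_div_norm orthogonal_transformation_norm linear_scale orthogonal_transformation_linear)

text \<open>The image of Lebesgue measure under \<open>f\<close> gives every ball the Lebesgue mass
  of a ball of the same radius, so the small-ball comparison applies in both directions with ratio
  1; no determinant is involved.\<close>

lemma emeasure_lborel_orthogonal:
  fixes f :: "'a::euclidean_space \<Rightarrow> 'a"
  assumes f: "orthogonal_transformation f" and A: "f ` A \<in> sets borel"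
  shows "emeasure lborel (f ` A) = emeasure lborel A"
proof -
  have lin: "linear f" using f by (rule orthogonal_transformation_linear)
  have dist_f: "dist (f x) (f y) = dist x y" for x y
    using f lin by (simp add: dist_norm orthogonal_transformation_norm flip: linear_diff)
  have bij: "bij f" using f by (simp add: bij_def orthogonal_transformation_inj orthogonal_transformation_surj)
  have [measurable]: "f \<in> borel_measurable borel"
    using linear_continuous_on[OF linear_linear[THEN iffD2, OF lin]] by (intro borel_measurable_continuous_onI) simp
  define \<mu> where "\<mu> = distr lborel borel f"
  have sets\<mu>: "sets \<mu> = sets borel" by (simp add: \<mu>_def)
  have em: "emeasure \<mu> B = emeasure lborel (f -` B)" if "B \<in> sets borel" for B
    unfolding \<mu>_def using that by (subst emeasure_distr) auto
  define h where "h r = measure lborel (ball (0::'a) r)" for r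
  have h: "emeasure lborel (ball x r) = ennreal (h r)" if "r > 0" for x :: 'a and r
  proof -
    have "measure lborel (ball x r) = h r"
      unfolding h_def using that content_ball_conv_unit_ball[of r x] content_ball_conv_unit_ball[of r "0::'a"] by simp
    then show ?thesis using emeasure_lborel_ball_finite[of x r] by (simp add: emeasure_eq_ennreal_measure)
  qed
  have g: "emeasure \<mu> (ball x r) = ennreal (h r)" if "r > 0" for x :: 'a and r
  proof -
    have "f -` ball x r = ball (inv f x) r"
      using dist_f[of "inv f x"] bij by (auto simp: bij_is_surj surj_f_inv_f)
    then show ?thesis using h[OF that] by (simp add: em)
  qed
  have hpos: "h r > 0" if "r > 0" for r using that by (simp add: h_def content_ball_pos)
  have sf: "sigma_finite_measure \<mu>"
  proof
    have "x \<in> ball 0 (real (Suc (nat \<lceil>norm x\<rceil>)))" for x :: 'a by simp linarith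
    then have "(\<Union>i. ball (0::'a) (real (Suc i))) = UNIV" by blast
    then show "\<exists>A. countable A \<and> A \<subseteq> sets \<mu> \<and> \<Union>A = space \<mu> \<and> (\<forall>a\<in>A. emeasure \<mu> a \<noteq> \<infinity>)"
      by (intro exI[of _ "range (\<lambda>i. ball 0 (real (Suc i)))"]) (auto simp: sets\<mu> g \<mu>_def[THEN arg_cong[where f = space]])
  qed
  have eq: "emeasure \<mu> U = emeasure lborel U" if U: "open U" for U
  proof (rule antisym)
    have "emeasure \<mu> U \<le> liminf (\<lambda>k. ennreal (h (1 / (real k + 1)) / h (1 / (real k + 1))) * emeasure lborel U)"
      by (rule uniform_measure_le_liminf[OF sf sigma_finite_lborel sets\<mu> sets_lborel, of UNIV]) (auto simp: g h hpos U)
    then show "emeasure \<mu> U \<le> emeasure lborel U" using hpos[THEN less_imp_neq] by (simp add: Liminf_const)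
    have "emeasure lborel U \<le> liminf (\<lambda>k. ennreal (h (1 / (real k + 1)) / h (1 / (real k + 1))) * emeasure \<mu> U)"
      by (rule uniform_measure_le_liminf[OF sigma_finite_lborel sf sets_lborel sets\<mu>, of UNIV]) (auto simp: g h hpos U)
    then show "emeasure lborel U \<le> emeasure \<mu> U" using hpos[THEN less_imp_neq] by (simp add: Liminf_const)
  qed
  have "\<mu> = lborel"
  proof (rule measure_eqI_generator_eq[where E = "{U. open U}" and \<Omega> = UNIV and A = "\<lambda>i. ball 0 (real (Suc i))"])
    show "Int_stable {U::'a set. open U}" by (auto simp: Int_stable_def)
    show "sets \<mu> = sigma_sets UNIV {U. open U}" "sets (lborel :: 'a measure) = sigma_sets UNIV {U. open U}"
      using sets\<mu> by (simp_all add: borel_def)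
    have "x \<in> ball 0 (real (Suc (nat \<lceil>norm x\<rceil>)))" for x :: 'a by simp linarith
    then show "(\<Union>i. ball (0::'a) (real (Suc i))) = UNIV" by blast
  qed (auto simp: eq g h)
  then have "emeasure lborel (f ` A) = emeasure lborel (f -` f ` A)" using em[OF A] by simp
  then show ?thesis using bij by (simp add: bij_is_inj inj_vimage_image_eq)
qed

lemma cone_measure_rotation:
  fixes f :: "real^'n \<Rightarrow> real^'n"
  assumes f: "orthogonal_transformation f"
  shows "emeasure cone_measure (ball (f e) r) = emeasure cone_measure (ball e r)"
proof -
  let ?B = "\<lambda>e::real^'n. {x. norm x \<le> 1 \<and> sgn x \<in> ball e r}"
  have lin: "linear f" using f by (rule orthogonal_transformation_linear)
  have dist_f: "dist (f x) (f y) = dist x y" for x y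
    using f lin by (simp add: dist_norm orthogonal_transformation_norm flip: linear_diff)
  have im: "f ` ?B e = ?B (f e)"
  proof (rule set_eqI, rule iffI)
    fix y assume "y \<in> f ` ?B e"
    then show "y \<in> ?B (f e)" using f by (auto simp: orthogonal_transformation_norm orthogonal_transformation_sgn dist_f)
  next
    fix y assume y: "y \<in> ?B (f e)"
    obtain x where x: "y = f x" using orthogonal_transformation_surj[OF f] by (metis surjD)
    then show "y \<in> f ` ?B e" using y f by (auto simp: orthogonal_transformation_norm orthogonal_transformation_sgn dist_f)
  qed
  have "emeasure lborel (f ` ?B e) = emeasure lborel (?B e)"
    using im by (intro emeasure_lborel_orthogonal[OF f]) auto
  then show ?thesis unfolding im by (simp add: emeasure_cone_measure)
qed

lemma hausdorff_measure_rotation: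
  fixes f :: "real^'n \<Rightarrow> real^'n"
  assumes f: "orthogonal_transformation f"
  shows "hausdorff_measure s (ball (f e) r \<inter> sphere 0 1) = hausdorff_measure s (ball e r \<inter> sphere 0 1)"
proof -
  have lin: "linear f" using f by (rule orthogonal_transformation_linear)
  have dist_f: "dist (f x) (f y) = dist x y" for x y
    using f lin by (simp add: dist_norm orthogonal_transformation_norm flip: linear_diff)
  have "f ` (ball e r \<inter> sphere 0 1) = ball (f e) r \<inter> sphere 0 1"
  proof (rule set_eqI, rule iffI)
    fix y assume y: "y \<in> ball (f e) r \<inter> sphere 0 1"
    obtain x where x: "y = f x" using orthogonal_transformation_surj[OF f] by (metis surjD)
    then show "y \<in> f ` (ball e r \<inter> sphere 0 1)" using y f by (auto simp: orthogonal_transformation_norm dist_f)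
  qed (use f in \<open>auto simp: orthogonal_transformation_norm dist_f\<close>)
  moreover have "hausdorff_measure s (f ` (ball e r \<inter> sphere 0 1)) = ennreal (1 powr s) * hausdorff_measure s (ball e r \<inter> sphere 0 1)"
    using orthogonal_transformation_surj[OF f] by (intro hausdorff_measure_similarity) (auto simp: dist_f)
  ultimately show ?thesis by simp
qed

text \<open>Rotations act transitively on the sphere, so each measure gives the same mass to all
  balls of a given radius centred on it, and two such measures are proportional. The constant enters
  both sides of the final comparison alike, so only its sign matters.\<close>

lemma hausdorff_measure_sphere_cone:
  assumes dim: "CARD('n::finite) \<ge> 2"
  obtains c where "c > 0" "\<And>A. A \<in> sets borel \<Longrightarrow>
    hausdorff_measure (real CARD('n) - 1) (A \<inter> sphere (0::real^'n) 1) = ennreal c * emeasure cone_measure A"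
proof -
  let ?s = "real CARD('n) - 1"
  let ?S = "sphere (0::real^'n) 1"
  define \<mu> where "\<mu> = density (hausdorff_borel ?s) (indicator ?S)"
  have Sb: "?S \<in> sets borel" by (simp add: borel_closed)
  have sets\<mu> [simp]: "sets \<mu> = sets borel" by (simp add: \<mu>_def)
  have \<mu>: "emeasure \<mu> A = hausdorff_measure ?s (A \<inter> ?S)" if A: "A \<in> sets borel" for A
  proof -
    have "emeasure \<mu> A = (\<integral>\<^sup>+x. indicator ?S x * indicator A x \<partial>hausdorff_borel ?s)"
      unfolding \<mu>_def using A Sb by (intro emeasure_density) (auto intro!: borel_measurable_indicator)
    also have "\<dots> = (\<integral>\<^sup>+x. indicator (A \<inter> ?S) x \<partial>hausdorff_borel ?s)"
      by (intro nn_integral_cong) (auto simp: indicator_def)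
    also have "\<dots> = emeasure (hausdorff_borel ?s) (A \<inter> ?S)"
      using A Sb by (intro nn_integral_indicator) auto
    also have "\<dots> = hausdorff_measure ?s (A \<inter> ?S)" using A Sb by (intro emeasure_hausdorff_borel) auto
    finally show ?thesis .
  qed
  have tot: "emeasure \<mu> UNIV = hausdorff_measure ?s ?S" by (subst \<mu>) auto
  have fin: "finite_measure \<mu>"
  proof
    have "space \<mu> = UNIV" by (simp add: \<mu>_def)
    then show "emeasure \<mu> (space \<mu>) \<noteq> \<infinity>"
      using hausdorff_measure_sphere_finite[where 'a = "real^'n"] tot by simp
  qed
  have nz: "emeasure \<mu> UNIV \<noteq> 0" using hausdorff_measure_sphere_pos[where 'a = "real^'n"] tot dim by simp
  have null: "emeasure \<mu> (- ?S) = 0" using Sb by (subst \<mu>) (auto simp: hausdorff_measure_empty)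
  have nz': "emeasure (cone_measure :: (real^'n) measure) UNIV \<noteq> 0"
    using unit_ball_vol_pos[where 'a = "real^'n"] by (simp add: emeasure_cone_UNIV)
  obtain e :: "real^'n" where e: "norm e = 1" using vector_choose_size[of 1] by auto
  have rot: "\<exists>f. orthogonal_transformation f \<and> f e = x" if "norm x = 1" for x :: "real^'n"
    using orthogonal_transformation_exists_1[OF e that] by metis
  interpret M: finite_measure \<mu> by (rule fin)
  interpret C: finite_measure "cone_measure :: (real^'n) measure" by (rule finite_measure_cone_measure)
  define g where "g r = measure \<mu> (ball e r)" for r
  define h where "h r = measure cone_measure (ball e r)" for r
  have g: "emeasure \<mu> (ball x r) = ennreal (g r)" if x: "x \<in> ?S" for x r
  proof -
    obtain f where f: "orthogonal_transformation f" "f e = x" using rot[of x] x by auto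
    have "emeasure \<mu> (ball x r) = emeasure \<mu> (ball e r)"
      using hausdorff_measure_rotation[OF f(1), of ?s e r] f(2) by (simp add: \<mu>)
    then show ?thesis by (simp add: g_def M.emeasure_eq_measure)
  qed
  have h: "emeasure cone_measure (ball x r) = ennreal (h r)" if x: "x \<in> ?S" for x r
  proof -
    obtain f where f: "orthogonal_transformation f" "f e = x" using rot[of x] x by auto
    show ?thesis
      using cone_measure_rotation[OF f(1), of e r] f(2) by (simp add: h_def C.emeasure_eq_measure)
  qed
  have gpos: "g r > 0" if "r > 0" for r
  proof -
    have "ennreal (g r) \<noteq> 0"
      by (rule uniform_ball_nonzero[OF sets\<mu> compact_sphere null nz g that])
    then show ?thesis by (simp add: g_def zero_less_measure_iff)
  qed
  have hpos: "h r > 0" if "r > 0" for r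
  proof -
    have "ennreal (h r) \<noteq> 0"
      by (rule uniform_ball_nonzero[OF sets_cone_measure compact_sphere emeasure_cone_sphere nz' h that])
    then show ?thesis by (simp add: h_def zero_less_measure_iff)
  qed
  obtain c where "c > 0" "\<And>A. A \<in> sets borel \<Longrightarrow> emeasure \<mu> A = ennreal c * emeasure cone_measure A"
    using uniform_measures_proportional[OF fin finite_measure_cone_measure sets\<mu> sets_cone_measure Sb null
       emeasure_cone_sphere g h gpos hpos nz nz'] by blast
  then show thesis using \<mu> that by metis
qed

text \<open>The first-index partition of space by the minimiser (\<open>\<sigma> = 1\<close>) or maximiser (\<open>\<sigma> = -1\<close>)
  of the distance to the points \<open>p\<close>.\<close>
definition cell :: "real \<Rightarrow> nat \<Rightarrow> (nat \<Rightarrow> 'a::metric_space) \<Rightarrow> nat \<Rightarrow> 'a set" where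
  "cell \<sigma> N p i = {x. (\<forall>j<N. \<sigma> * dist x (p i) \<le> \<sigma> * dist x (p j)) \<and> (\<forall>j<i. \<sigma> * dist x (p i) < \<sigma> * dist x (p j))}"

text \<open>The set where the smallest (or largest) distance to the configuration lies in
  \<open>R\<close>, written cell by cell. Taking \<open>R = {..r}\<close> gives the union
  (intersection) of the balls and \<open>R = {r}\<close> its boundary for large \<open>r\<close>, so
  volume and surface share one notion.\<close>

definition level_set :: "real \<Rightarrow> nat \<Rightarrow> (nat \<Rightarrow> 'a::metric_space) \<Rightarrow> real set \<Rightarrow> 'a set" where
  "level_set \<sigma> N p R = (\<Union>i<N. {x \<in> cell \<sigma> N p i. dist x (p i) \<in> R})"

lemma cell_borel [measurable]: "cell \<sigma> N p i \<in> sets (borel :: 'a::euclidean_space measure)"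
  unfolding cell_def by measurable

lemma cell_unique: "i < N \<Longrightarrow> j < N \<Longrightarrow> x \<in> cell \<sigma> N p i \<Longrightarrow> x \<in> cell \<sigma> N p j \<Longrightarrow> i = j"
  unfolding cell_def by (smt (verit, best) mem_Collect_eq nat_neq_iff)

lemma cell_ex: assumes "N > 0" shows "\<exists>i<N. x \<in> cell \<sigma> N p i"
proof -
  let ?f = "\<lambda>i. \<sigma> * dist x (p i)"
  define m where "m = Min (?f ` {..<N})"
  have "m \<in> ?f ` {..<N}" unfolding m_def using assms by (intro Min_in) auto
  then have ex: "\<exists>i. i < N \<and> ?f i = m" by auto
  define i where "i = (LEAST i. i < N \<and> ?f i = m)"
  have i: "i < N" "?f i = m" using LeastI_ex[OF ex] by (auto simp: i_def)
  have le: "m \<le> ?f j" if "j < N" for j unfolding m_def using that by (intro Min_le) auto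
  have "?f i < ?f j" if "j < i" for j
  proof -
    have "?f j \<noteq> m" using not_less_Least[of j "\<lambda>i. i < N \<and> ?f i = m"] that i(1) by (auto simp: i_def)
    then show ?thesis using le[of j] that i by (simp add: order_less_le)
  qed
  then show ?thesis using i le by (auto simp: cell_def)
qed

lemma level_set_mem:
  assumes "i < N" "x \<in> cell \<sigma> N p i"
  shows "x \<in> level_set \<sigma> N p R \<longleftrightarrow> dist x (p i) \<in> R"
proof
  assume "x \<in> level_set \<sigma> N p R"
  then obtain j where j: "j < N" "x \<in> cell \<sigma> N p j" "dist x (p j) \<in> R" by (auto simp: level_set_def)
  then show "dist x (p i) \<in> R" using cell_unique[OF j(1) assms(1) j(2) assms(2)] by simp
qed (use assms in \<open>auto simp: level_set_def\<close>)

text \<open>Moving back by \<open>t - k\<close> towards \<open>p i\<close> shortens the distance to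
  \<open>p i\<close> by exactly that amount and the distance to any other centre by at most that
  amount, so weak and strict comparisons both survive.\<close>

lemma cell_scale_near:
  fixes c :: "'a::real_normed_vector"
  assumes "c = p i" "c + t *\<^sub>R u \<in> cell 1 N p i" "0 \<le> k" "k \<le> t" "norm u = 1"
  shows "c + k *\<^sub>R u \<in> cell 1 N p i"
proof -
  have d: "dist (c + s *\<^sub>R u) (p i) = s" if "s \<ge> 0" for s using assms that by (simp add: dist_norm)
  have "dist (c + t *\<^sub>R u) (p j) \<le> dist (c + k *\<^sub>R u) (p j) + (t - k)" for j
  proof -
    have "(c + t *\<^sub>R u) - (c + k *\<^sub>R u) = (t - k) *\<^sub>R u" by (simp add: algebra_simps)
    then have "dist (c + t *\<^sub>R u) (c + k *\<^sub>R u) = t - k" using assms by (simp add: dist_norm)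
    then show ?thesis using dist_triangle[of "c + t *\<^sub>R u" "p j" "c + k *\<^sub>R u"] by linarith
  qed
  then show ?thesis using assms(2-4) d[of t] d[of k] unfolding cell_def by (smt (verit) mem_Collect_eq mult_1)
qed

text \<open>Moving outwards by \<open>k - t\<close> lengthens the distance to \<open>p i\<close> by
  exactly that amount and the distance to any other centre by at most that amount.\<close>

lemma cell_scale_far:
  fixes c :: "'a::real_normed_vector"
  assumes "c = p i" "c + t *\<^sub>R u \<in> cell (-1) N p i" "0 \<le> t" "t \<le> k" "norm u = 1"
  shows "c + k *\<^sub>R u \<in> cell (-1) N p i"
proof -
  have d: "dist (c + s *\<^sub>R u) (p i) = s" if "s \<ge> 0" for s using assms that by (simp add: dist_norm)
  have "dist (c + k *\<^sub>R u) (p j) \<le> dist (c + t *\<^sub>R u) (p j) + (k - t)" for j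
  proof -
    have "(c + k *\<^sub>R u) - (c + t *\<^sub>R u) = (k - t) *\<^sub>R u" by (simp add: algebra_simps)
    then have "dist (c + k *\<^sub>R u) (c + t *\<^sub>R u) = k - t" using assms by (simp add: dist_norm)
    then show ?thesis using dist_triangle[of "c + k *\<^sub>R u" "p j" "c + t *\<^sub>R u"] by linarith
  qed
  then show ?thesis using assms(2-4) d[of t] d[of k] unfolding cell_def by (smt (verit) mem_Collect_eq)
qed

text \<open>The function \<open>G\<close> of the overview, for both signs.\<close>

definition cell_angle :: "real \<Rightarrow> nat \<Rightarrow> (nat \<Rightarrow> 'a::euclidean_space) \<Rightarrow> real \<Rightarrow> real" where
  "cell_angle \<sigma> N p r = (\<Sum>i<N. measure cone_measure {u. p i + r *\<^sub>R u \<in> cell \<sigma> N p i})"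

lemma cell_directions_borel [measurable]:
  fixes p :: "nat \<Rightarrow> 'a::euclidean_space"
  shows "{u. p i + r *\<^sub>R u \<in> cell \<sigma> N p i} \<in> sets borel"
  by measurable

text \<open>The part of the level set in cell \<open>i\<close> is the image of a subset of the unit
  sphere under a similarity of ratio \<open>r\<close>, and the parts are disjoint thanks to the
  tie-breaking in \<open>cell\<close>.\<close>

lemma hausdorff_measure_level_set:
  fixes p :: "nat \<Rightarrow> real^'n"
  assumes c: "c \<ge> 0" "\<And>A. A \<in> sets borel \<Longrightarrow> hausdorff_measure s (A \<inter> sphere (0::real^'n) 1) = ennreal c * emeasure cone_measure A"
    and r: "r > 0"
  shows "hausdorff_measure s (level_set \<sigma> N p {r}) = ennreal (r powr s * c * cell_angle \<sigma> N p r)"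
proof -
  interpret C: finite_measure "cone_measure :: (real^'n) measure" by (rule finite_measure_cone_measure)
  let ?L = "\<lambda>i. {x \<in> cell \<sigma> N p i. dist x (p i) \<in> {r}}"
  have Lb: "?L i \<in> sets borel" for i by measurable
  have "hausdorff_measure s (level_set \<sigma> N p {r}) = emeasure (hausdorff_borel s) (\<Union>i<N. ?L i)"
    unfolding level_set_def using Lb by (intro emeasure_hausdorff_borel[symmetric] sets.finite_UN) auto
  also have "\<dots> = (\<Sum>i<N. emeasure (hausdorff_borel s) (?L i))"
  proof (rule sum_emeasure[symmetric])
    show "disjoint_family_on ?L {..<N}"
      unfolding disjoint_family_on_def using cell_unique[of _ N _ _ \<sigma> p] by blast
    show "?L ` {..<N} \<subseteq> sets (hausdorff_borel s)" using Lb by auto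
  qed simp
  also have "\<dots> = (\<Sum>i<N. ennreal (r powr s * c * measure cone_measure {u. p i + r *\<^sub>R u \<in> cell \<sigma> N p i}))"
  proof (intro sum.cong refl)
    fix i
    let ?f = "\<lambda>u. p i + r *\<^sub>R u"
    let ?A = "{u. ?f u \<in> cell \<sigma> N p i}"
    have im: "?L i = ?f ` (?A \<inter> sphere 0 1)"
    proof (rule set_eqI, rule iffI)
      fix x assume x: "x \<in> ?L i"
      have "x = ?f ((x - p i) /\<^sub>R r)" using r by simp
      moreover have "(x - p i) /\<^sub>R r \<in> ?A \<inter> sphere 0 1" using x r by (auto simp: dist_norm)
      ultimately show "x \<in> ?f ` (?A \<inter> sphere 0 1)" by blast
    qed (use r in \<open>auto simp: dist_norm\<close>)
    have surj: "surj ?f"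
      by (rule surjI[of _ "\<lambda>x. (x - p i) /\<^sub>R r"]) (use r in simp)
    have "emeasure (hausdorff_borel s) (?L i) = hausdorff_measure s (?L i)" by (rule emeasure_hausdorff_borel[OF Lb])
    also have "\<dots> = ennreal (r powr s) * hausdorff_measure s (?A \<inter> sphere 0 1)"
      unfolding im using r surj
      by (intro hausdorff_measure_similarity) (auto simp: dist_norm simp flip: scaleR_diff_right)
    also have "\<dots> = ennreal (r powr s) * (ennreal c * emeasure cone_measure ?A)" by (subst c(2)) auto
    also have "\<dots> = ennreal (r powr s * c * measure cone_measure ?A)"
      using c(1) by (simp add: C.emeasure_eq_measure ennreal_mult' mult.assoc)
    finally show "emeasure (hausdorff_borel s) (?L i) = ennreal (r powr s * c * measure cone_measure ?A)" .
  qed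
  also have "\<dots> = ennreal (\<Sum>i<N. r powr s * c * measure cone_measure {u. p i + r *\<^sub>R u \<in> cell \<sigma> N p i})"
    using c(1) by (intro sum_ennreal) auto
  finally show ?thesis by (simp add: cell_angle_def sum_distrib_left)
qed

section \<open>Volume between two level sets\<close>

lemma measure_lborel_translate:
  fixes A :: "'a::euclidean_space set"
  assumes A: "A \<in> sets borel"
  shows "measure lborel {x. x - c \<in> A} = measure lborel A"
proof -
  have "{x. x - c \<in> A} = (+) c ` A" by (auto simp: image_iff) (metis add.commute diff_add_cancel)
  moreover have "{x. x - c \<in> A} \<in> sets borel" using A by measurable
  ultimately show ?thesis using measure_translation[of c A] A by simp
qed

lemma measure_shell:
  fixes c :: "'a::euclidean_space"
  assumes A [measurable]: "A \<in> sets borel" and r: "0 \<le> r" "r \<le> r'"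
  shows "measure lborel {x. r < dist x c \<and> dist x c \<le> r' \<and> sgn (x - c) \<in> A} = (r' ^ DIM('a) - r ^ DIM('a)) * measure cone_measure A"
proof -
  interpret C: finite_measure "cone_measure :: 'a measure" by (rule finite_measure_cone_measure)
  let ?B = "\<lambda>t. {x::'a. norm x \<le> t \<and> sgn x \<in> A}"
  have e: "emeasure lborel (?B t) = ennreal (t ^ DIM('a) * measure cone_measure A)" if "t \<ge> 0" for t
    unfolding emeasure_sector[OF A that] C.emeasure_eq_measure using that by (simp add: ennreal_mult')
  have m: "measure lborel (?B t) = t ^ DIM('a) * measure cone_measure A" if "t \<ge> 0" for t
    using e[OF that] that by (intro measure_eq_emeasure_eq_ennreal) auto
  have "{x. r < dist x c \<and> dist x c \<le> r' \<and> sgn (x - c) \<in> A} = {x. x - c \<in> ?B r' - ?B r}"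
    using r by (auto simp: dist_norm)
  then have "measure lborel {x. r < dist x c \<and> dist x c \<le> r' \<and> sgn (x - c) \<in> A} = measure lborel (?B r' - ?B r)"
    by (simp only: measure_lborel_translate sets.Diff sgn_in_measurable A)
  also have "\<dots> = measure lborel (?B r') - measure lborel (?B r)"
    using r e[of r'] by (intro measurable_measure_Diff fmeasurableI) auto
  finally show ?thesis using r by (simp add: m left_diff_distrib)
qed

lemma level_set_borel [measurable]:
  fixes p :: "nat \<Rightarrow> 'a::euclidean_space"
  assumes [measurable]: "R \<in> sets borel"
  shows "level_set \<sigma> N p R \<in> sets borel"
  unfolding level_set_def by measurable

lemma fmeasurable_lborel_bounded: "A \<in> sets borel \<Longrightarrow> bounded A \<Longrightarrow> A \<in> fmeasurable (lborel :: 'a::euclidean_space measure)"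
  using bounded_set_imp_lmeasurable[of A] by (auto simp: fmeasurable_def)

lemma bounded_level_set: "bounded (level_set \<sigma> N p {..r})" for p :: "nat \<Rightarrow> 'a::euclidean_space"
  by (rule bounded_subset[of "\<Union>i<N. cball (p i) r"]) (auto simp: level_set_def dist_commute)

lemma level_set_volume_diff:
  fixes p :: "nat \<Rightarrow> 'a::euclidean_space"
  assumes "r \<le> r'"
  shows "measure lborel (level_set \<sigma> N p {..r'}) - measure lborel (level_set \<sigma> N p {..r}) =
    (\<Sum>i<N. measure lborel {x \<in> cell \<sigma> N p i. r < dist x (p i) \<and> dist x (p i) \<le> r'})"
proof -
  let ?D = "\<lambda>i. {x \<in> cell \<sigma> N p i. r < dist x (p i) \<and> dist x (p i) \<le> r'}"
  have fm: "level_set \<sigma> N p {..t} \<in> fmeasurable lborel" for t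
    by (intro fmeasurable_lborel_bounded bounded_level_set) measurable
  have Db: "?D i \<in> fmeasurable lborel" for i
    by (rule fmeasurable_lborel_bounded, measurable, rule bounded_subset[OF bounded_cball[of "p i" r']])
      (auto simp: dist_commute)
  have sub: "level_set \<sigma> N p {..r} \<subseteq> level_set \<sigma> N p {..r'}" using assms by (auto simp: level_set_def)
  have "level_set \<sigma> N p {..r'} - level_set \<sigma> N p {..r} = (\<Union>i<N. ?D i)"
  proof (rule set_eqI)
    fix x
    show "x \<in> level_set \<sigma> N p {..r'} - level_set \<sigma> N p {..r} \<longleftrightarrow> x \<in> (\<Union>i<N. ?D i)"
    proof (cases "\<exists>i<N. x \<in> cell \<sigma> N p i")
      case True
      then obtain i where i: "i < N" "x \<in> cell \<sigma> N p i" by blast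
      have uniq: "j = i" if "j < N" "x \<in> cell \<sigma> N p j" for j
        by (rule cell_unique[OF that(1) i(1) that(2) i(2)])
      have "x \<in> (\<Union>i<N. ?D i) \<longleftrightarrow> x \<in> ?D i"
      proof
        assume "x \<in> (\<Union>i<N. ?D i)"
        then obtain j where "j < N" "x \<in> ?D j" by blast
        then show "x \<in> ?D i" using uniq[of j] by simp
      qed (use i(1) in blast)
      then show ?thesis using level_set_mem[OF i, of "{..r}"] level_set_mem[OF i, of "{..r'}"] i(2) by (simp add: not_le conj_commute)
    qed (auto simp: level_set_def)
  qed
  then have "measure lborel (level_set \<sigma> N p {..r'}) - measure lborel (level_set \<sigma> N p {..r}) = measure lborel (\<Union>i<N. ?D i)"
    using measurable_measure_Diff[OF fm fmeasurableD[OF fm] sub] by simp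
  also have "\<dots> = (\<Sum>i<N. measure lborel (?D i))"
  proof (rule measure_finite_Union)
    show "disjoint_family_on ?D {..<N}"
      unfolding disjoint_family_on_def using cell_unique[of _ N _ _ \<sigma> p] by blast
    show "?D ` {..<N} \<subseteq> sets lborel" using fmeasurableD[OF Db] by blast
    show "emeasure lborel (?D i) \<noteq> \<infinity>" for i using fmeasurableD2[OF Db] by simp
  qed simp
  finally show ?thesis .
qed

text \<open>\<open>A\<close> contains every direction in which the cell meets the shell. Excluding
  the inner radius guarantees \<open>x \<noteq> p i\<close>, so that \<open>sgn (x - p i)\<close> is
  a unit vector.\<close>

lemma measure_cell_shell_le:
  fixes p :: "nat \<Rightarrow> 'a::euclidean_space"
  assumes A [measurable]: "A \<in> sets borel" and r: "0 \<le> r" "r \<le> r'"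
    and sub: "\<And>u t. norm u = 1 \<Longrightarrow> r < t \<Longrightarrow> t \<le> r' \<Longrightarrow> p i + t *\<^sub>R u \<in> cell \<sigma> N p i \<Longrightarrow> u \<in> A"
  shows "measure lborel {x \<in> cell \<sigma> N p i. r < dist x (p i) \<and> dist x (p i) \<le> r'} \<le> (r' ^ DIM('a) - r ^ DIM('a)) * measure cone_measure A"
  unfolding measure_shell[OF A r, of "p i", symmetric]
proof (rule measure_mono_fmeasurable)
  show "{x \<in> cell \<sigma> N p i. r < dist x (p i) \<and> dist x (p i) \<le> r'} \<subseteq> {x. r < dist x (p i) \<and> dist x (p i) \<le> r' \<and> sgn (x - p i) \<in> A}"
  proof clarify
    fix x assume x: "x \<in> cell \<sigma> N p i" "r < dist x (p i)" "dist x (p i) \<le> r'"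
    then have "x \<noteq> p i" using r by auto
    then show "sgn (x - p i) \<in> A"
      using x sub[of "sgn (x - p i)" "dist x (p i)"] by (simp add: norm_sgn sgn_div_norm dist_norm)
  qed
  show "{x. r < dist x (p i) \<and> dist x (p i) \<le> r' \<and> sgn (x - p i) \<in> A} \<in> fmeasurable lborel"
    by (rule fmeasurable_lborel_bounded, measurable, rule bounded_subset[OF bounded_cball[of "p i" r']])
      (auto simp: dist_commute)
qed measurable

text \<open>Here \<open>A\<close> consists of directions along which the cell contains the whole
  width of the shell.\<close>

lemma measure_cell_shell_ge:
  fixes p :: "nat \<Rightarrow> 'a::euclidean_space"
  assumes A [measurable]: "A \<in> sets borel" and r: "0 \<le> r" "r \<le> r'"
    and sub: "\<And>u t. norm u = 1 \<Longrightarrow> r < t \<Longrightarrow> t \<le> r' \<Longrightarrow> u \<in> A \<Longrightarrow> p i + t *\<^sub>R u \<in> cell \<sigma> N p i"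
  shows "measure lborel {x \<in> cell \<sigma> N p i. r < dist x (p i) \<and> dist x (p i) \<le> r'} \<ge> (r' ^ DIM('a) - r ^ DIM('a)) * measure cone_measure A"
  unfolding measure_shell[OF A r, of "p i", symmetric]
proof (rule measure_mono_fmeasurable)
  show "{x. r < dist x (p i) \<and> dist x (p i) \<le> r' \<and> sgn (x - p i) \<in> A} \<subseteq> {x \<in> cell \<sigma> N p i. r < dist x (p i) \<and> dist x (p i) \<le> r'}"
  proof
    fix x assume "x \<in> {x. r < dist x (p i) \<and> dist x (p i) \<le> r' \<and> sgn (x - p i) \<in> A}"
    then have x: "sgn (x - p i) \<in> A" "r < dist x (p i)" "dist x (p i) \<le> r'" by auto
    then have "x \<noteq> p i" using r by auto
    then show "x \<in> {x \<in> cell \<sigma> N p i. r < dist x (p i) \<and> dist x (p i) \<le> r'}"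
      using x sub[of "sgn (x - p i)" "dist x (p i)"] by (simp add: norm_sgn sgn_div_norm dist_norm)
  qed
  show "{x \<in> cell \<sigma> N p i. r < dist x (p i) \<and> dist x (p i) \<le> r'} \<in> fmeasurable lborel"
    by (rule fmeasurable_lborel_bounded, measurable, rule bounded_subset[OF bounded_cball[of "p i" r']])
      (auto simp: dist_commute)
qed measurable

text \<open>The set of directions in which a nearest-point cell is seen at distance t shrinks as t
  grows, so the shell volume is pinched between the angles at its two radii. These inequalities
  stand in for the derivative formula V' = n r^(n-1) G(r).\<close>

lemma volume_diff_near:
  fixes p :: "nat \<Rightarrow> 'a::euclidean_space" and N :: nat
  assumes r: "0 \<le> r" "r \<le> r'"
  defines "V \<equiv> \<lambda>r. measure lborel (level_set 1 N p {..r})"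
  shows "cell_angle 1 N p r' * (r' ^ DIM('a) - r ^ DIM('a)) \<le> V r' - V r"
    "V r' - V r \<le> cell_angle 1 N p r * (r' ^ DIM('a) - r ^ DIM('a))"
proof -
  have diff: "V r' - V r = (\<Sum>i<N. measure lborel {x \<in> cell 1 N p i. r < dist x (p i) \<and> dist x (p i) \<le> r'})"
    unfolding V_def by (rule level_set_volume_diff[OF r(2)])
  show "cell_angle 1 N p r' * (r' ^ DIM('a) - r ^ DIM('a)) \<le> V r' - V r"
    unfolding diff cell_angle_def sum_distrib_right
  proof (rule sum_mono)
    fix i
    show "measure cone_measure {u. p i + r' *\<^sub>R u \<in> cell 1 N p i} * (r' ^ DIM('a) - r ^ DIM('a)) \<le>
      measure lborel {x \<in> cell 1 N p i. r < dist x (p i) \<and> dist x (p i) \<le> r'}"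
      unfolding mult.commute[of "measure cone_measure _"]
      by (rule measure_cell_shell_ge[OF cell_directions_borel r]) (use r in \<open>auto intro: cell_scale_near[where t = r']\<close>)
  qed
  show "V r' - V r \<le> cell_angle 1 N p r * (r' ^ DIM('a) - r ^ DIM('a))"
    unfolding diff cell_angle_def sum_distrib_right
  proof (rule sum_mono)
    fix i
    show "measure lborel {x \<in> cell 1 N p i. r < dist x (p i) \<and> dist x (p i) \<le> r'} \<le>
      measure cone_measure {u. p i + r *\<^sub>R u \<in> cell 1 N p i} * (r' ^ DIM('a) - r ^ DIM('a))"
      unfolding mult.commute[of "measure cone_measure _"]
      by (rule measure_cell_shell_le[OF cell_directions_borel r]) (use r in \<open>auto intro: cell_scale_near\<close>)
  qed
qed

text \<open>Farthest-point cells contain outward rays, so the sets of directions grow with the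
  distance and the two bounds exchange their radii.\<close>

lemma volume_diff_far:
  fixes p :: "nat \<Rightarrow> 'a::euclidean_space" and N :: nat
  assumes r: "0 \<le> r" "r \<le> r'"
  defines "V \<equiv> \<lambda>r. measure lborel (level_set (-1) N p {..r})"
  shows "cell_angle (-1) N p r * (r' ^ DIM('a) - r ^ DIM('a)) \<le> V r' - V r"
    "V r' - V r \<le> cell_angle (-1) N p r' * (r' ^ DIM('a) - r ^ DIM('a))"
proof -
  have diff: "V r' - V r = (\<Sum>i<N. measure lborel {x \<in> cell (-1) N p i. r < dist x (p i) \<and> dist x (p i) \<le> r'})"
    unfolding V_def by (rule level_set_volume_diff[OF r(2)])
  show "cell_angle (-1) N p r * (r' ^ DIM('a) - r ^ DIM('a)) \<le> V r' - V r"
    unfolding diff cell_angle_def sum_distrib_right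
  proof (rule sum_mono)
    fix i
    show "measure cone_measure {u. p i + r *\<^sub>R u \<in> cell (-1) N p i} * (r' ^ DIM('a) - r ^ DIM('a)) \<le>
      measure lborel {x \<in> cell (-1) N p i. r < dist x (p i) \<and> dist x (p i) \<le> r'}"
      unfolding mult.commute[of "measure cone_measure _"]
      by (rule measure_cell_shell_ge[OF cell_directions_borel r]) (use r in \<open>auto intro: cell_scale_far\<close>)
  qed
  show "V r' - V r \<le> cell_angle (-1) N p r' * (r' ^ DIM('a) - r ^ DIM('a))"
    unfolding diff cell_angle_def sum_distrib_right
  proof (rule sum_mono)
    fix i
    show "measure lborel {x \<in> cell (-1) N p i. r < dist x (p i) \<and> dist x (p i) \<le> r'} \<le>
      measure cone_measure {u. p i + r' *\<^sub>R u \<in> cell (-1) N p i} * (r' ^ DIM('a) - r ^ DIM('a))"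
      unfolding mult.commute[of "measure cone_measure _"]
      by (rule measure_cell_shell_le[OF cell_directions_borel r]) (use r in \<open>auto intro: cell_scale_far\<close>)
  qed
qed

section \<open>Strict edges of the joint configuration\<close>

text \<open>Without \<open>y\<close> the remaining points span a compact convex set that misses
  \<open>y\<close>, and a hyperplane separates the two.\<close>

lemma extreme_point_finite_exposed:
  fixes S :: "'a::euclidean_space set"
  assumes "finite S" "y extreme_point_of (convex hull S)"
  obtains b where "\<And>z. z \<in> S \<Longrightarrow> z \<noteq> y \<Longrightarrow> b \<bullet> z < b \<bullet> y"
proof -
  have "y \<notin> convex hull (S - {y})"
  proof
    assume "y \<in> convex hull (S - {y})"
    then have "y extreme_point_of (convex hull (S - {y}))"
      using assms(2) hull_mono[of "S - {y}" S convex]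
      by (auto simp: extreme_point_of_def)
    then have "y \<in> S - {y}" by (rule extreme_point_of_convex_hull)
    then show False by simp
  qed
  moreover have "closed (convex hull (S - {y}))"
    using assms(1) by (simp add: compact_imp_closed finite_imp_compact_convex_hull)
  ultimately obtain a b where ab: "a \<bullet> y < b" "\<And>x. x \<in> convex hull (S - {y}) \<Longrightarrow> a \<bullet> x > b"
    using separating_hyperplane_closed_point[of "convex hull (S - {y})" y] by auto
  show thesis
  proof
    fix z assume "z \<in> S" "z \<noteq> y"
    then have "a \<bullet> z > b" by (intro ab(2) hull_inc) auto
    then show "(-a) \<bullet> z < (-a) \<bullet> y" using ab(1) by simp
  qed
qed

text \<open>The polarised form of the overview. On a difference of joint points
  \<open>(p i, q i)\<close> it is the squared distance in \<open>p\<close> minus that in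
  \<open>q\<close>, so expansion makes it nonpositive there.\<close>

definition bform :: "'a::real_inner \<times> 'a \<Rightarrow> 'a \<times> 'a \<Rightarrow> real" where
  "bform x y = fst x \<bullet> fst y - snd x \<bullet> snd y"

lemma bilinear_bform: "bilinear bform"
  unfolding bilinear_def bform_def
  by (auto intro!: linearI simp: inner_add_left inner_add_right algebra_simps)

lemma bform_commute: "bform x y = bform y x"
  by (simp add: bform_def inner_commute)

lemma bform_polar: "2 * bform x y = bform x x + bform y y - bform (x - y) (x - y)"
  by (simp add: bform_def inner_diff_left inner_diff_right inner_commute)

text \<open>For one fixed argument the condition cuts out a half-space in the other, so it passes to
  the convex hull one argument at a time.\<close>

lemma bform_hull_nonneg:
  assumes "\<And>y z. y \<in> E \<Longrightarrow> z \<in> E \<Longrightarrow> bform y z \<ge> 0" "x \<in> convex hull E" "y \<in> convex hull E"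
  shows "bform x y \<ge> 0"
proof -
  have 1: "convex {x. bform x y \<ge> 0}" for y :: "'a \<times> 'a"
    unfolding convex_def
    by (auto simp: bilinear_ladd[OF bilinear_bform] bilinear_lmul[OF bilinear_bform])
  have 2: "bform x z \<ge> 0" if "x \<in> convex hull E" "z \<in> E" for x z
    using hull_minimal[of E "{x. bform x z \<ge> 0}" convex, OF _ 1] that assms(1) by blast
  have "bform y x \<ge> 0"
    using 2 hull_minimal[of E "{y. bform y x \<ge> 0}" convex, OF _ 1] assms(2,3)
    by (metis (no_types, lifting) bform_commute mem_Collect_eq subsetD subsetI)
  then show ?thesis by (simp add: bform_commute)
qed

text \<open>Consider the vertex figure at \<open>v\<close>: the directions to the other points, cut
  by a hyperplane. Its extreme points are edge directions, isotropic by assumption; polarisation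
  with \<open>nonpos\<close> makes the form nonnegative between any two of them, hence on their
  hull, which contains the direction to \<open>m\<close>. The opposite sign is \<open>nonpos\<close>
  itself.\<close>

lemma bform_vertex:
  fixes X :: "('a::euclidean_space \<times> 'a) set"
  assumes fin: "finite X" and nonpos: "\<And>x y. x \<in> X \<Longrightarrow> y \<in> X \<Longrightarrow> bform (x - y) (x - y) \<le> 0"
    and edges: "\<And>x y c. x \<in> X \<Longrightarrow> y \<in> X \<Longrightarrow> x \<noteq> y \<Longrightarrow> c \<bullet> x = c \<bullet> y \<Longrightarrow>
       (\<And>z. z \<in> X \<Longrightarrow> z \<in> closed_segment x y \<or> c \<bullet> z < c \<bullet> x) \<Longrightarrow> bform (x - y) (x - y) = 0"
    and v: "v extreme_point_of (convex hull X)" and m: "m \<in> X"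
  shows "bform (m - v) (m - v) = 0"
proof (cases "m = v")
  case True then show ?thesis by (simp add: bform_def)
next
  case False
  have vX: "v \<in> X" using v by (rule extreme_point_of_convex_hull)
  obtain b where b: "\<And>z. z \<in> X \<Longrightarrow> z \<noteq> v \<Longrightarrow> b \<bullet> z < b \<bullet> v"
    using extreme_point_finite_exposed[OF fin v] by blast
  define l where "l z = b \<bullet> v - b \<bullet> z" for z
  have lpos: "l z > 0" if "z \<in> X" "z \<noteq> v" for z using b[OF that] by (simp add: l_def)
  \<comment> \<open>Central projection of \<open>z - v\<close> onto the hyperplane where
    \<open>b\<close> takes the value -1.\<close>
  define Y where "Y z = (1 / l z) *\<^sub>R (z - v)" for z
  have zY: "z - v = l z *\<^sub>R Y z" if "z \<in> X" "z \<noteq> v" for z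
    using lpos[OF that] by (simp add: Y_def)
  have bY: "b \<bullet> Y z = -1" if "z \<in> X" "z \<noteq> v" for z
  proof -
    have "b \<bullet> (z - v) = - l z" by (simp add: l_def inner_diff_right)
    then show ?thesis using lpos[OF that] by (simp add: Y_def)
  qed
  define T where "T = Y ` (X - {v})"
  have finT: "finite T" using fin by (simp add: T_def)
  define E where "E = {y. y extreme_point_of (convex hull T)}"
  have hullE: "convex hull E = convex hull T"
    unfolding E_def using Krein_Milman_polytope[OF finT] by simp
  have ex: "\<exists>x\<in>X. x \<noteq> v \<and> Y x = y \<and> bform (x - v) (x - v) = 0" if "y \<in> E" for y
  proof -
    have yT: "y \<in> T" using that unfolding E_def by (auto dest: extreme_point_of_convex_hull)
    obtain a where a: "\<And>z. z \<in> T \<Longrightarrow> z \<noteq> y \<Longrightarrow> a \<bullet> z < a \<bullet> y"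
      using extreme_point_finite_exposed[OF finT, of y] \<open>y \<in> E\<close> unfolding E_def by blast
    \<comment> \<open>Several points of \<open>X\<close> may lie on the ray from \<open>v\<close>
      with direction \<open>y\<close>. The farthest one is chosen below as the end of the edge, so
      that all others lie on the segment.\<close>
    define R where "R = {x \<in> X. x \<noteq> v \<and> Y x = y}"
    have "finite R" "R \<noteq> {}" using fin yT by (auto simp: R_def T_def)
    then obtain x where x: "x \<in> R" "\<And>z. z \<in> R \<Longrightarrow> l z \<le> l x"
      using Max_in[of "l ` R"] Max_ge[of "l ` R"] by (smt (verit) empty_is_image finite_imageI imageE imageI)
    \<comment> \<open>Since \<open>b \<bullet> Y z = -1\<close>, this functional takes the value
      \<open>a \<bullet> Y z - a \<bullet> y\<close> at \<open>Y z\<close>: it vanishes on the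
      direction \<open>y\<close> and is negative on all others, so it exposes the edge.\<close>
    define c where "c = a + (a \<bullet> y) *\<^sub>R b"
    have cval: "c \<bullet> (z - v) = l z * (a \<bullet> Y z - a \<bullet> y)" if "z \<in> X" "z \<noteq> v" for z
      unfolding zY[OF that] c_def using bY[OF that] by (simp add: inner_add_left algebra_simps)
    have xX: "x \<in> X" "x \<noteq> v" "Y x = y" using x(1) by (auto simp: R_def)
    have "bform (v - x) (v - x) = 0"
    proof (rule edges[of _ _ c])
      show eq: "c \<bullet> v = c \<bullet> x" using cval[OF xX(1,2)] xX(3) by (simp add: inner_diff_right)
      fix z assume z: "z \<in> X"
      show "z \<in> closed_segment v x \<or> c \<bullet> z < c \<bullet> v"
      proof (cases "z = v")
        case False
        show ?thesis
        proof (cases "Y z = y")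
          case True
          then have "z \<in> R" using z False by (simp add: R_def)
          then have le: "l z \<le> l x" using x(2) by blast
          have "z - v = (l z / l x) *\<^sub>R (x - v)"
            using zY[OF z False] zY[OF xX(1,2)] True xX(3) lpos[OF xX(1,2)] by simp
          then have "z = v + (l z / l x) *\<^sub>R (x - v)" by (simp add: algebra_simps)
          then have "z \<in> closed_segment v x"
            using le lpos[OF xX(1,2)] lpos[OF z False]
            unfolding closed_segment_def by (auto intro!: exI[of _ "l z / l x"] simp: algebra_simps)
          then show ?thesis by blast
        next
          case F: False
          have "Y z \<in> T" using z False by (auto simp: T_def)
          then have "c \<bullet> (z - v) < 0"
            unfolding cval[OF z False] using a[OF _ F] lpos[OF z False] by (simp add: mult_pos_neg)
          then show ?thesis by (simp add: inner_diff_right)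
        qed
      qed simp
    qed (use vX xX in auto)
    then have "bform (x - v) (x - v) = 0" by (simp add: bform_def inner_diff_left inner_diff_right inner_commute)
    then show ?thesis using xX by blast
  qed
  have nonneg: "bform y z \<ge> 0" if yE: "y \<in> E" and zE: "z \<in> E" for y z
  proof -
    obtain x where x: "x \<in> X" "x \<noteq> v" "Y x = y" "bform (x - v) (x - v) = 0" using ex[OF yE] by blast
    obtain w where w: "w \<in> X" "w \<noteq> v" "Y w = z" "bform (w - v) (w - v) = 0" using ex[OF zE] by blast
    \<comment> \<open>In the polar identity the two squares vanish, and what remains is minus a
      nonpositive number.\<close>
    have "2 * bform (x - v) (w - v) \<ge> 0"
      unfolding bform_polar using x(4) w(4) nonpos[OF x(1) w(1)] by simp
    then have "l x * (l w * bform y z) \<ge> 0"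
      unfolding zY[OF x(1,2)] zY[OF w(1,2)] x(3) w(3)
      by (simp add: bilinear_lmul[OF bilinear_bform] bilinear_rmul[OF bilinear_bform] mult.left_commute)
    then show ?thesis using lpos[OF x(1,2)] lpos[OF w(1,2)] by (simp add: zero_le_mult_iff)
  qed
  have "Y m \<in> T" using m False by (simp add: T_def)
  then have mem: "Y m \<in> convex hull E" unfolding hullE by (rule hull_inc)
  have "bform (Y m) (Y m) \<ge> 0" by (rule bform_hull_nonneg[OF nonneg mem mem])
  then have "bform (m - v) (m - v) \<ge> 0"
    unfolding zY[OF m False] using lpos[OF m False]
    by (simp add: bilinear_lmul[OF bilinear_bform] bilinear_rmul[OF bilinear_bform])
  then show ?thesis using nonpos[OF m vX] by linarith
qed

text \<open>Otherwise every vertex is isotropic relative to every point of \<open>X\<close>.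
  Polarisation then makes \<open>bform (x - y0) (y - y0)\<close> vanish for all vertices
  \<open>x\<close> and \<open>y\<close>, and \<open>x0 - y0\<close> is a convex combination of such
  differences, against strictness.\<close>

lemma ex_strict_edge:
  fixes X :: "('a::euclidean_space \<times> 'a) set"
  assumes fin: "finite X" and nonpos: "\<And>x y. x \<in> X \<Longrightarrow> y \<in> X \<Longrightarrow> bform (x - y) (x - y) \<le> 0"
    and strict: "x0 \<in> X" "y0 \<in> X" "bform (x0 - y0) (x0 - y0) < 0"
  obtains x y c where "x \<in> X" "y \<in> X" "bform (x - y) (x - y) < 0" "c \<bullet> x = c \<bullet> y"
    "\<And>z. z \<in> X \<Longrightarrow> z \<in> closed_segment x y \<or> c \<bullet> z < c \<bullet> x"
proof -
  have "\<exists>x y c. x \<in> X \<and> y \<in> X \<and> bform (x - y) (x - y) < 0 \<and> c \<bullet> x = c \<bullet> y \<and>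
    (\<forall>z\<in>X. z \<in> closed_segment x y \<or> c \<bullet> z < c \<bullet> x)"
  proof (rule ccontr)
    assume neg: "\<not> ?thesis"
    have edges: "bform (x - y) (x - y) = 0" if "x \<in> X" "y \<in> X" "c \<bullet> x = c \<bullet> y"
       "\<And>z. z \<in> X \<Longrightarrow> z \<in> closed_segment x y \<or> c \<bullet> z < c \<bullet> x" for x y c
      using neg that nonpos[OF that(1,2)] by (meson less_eq_real_def)
    define V where "V = {v. v extreme_point_of (convex hull X)}"
    have V: "bform (m - v) (m - v) = 0" if "v \<in> V" "m \<in> X" for v m
    proof (rule bform_vertex[OF fin nonpos])
      fix x y c assume "x \<in> X" "y \<in> X" "c \<bullet> x = c \<bullet> y"
        "\<And>z. z \<in> X \<Longrightarrow> z \<in> closed_segment x y \<or> c \<bullet> z < c \<bullet> x"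
      then show "bform (x - y) (x - y) = 0" by (rule edges)
    qed (use that in \<open>auto simp: V_def\<close>)
    have VX: "V \<subseteq> X" unfolding V_def by (auto dest: extreme_point_of_convex_hull)
    have sym: "bform (x - y) (x - y) = bform (y - x) (y - x)" for x y :: "'a \<times> 'a"
      by (simp add: bform_def inner_diff_left inner_diff_right inner_commute)
    have "bform (x - y0) (y - y0) \<ge> 0" if "x \<in> V" "y \<in> V" for x y
    proof -
      have "2 * bform (x - y0) (y - y0) = 0"
        unfolding bform_polar using V[OF that(1) strict(2)] V[OF that(2) strict(2)] V[of y x] that VX
        by (auto simp: sym[of _ y0])
      then show ?thesis by simp
    qed
    then have nonneg: "bform y z \<ge> 0" if "y \<in> (\<lambda>x. x - y0) ` V" "z \<in> (\<lambda>x. x - y0) ` V" for y z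
      using that by blast
    have mem: "x0 - y0 \<in> convex hull ((\<lambda>x. x - y0) ` V)"
    proof -
      have "x0 \<in> convex hull V"
        unfolding V_def using Krein_Milman_polytope[OF fin] strict(1) by (metis hull_inc)
      then have "x0 - y0 \<in> (\<lambda>x. x - y0) ` (convex hull V)" by (rule imageI)
      moreover have "convex hull ((\<lambda>x. x - y0) ` V) = (\<lambda>x. x - y0) ` (convex hull V)"
        using convex_hull_translation[of "-y0" V] by (simp add: algebra_simps image_image)
      ultimately show ?thesis by simp
    qed
    have "bform (x0 - y0) (x0 - y0) \<ge> 0" by (rule bform_hull_nonneg[OF nonneg mem mem])
    then show False using strict by linarith
  qed
  then show thesis using that by blast
qed

section \<open>Integration by parts against a bump function\<close>

text \<open>A radial weight with compact support whose square is continuously differentiable: the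
  gradient of \<open>(bump x)\<^sup>2 / 4\<close> is \<open>- bump x *\<^sub>R x\<close>. This
  identity replaces the one for the Gaussian.\<close>

definition bump :: "'a::real_inner \<Rightarrow> real" where
  "bump x = max 0 (1 - x \<bullet> x)"

lemma bump_nonneg: "0 \<le> bump x"
  and bump_eq_0: "norm x \<ge> 1 \<Longrightarrow> bump x = 0"
  by (auto simp: bump_def dot_square_norm max_def intro: antisym)

lemma continuous_on_bump [continuous_intros]:
  "continuous_on S f \<Longrightarrow> continuous_on S (\<lambda>x. bump (f x))"
  unfolding bump_def by (intro continuous_intros)

lemma has_real_derivative_max0_sq:
  "((\<lambda>y::real. (max 0 y)\<^sup>2) has_real_derivative 2 * max 0 y) (at y)"
proof -
  consider "y > 0" | "y < 0" | "y = 0" by linarith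
  then show ?thesis
  proof cases
    case 1
    have "((\<lambda>y::real. y\<^sup>2) has_real_derivative 2 * y) (at y)"
      by (auto intro!: derivative_eq_intros)
    then have "((\<lambda>y::real. (max 0 y)\<^sup>2) has_real_derivative 2 * y) (at y)"
      by (rule DERIV_cong_ev[THEN iffD1, rotated -1])
        (use 1 in \<open>auto intro!: eventually_mono[OF eventually_nhds_in_open[of "{0<..}"]]\<close>)
    then show ?thesis using 1 by simp
  next
    case 2
    have "((\<lambda>y::real. 0) has_real_derivative 0) (at y)" by simp
    then have "((\<lambda>y::real. (max 0 y)\<^sup>2) has_real_derivative 0) (at y)"
      by (rule DERIV_cong_ev[THEN iffD1, rotated -1])
        (use 2 in \<open>auto intro!: eventually_mono[OF eventually_nhds_in_open[of "{..<0}"]]\<close>)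
    then show ?thesis using 2 by simp
  next
    case 3
    have "((\<lambda>h::real. (max 0 h)\<^sup>2 / h) \<longlongrightarrow> 0) (at 0)"
    proof (rule tendsto_0_le[where K = 1])
      show "((\<lambda>h::real. h) \<longlongrightarrow> 0) (at 0)" by (rule tendsto_ident_at)
      show "\<forall>\<^sub>F h::real in at 0. norm ((max 0 h)\<^sup>2 / h) \<le> norm h * 1"
        by (auto intro!: always_eventually simp: max_def power2_eq_square)
    qed
    then show ?thesis using 3 by (simp add: DERIV_def)
  qed
qed

text \<open>The weight lives on the unit ball; a box around the ball of radius 2 leaves room for
  translations of length at most 1.\<close>

definition wbox :: "'a::euclidean_space set" where
  "wbox = cbox (-(2 *\<^sub>R One)) (2 *\<^sub>R One)"

lemma cball_subset_wbox: "cball 0 2 \<subseteq> (wbox :: 'a::euclidean_space set)"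
proof
  fix x :: 'a assume "x \<in> cball 0 2"
  then have "\<bar>x \<bullet> b\<bar> \<le> 2" if "b \<in> Basis" for b
    using Basis_le_norm[OF that, of x] by simp
  then show "x \<in> wbox" by (auto simp: wbox_def mem_box abs_le_iff) (smt (verit))
qed

lemma integral_support_eq:
  fixes f :: "'a::euclidean_space \<Rightarrow> real"
  assumes "\<And>x. x \<notin> S \<Longrightarrow> f x = 0" "S \<subseteq> A" "S \<subseteq> B"
  shows "integral A f = integral B f"
proof -
  have "(\<lambda>x. if x \<in> A then f x else 0) = (\<lambda>x. if x \<in> B then f x else 0)"
    using assms by (auto simp: fun_eq_iff)
  then show ?thesis by (metis integral_restrict_UNIV)
qed

lemma integral_wbox_translation:
  fixes f :: "'a::euclidean_space \<Rightarrow> real"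
  assumes f: "\<And>x. norm x > 1 \<Longrightarrow> f x = 0" and c: "norm c \<le> 1"
  shows "integral wbox (\<lambda>x. f (x + c)) = integral wbox f"
proof -
  let ?B = "cbox (- (2 *\<^sub>R One) + c) (2 *\<^sub>R One + c)"
  have "integral wbox (\<lambda>x. f (x + c)) = integral ?B f"
    using integral_shift_cbox[of "- (2 *\<^sub>R One) + c" c "2 *\<^sub>R One + c" f]
    by (simp add: wbox_def)
  also have "\<dots> = integral wbox f"
  proof (rule integral_support_eq[where S = "cball 0 1"])
    show "cball 0 1 \<subseteq> ?B"
    proof
      fix x :: 'a assume "x \<in> cball 0 1"
      then have "x - c \<in> cball 0 2" using c norm_triangle_ineq4[of x c] by simp
      then have "x - c \<in> wbox" using cball_subset_wbox by blast
      then show "x \<in> ?B" by (auto simp: wbox_def mem_box inner_diff_left inner_add_left)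
    qed
    show "cball 0 1 \<subseteq> (wbox :: 'a set)" using cball_subset_wbox by (meson cball_subset_cball_iff order_trans subset_cball one_le_numeral)
  qed (use f in auto)
  finally show ?thesis .
qed

text \<open>The integral of \<open>(bump x)\<^sup>2 / 4 * F x\<close> does not change when the
  argument is shifted by \<open>s *\<^sub>R v\<close>; the formula says that its derivative at
  \<open>s = 0\<close> vanishes.\<close>

lemma integration_by_parts_bump:
  fixes F F' :: "'a::euclidean_space \<Rightarrow> real" and v :: 'a
  assumes contF: "continuous_on UNIV F" and contF': "continuous_on UNIV F'"
    and deriv: "\<And>x s. ((\<lambda>s. F (x + s *\<^sub>R v)) has_real_derivative F' (x + s *\<^sub>R v)) (at s)"
  shows "integral wbox (\<lambda>x. bump x * (x \<bullet> v) * F x) = integral wbox (\<lambda>x. (bump x)\<^sup>2 / 4 * F' x)"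
proof -
  \<comment> \<open>Shifts with \<open>\<bar>s\<bar> \<le> e\<close> have length at most 1 and keep
    the support inside \<open>wbox\<close>; the \<open>+ 1\<close> covers
    \<open>v = 0\<close>.\<close>
  define e where "e = 1 / (norm v + 1)"
  have e: "e > 0" "e * norm v \<le> 1"
    by (auto simp: e_def divide_simps add_nonneg_pos)
  let ?U = "{-e..e}"
  let ?f = "\<lambda>s x. (bump (x + s *\<^sub>R v))\<^sup>2 / 4 * F (x + s *\<^sub>R v)"
  let ?f' = "\<lambda>s x. (bump (x + s *\<^sub>R v))\<^sup>2 / 4 * F' (x + s *\<^sub>R v) - bump (x + s *\<^sub>R v) * ((x + s *\<^sub>R v) \<bullet> v) * F (x + s *\<^sub>R v)"
  have cF [continuous_intros]: "continuous_on S (\<lambda>x. F (g x))" "continuous_on S (\<lambda>x. F' (g x))" if "continuous_on S g"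
    for S and g :: "'c::topological_space \<Rightarrow> 'a"
    using continuous_on_compose2[OF contF that] continuous_on_compose2[OF contF' that] by auto
  have D: "((\<lambda>s. ?f s x) has_real_derivative ?f' s x) (at s)" for s x
  proof -
    have 1: "((\<lambda>s. 1 - (x + s *\<^sub>R v) \<bullet> (x + s *\<^sub>R v)) has_real_derivative - 2 * ((x + s *\<^sub>R v) \<bullet> v)) (at s)"
      unfolding inner_add_left inner_add_right inner_scaleR_left inner_scaleR_right
      by (auto intro!: derivative_eq_intros simp: inner_commute algebra_simps)
    have 2: "((\<lambda>s. (bump (x + s *\<^sub>R v))\<^sup>2) has_real_derivative 2 * bump (x + s *\<^sub>R v) * (- 2 * ((x + s *\<^sub>R v) \<bullet> v))) (at s)"
      unfolding bump_def by (rule DERIV_chain2[OF has_real_derivative_max0_sq 1])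
    have alg: "2 * b * (- 2 * k) / 4 * f + f' * (b\<^sup>2 / 4) = b\<^sup>2 / 4 * f' - b * k * f" for b k f f' :: real
      by simp
    show ?thesis
      by (rule DERIV_cong[OF DERIV_mult[OF DERIV_cdivide[OF 2, of 4] deriv] alg])
  qed
  have const: "integral wbox (?f s) = integral wbox (?f 0)" if "s \<in> ?U" for s
  proof -
    have "\<bar>s\<bar> \<le> e" using that by (simp add: abs_le_iff)
    then have "\<bar>s\<bar> * norm v \<le> e * norm v" by (rule mult_right_mono) simp
    then have "norm (s *\<^sub>R v) \<le> 1" using e(2) by simp
    moreover have "(bump x)\<^sup>2 / 4 * F x = 0" if "norm x > 1" for x :: 'a
      using bump_eq_0[of x] that by simp
    ultimately show ?thesis
      using integral_wbox_translation[of "\<lambda>x. (bump x)\<^sup>2 / 4 * F x" "s *\<^sub>R v"]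
      by (simp only: scaleR_zero_left add_0_right)
  qed
  have "((\<lambda>s. integral (cbox (-(2 *\<^sub>R One)) (2 *\<^sub>R One)) (?f s)) has_field_derivative integral (cbox (-(2 *\<^sub>R One)) (2 *\<^sub>R One)) (?f' 0)) (at 0 within ?U)"
  proof (rule leibniz_rule_field_derivative)
    show "((\<lambda>s. ?f s x) has_real_derivative ?f' s x) (at s within ?U)" for s x
      using D by (rule has_field_derivative_at_within)
    show "?f s integrable_on cbox (-(2 *\<^sub>R One)) (2 *\<^sub>R One)" for s
      by (intro integrable_continuous continuous_intros) auto
    show "continuous_on (?U \<times> cbox (-(2 *\<^sub>R One)) (2 *\<^sub>R One)) (\<lambda>(s, x). ?f' s x)"
      unfolding case_prod_beta by (intro continuous_intros) auto
  qed (use e in auto)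
  then have "((\<lambda>s. integral wbox (?f 0)) has_field_derivative integral wbox (?f' 0)) (at 0 within ?U)"
    unfolding wbox_def[symmetric]
    by (rule has_field_derivative_transform_within[OF _ zero_less_one]) (use e const in \<open>force+\<close>)
  moreover have "((\<lambda>s. integral wbox (?f 0)) has_field_derivative 0) (at 0 within ?U)" by simp
  moreover have "at 0 within ?U \<noteq> bot" using e by (simp add: trivial_limit_within islimpt_Icc)
  ultimately have "integral wbox (?f' 0) = 0"
    using has_field_derivative_unique by blast
  moreover have "integral wbox (?f' 0) = integral wbox (\<lambda>x. (bump x)\<^sup>2 / 4 * F' x) - integral wbox (\<lambda>x. bump x * (x \<bullet> v) * F x)"
    unfolding wbox_def scaleR_zero_left add_0_right
    by (intro integral_diff integrable_continuous continuous_intros) auto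
  ultimately show ?thesis by simp
qed

section \<open>Softmax interpolation\<close>

definition partition_fun :: "nat \<Rightarrow> real \<Rightarrow> (nat \<Rightarrow> 'a::real_inner) \<Rightarrow> 'a \<Rightarrow> real" where
  "partition_fun N \<beta> P z = (\<Sum>k<N. exp (\<beta> * (P k \<bullet> z)))"

definition softmax :: "nat \<Rightarrow> real \<Rightarrow> (nat \<Rightarrow> 'a::real_inner) \<Rightarrow> nat \<Rightarrow> 'a \<Rightarrow> real" where
  "softmax N \<beta> P i z = exp (\<beta> * (P i \<bullet> z)) / partition_fun N \<beta> P z"

lemma partition_fun_pos: "N > 0 \<Longrightarrow> partition_fun N \<beta> P z > 0"
  unfolding partition_fun_def by (intro sum_pos) auto

lemma softmax_nonneg: "N > 0 \<Longrightarrow> softmax N \<beta> P i z \<ge> 0"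
  using partition_fun_pos[of N \<beta> P z] by (simp add: softmax_def)

lemma sum_softmax: "N > 0 \<Longrightarrow> (\<Sum>i<N. softmax N \<beta> P i z) = 1"
  using partition_fun_pos[of N \<beta> P z]
  by (simp add: softmax_def partition_fun_def flip: sum_divide_distrib)

lemma continuous_on_partition_fun [continuous_intros]:
  fixes g :: "'c::topological_space \<Rightarrow> 'a::real_inner"
  assumes "\<And>k. k < N \<Longrightarrow> continuous_on S (\<lambda>x. P x k)" "continuous_on S g"
  shows "continuous_on S (\<lambda>x. partition_fun N \<beta> (P x) (g x))"
  unfolding partition_fun_def by (intro continuous_intros assms) auto

lemma continuous_on_softmax [continuous_intros]:
  fixes g :: "'c::topological_space \<Rightarrow> 'a::real_inner"
  assumes "N > 0" "i < N" "\<And>k. k < N \<Longrightarrow> continuous_on S (\<lambda>x. P x k)" "continuous_on S g"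
  shows "continuous_on S (\<lambda>x. softmax N \<beta> (P x) i (g x))"
proof -
  have "partition_fun N \<beta> (P x) (g x) \<noteq> 0" for x
    using partition_fun_pos[OF assms(1), of \<beta> "P x" "g x"] by linarith
  then show ?thesis
    unfolding softmax_def by (intro continuous_intros assms ballI) auto
qed

lemma softmax_directional_derivative:
  fixes z v :: "'a::real_inner"
  assumes "N > 0"
  shows "((\<lambda>s. softmax N \<beta> P i (z + s *\<^sub>R v)) has_real_derivative
     \<beta> * softmax N \<beta> P i (z + s *\<^sub>R v) * (P i \<bullet> v - (\<Sum>j<N. softmax N \<beta> P j (z + s *\<^sub>R v) * (P j \<bullet> v)))) (at s)"
proof -
  have e: "((\<lambda>s. exp (\<beta> * (P k \<bullet> (z + s *\<^sub>R v)))) has_real_derivative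
      exp (\<beta> * (P k \<bullet> (z + s *\<^sub>R v))) * (\<beta> * (P k \<bullet> v))) (at s)" for k
    by (auto intro!: derivative_eq_intros simp: inner_add_right)
  have Z: "((\<lambda>s. partition_fun N \<beta> P (z + s *\<^sub>R v)) has_real_derivative
     (\<Sum>k<N. exp (\<beta> * (P k \<bullet> (z + s *\<^sub>R v))) * (\<beta> * (P k \<bullet> v)))) (at s)"
    unfolding partition_fun_def by (intro DERIV_sum e)
  have Z0: "partition_fun N \<beta> P (z + s *\<^sub>R v) \<noteq> 0" using partition_fun_pos[OF assms] by (metis less_irrefl)
  have s: "(\<Sum>j<N. softmax N \<beta> P j (z + s *\<^sub>R v) * (P j \<bullet> v)) =
     (\<Sum>j<N. exp (\<beta> * (P j \<bullet> (z + s *\<^sub>R v))) * (P j \<bullet> v)) / partition_fun N \<beta> P (z + s *\<^sub>R v)"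
    by (simp add: softmax_def sum_divide_distrib)
  have s2: "(\<Sum>k<N. exp (\<beta> * (P k \<bullet> (z + s *\<^sub>R v))) * (\<beta> * (P k \<bullet> v))) =
     \<beta> * (\<Sum>j<N. exp (\<beta> * (P j \<bullet> (z + s *\<^sub>R v))) * (P j \<bullet> v))"
    by (simp add: sum_distrib_left mult_ac)
  have alg: "(e * (\<beta> * a) * Z - e * (\<beta> * S)) / (Z * Z) = \<beta> * (e / Z) * (a - S / Z)" if "Z \<noteq> 0" for e a Z S :: real
    using that by (simp add: divide_simps) (simp add: algebra_simps)
  show ?thesis
    unfolding s unfolding softmax_def
    by (rule DERIV_cong[OF DERIV_divide[OF e Z Z0]], unfold s2, rule alg[OF Z0])
qed

text \<open>A covariance written as a symmetric sum over pairs. For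
  \<open>M i j = P i \<bullet> P' j\<close> the bracket on the right factors as
  \<open>(P i - P j) \<bullet> (P' i - P' j)\<close>.\<close>

lemma sum_pairs_softmax:
  fixes c :: "nat \<Rightarrow> real" and M :: "nat \<Rightarrow> nat \<Rightarrow> real"
  assumes "(\<Sum>i<N. c i) = 1"
  shows "(\<Sum>i<N. c i * (M i i - (\<Sum>j<N. c j * M j i))) =
     (\<Sum>i<N. \<Sum>j<N. c i * c j * (M i i + M j j - M i j - M j i)) / 2"
proof -
  have 1: "(\<Sum>i<N. \<Sum>j<N. c i * c j * M i i) = (\<Sum>i<N. c i * M i i)"
  proof -
    have "(\<Sum>j<N. c i * c j * M i i) = c i * M i i * (\<Sum>j<N. c j)" for i
      by (simp add: sum_distrib_left mult_ac)
    then show ?thesis by (simp add: assms)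
  qed
  have 2: "(\<Sum>i<N. \<Sum>j<N. c i * c j * M j j) = (\<Sum>i<N. c i * M i i)"
    by (subst sum.swap, subst 1[symmetric]) (simp add: mult_ac)
  have 3: "(\<Sum>i<N. \<Sum>j<N. c i * c j * M i j) = (\<Sum>i<N. \<Sum>j<N. c i * c j * M j i)"
    by (subst sum.swap) (simp add: mult_ac)
  have "(\<Sum>i<N. \<Sum>j<N. c i * c j * (M i i + M j j - M i j - M j i)) =
    (\<Sum>i<N. \<Sum>j<N. c i * c j * M i i) + (\<Sum>i<N. \<Sum>j<N. c i * c j * M j j)
    - (\<Sum>i<N. \<Sum>j<N. c i * c j * M i j) - (\<Sum>i<N. \<Sum>j<N. c i * c j * M j i)"
    by (simp add: distrib_left right_diff_distrib sum.distrib sum_subtractf)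
  also have "\<dots> = 2 * ((\<Sum>i<N. c i * M i i) - (\<Sum>i<N. \<Sum>j<N. c i * c j * M j i))"
    unfolding 1 2 3 by simp
  also have "(\<Sum>i<N. c i * M i i) - (\<Sum>i<N. \<Sum>j<N. c i * c j * M j i) =
     (\<Sum>i<N. c i * (M i i - (\<Sum>j<N. c j * M j i)))"
    by (simp add: sum_distrib_left right_diff_distrib sum_subtractf mult.assoc)
  finally show ?thesis by simp
qed

text \<open>Up to an error of order \<open>1 / \<beta>\<close> this is the weighted integral of the
  support function; smoothing the maximum makes it differentiable along a motion of the
  points.\<close>

definition smooth_width :: "nat \<Rightarrow> real \<Rightarrow> (nat \<Rightarrow> 'a::euclidean_space) \<Rightarrow> real" where
  "smooth_width N \<beta> P = integral wbox (\<lambda>z. bump z * (ln (partition_fun N \<beta> P z) / \<beta>))"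

lemma integrable_on_wbox: "continuous_on UNIV (f :: 'a::euclidean_space \<Rightarrow> real) \<Longrightarrow> f integrable_on wbox"
  unfolding wbox_def by (rule integrable_continuous) (erule continuous_on_subset, simp)

text \<open>Differentiation under the integral gives the softmax mean of
  \<open>P' \<theta> i \<bullet> z\<close>. Integration by parts in direction
  \<open>P' \<theta> i\<close> trades the factor \<open>z\<close> for a derivative of the weight,
  and symmetrising over pairs leaves half the derivative of each squared distance. Hence an
  expanding motion increases the width.\<close>

lemma smooth_width_derivative:
  fixes P P' :: "real \<Rightarrow> nat \<Rightarrow> 'a::euclidean_space"
  assumes N: "N > 0" and \<beta>: "\<beta> > 0"
    and der: "\<And>\<theta> i. ((\<lambda>\<theta>. P \<theta> i) has_vector_derivative P' \<theta> i) (at \<theta>)"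
    and cont: "\<And>i. continuous_on UNIV (\<lambda>\<theta>. P' \<theta> i)"
  shows "((\<lambda>\<theta>. smooth_width N \<beta> (P \<theta>)) has_real_derivative
     integral wbox (\<lambda>z. (bump z)\<^sup>2 / 4 * (\<beta> / 2 * (\<Sum>i<N. \<Sum>j<N. softmax N \<beta> (P \<theta>) i z * softmax N \<beta> (P \<theta>) j z *
         ((P \<theta> i - P \<theta> j) \<bullet> (P' \<theta> i - P' \<theta> j)))))) (at \<theta>)"
proof -
  let ?\<pi> = "softmax N \<beta> (P \<theta>)"
  have contP: "continuous_on S (\<lambda>\<theta>. P \<theta> i)" for i S
    by (rule continuous_at_imp_continuous_on) (use has_vector_derivative_continuous[OF der] in simp)
  have cP [continuous_intros]: "continuous_on S (\<lambda>x. P (g x) i)" "continuous_on S (\<lambda>x. P' (g x) i)"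
    if "continuous_on S g" for S i and g :: "'c::topological_space \<Rightarrow> real"
    using continuous_on_compose2[OF contP that] continuous_on_compose2[OF cont that] by auto
  let ?f = "\<lambda>\<theta> z. bump z * (ln (partition_fun N \<beta> (P \<theta>) z) / \<beta>)"
  let ?f' = "\<lambda>\<theta> z. bump z * (\<Sum>i<N. softmax N \<beta> (P \<theta>) i z * (P' \<theta> i \<bullet> z))"
  have Z0: "partition_fun N \<beta> P z \<noteq> 0" for P :: "nat \<Rightarrow> 'a" and z
    using partition_fun_pos[OF N] by (metis less_irrefl)
  have D: "((\<lambda>\<theta>. ?f \<theta> z) has_real_derivative ?f' \<theta> z) (at \<theta>)" for \<theta> z
  proof -
    have i: "((\<lambda>\<theta>. P \<theta> k \<bullet> z) has_real_derivative P' \<theta> k \<bullet> z) (at \<theta>)" for k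
      using has_derivative_inner_left[OF der[unfolded has_vector_derivative_def, of k \<theta>], of z]
      unfolding has_field_derivative_def by (rule has_derivative_eq_rhs) (simp add: fun_eq_iff)
    have e: "((\<lambda>\<theta>. exp (\<beta> * (P \<theta> k \<bullet> z))) has_real_derivative
        exp (\<beta> * (P \<theta> k \<bullet> z)) * (\<beta> * (P' \<theta> k \<bullet> z))) (at \<theta>)" for k
      by (auto intro!: derivative_eq_intros i)
    have Z: "((\<lambda>\<theta>. partition_fun N \<beta> (P \<theta>) z) has_real_derivative
       (\<Sum>k<N. exp (\<beta> * (P \<theta> k \<bullet> z)) * (\<beta> * (P' \<theta> k \<bullet> z)))) (at \<theta>)"
      unfolding partition_fun_def by (intro DERIV_sum e)
    have "((\<lambda>\<theta>. ln (partition_fun N \<beta> (P \<theta>) z)) has_real_derivative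
       1 / partition_fun N \<beta> (P \<theta>) z * (\<Sum>k<N. exp (\<beta> * (P \<theta> k \<bullet> z)) * (\<beta> * (P' \<theta> k \<bullet> z)))) (at \<theta>)"
      by (rule DERIV_chain2[OF DERIV_ln_divide[OF partition_fun_pos[OF N]] Z])
    also have "1 / partition_fun N \<beta> (P \<theta>) z * (\<Sum>k<N. exp (\<beta> * (P \<theta> k \<bullet> z)) * (\<beta> * (P' \<theta> k \<bullet> z))) =
      \<beta> * (\<Sum>i<N. softmax N \<beta> (P \<theta>) i z * (P' \<theta> i \<bullet> z))"
      by (simp add: softmax_def sum_distrib_left mult_ac)
    finally show ?thesis
      by (rule DERIV_cong[OF DERIV_cmult[OF DERIV_cdivide]]) (use \<beta> in simp)
  qed
  have "((\<lambda>\<theta>. integral (cbox (-(2 *\<^sub>R One)) (2 *\<^sub>R One)) (?f \<theta>)) has_field_derivative integral (cbox (-(2 *\<^sub>R One)) (2 *\<^sub>R One)) (?f' \<theta>)) (at \<theta> within UNIV)"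
  proof (rule leibniz_rule_field_derivative)
    show "((\<lambda>s. ?f s x) has_real_derivative ?f' s x) (at s within UNIV)" for s x
      using D by simp
    show "?f s integrable_on cbox (-(2 *\<^sub>R One)) (2 *\<^sub>R One)" for s
      by (intro integrable_continuous continuous_intros ballI Z0) (use \<beta> in simp_all)
    show "continuous_on (UNIV \<times> cbox (-(2 *\<^sub>R One)) (2 *\<^sub>R One)) (\<lambda>(s, x). ?f' s x)"
      unfolding case_prod_beta by (intro continuous_intros) (use N in auto)
  qed auto
  then have 1: "((\<lambda>\<theta>. smooth_width N \<beta> (P \<theta>)) has_real_derivative integral wbox (?f' \<theta>)) (at \<theta>)"
    unfolding wbox_def smooth_width_def by simp
  have cpi: "continuous_on UNIV (?\<pi> i)" if "i < N" for i
    using continuous_on_softmax[OF N that, of UNIV "\<lambda>_. P \<theta>" "\<lambda>z. z"] by (simp add: continuous_on_id)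
  have "integral wbox (?f' \<theta>) = integral wbox (\<lambda>z. \<Sum>i<N. bump z * (z \<bullet> P' \<theta> i) * ?\<pi> i z)"
    by (simp add: sum_distrib_left inner_commute mult_ac)
  also have "\<dots> = (\<Sum>i<N. integral wbox (\<lambda>z. bump z * (z \<bullet> P' \<theta> i) * ?\<pi> i z))"
    by (intro integral_sum integrable_on_wbox continuous_intros cpi) auto
  also have "\<dots> = (\<Sum>i<N. integral wbox (\<lambda>z. (bump z)\<^sup>2 / 4 *
      (\<beta> * ?\<pi> i z * (P \<theta> i \<bullet> P' \<theta> i - (\<Sum>j<N. ?\<pi> j z * (P \<theta> j \<bullet> P' \<theta> i))))))"
    by (intro sum.cong refl integration_by_parts_bump softmax_directional_derivative[OF N] continuous_intros cpi) auto
  also have "\<dots> = integral wbox (\<lambda>z. \<Sum>i<N. (bump z)\<^sup>2 / 4 *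
      (\<beta> * ?\<pi> i z * (P \<theta> i \<bullet> P' \<theta> i - (\<Sum>j<N. ?\<pi> j z * (P \<theta> j \<bullet> P' \<theta> i)))))"
    by (intro integral_sum[symmetric] integrable_on_wbox continuous_intros cpi) auto
  also have "\<dots> = integral wbox (\<lambda>z. (bump z)\<^sup>2 / 4 * (\<beta> * (\<Sum>i<N. ?\<pi> i z * (P \<theta> i \<bullet> P' \<theta> i - (\<Sum>j<N. ?\<pi> j z * (P \<theta> j \<bullet> P' \<theta> i))))))"
    by (simp add: sum_distrib_left mult.assoc)
  also have "\<dots> = integral wbox (\<lambda>z. (bump z)\<^sup>2 / 4 * (\<beta> / 2 * (\<Sum>i<N. \<Sum>j<N. ?\<pi> i z * ?\<pi> j z *
         ((P \<theta> i - P \<theta> j) \<bullet> (P' \<theta> i - P' \<theta> j)))))"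
  proof -
    have "(\<Sum>i<N. ?\<pi> i z * (P \<theta> i \<bullet> P' \<theta> i - (\<Sum>j<N. ?\<pi> j z * (P \<theta> j \<bullet> P' \<theta> i)))) =
      (\<Sum>i<N. \<Sum>j<N. ?\<pi> i z * ?\<pi> j z * ((P \<theta> i - P \<theta> j) \<bullet> (P' \<theta> i - P' \<theta> j))) / 2" for z
      unfolding sum_pairs_softmax[OF sum_softmax[OF N], where M = "\<lambda>i j. P \<theta> i \<bullet> P' \<theta> j"]
      by (intro arg_cong2[where f = "(/)"] sum.cong refl arg_cong2[where f = "(*)"])
        (simp add: inner_diff_left inner_diff_right)
    then have "\<beta> * (\<Sum>i<N. ?\<pi> i z * (P \<theta> i \<bullet> P' \<theta> i - (\<Sum>j<N. ?\<pi> j z * (P \<theta> j \<bullet> P' \<theta> i)))) =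
      \<beta> / 2 * (\<Sum>i<N. \<Sum>j<N. ?\<pi> i z * ?\<pi> j z * ((P \<theta> i - P \<theta> j) \<bullet> (P' \<theta> i - P' \<theta> j)))" for z
      by (simp only: times_divide_eq_right times_divide_eq_left)
    then show ?thesis by (simp only:)
  qed
  finally show ?thesis using 1 by (simp only:)
qed

section \<open>A lower bound for the derivative\<close>

text \<open>The support function of the convex hull of the points. \<open>Max\<close> is unspecified
  on the empty set, hence the recurring assumption \<open>N > 0\<close>.\<close>

definition support_max :: "nat \<Rightarrow> (nat \<Rightarrow> 'a::real_inner) \<Rightarrow> 'a \<Rightarrow> real" where
  "support_max N P x = Max ((\<lambda>i. P i \<bullet> x) ` {..<N})"

lemma support_max_ge: "i < N \<Longrightarrow> P i \<bullet> x \<le> support_max N P x"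
  by (simp add: support_max_def)

lemma support_max_attained: "N > 0 \<Longrightarrow> \<exists>i<N. support_max N P x = P i \<bullet> x"
  using Max_in[of "(\<lambda>i. P i \<bullet> x) ` {..<N}"] unfolding support_max_def
  by (metis (no_types, lifting) finite_imageI finite_lessThan image_iff image_is_empty lessThan_empty_iff lessThan_iff not_gr_zero)

lemma support_max_diff_le:
  assumes "N > 0" "\<And>i. i < N \<Longrightarrow> norm (P i) \<le> D"
  shows "support_max N P x - support_max N P y \<le> D * norm (x - y)"
proof -
  obtain i where i: "i < N" "support_max N P x = P i \<bullet> x" using support_max_attained[OF assms(1)] by blast
  have "P i \<bullet> x - P i \<bullet> y \<le> norm (P i) * norm (x - y)"
    by (metis inner_diff_right norm_cauchy_schwarz)
  also have "\<dots> \<le> D * norm (x - y)" using assms(2)[OF i(1)] by (intro mult_right_mono) auto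
  finally show ?thesis using i support_max_ge[OF i(1), of P y] by linarith
qed

lemma ex_norm_bound: "\<exists>D>0. \<forall>i<(N::nat). norm (P i :: 'a::real_normed_vector) \<le> D"
proof -
  have "norm (P i) \<le> (\<Sum>i<N. norm (P i)) + 1" if "i < N" for i
  proof -
    have "norm (P i) \<le> (\<Sum>i<N. norm (P i))" using that by (intro member_le_sum) auto
    then show ?thesis by simp
  qed
  then show ?thesis by (intro exI[of _ "(\<Sum>i<N. norm (P i)) + 1"]) (auto intro!: add_nonneg_pos sum_nonneg)
qed

lemma continuous_on_support_max:
  assumes "N > 0" shows "continuous_on S (support_max N P)"
proof -
  obtain D where D: "D > 0" "\<And>i. i < N \<Longrightarrow> norm (P i) \<le> D" using ex_norm_bound by blast
  have "dist (support_max N P x) (support_max N P y) \<le> D * dist x y" for x y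
    using support_max_diff_le[of N P D x y] support_max_diff_le[of N P D y x] D assms
    by (simp add: dist_norm norm_minus_commute abs_le_iff)
  then have "D-lipschitz_on S (support_max N P)" using D by (intro lipschitz_onI) auto
  then show ?thesis by (rule lipschitz_on_continuous_on)
qed

lemma support_max_le_lse:
  assumes "N > 0" "\<beta> > 0"
  shows "support_max N P z \<le> ln (partition_fun N \<beta> P z) / \<beta>"
    and "ln (partition_fun N \<beta> P z) / \<beta> \<le> support_max N P z + ln N / \<beta>"
proof -
  obtain i where i: "i < N" "support_max N P z = P i \<bullet> z" using support_max_attained[OF assms(1)] by blast
  have "exp (\<beta> * support_max N P z) \<le> partition_fun N \<beta> P z"
    unfolding partition_fun_def i(2)
    using member_le_sum[of i "{..<N}" "\<lambda>i. exp (\<beta> * (P i \<bullet> z))"] i(1) by simp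
  then have "\<beta> * support_max N P z \<le> ln (partition_fun N \<beta> P z)"
    using partition_fun_pos[OF assms(1), of \<beta> P z] by (simp add: ln_ge_iff)
  then show "support_max N P z \<le> ln (partition_fun N \<beta> P z) / \<beta>" using assms by (simp add: field_simps)
  have "partition_fun N \<beta> P z \<le> (\<Sum>k<N. exp (\<beta> * support_max N P z))"
    unfolding partition_fun_def using assms by (intro sum_mono) (simp add: support_max_ge)
  then have "partition_fun N \<beta> P z \<le> N * exp (\<beta> * support_max N P z)" by simp
  then have "ln (partition_fun N \<beta> P z) \<le> ln (N * exp (\<beta> * support_max N P z))"
    using partition_fun_pos[OF assms(1), of \<beta> P z] assms by (subst ln_le_cancel_iff) auto
  also have "\<dots> = ln N + \<beta> * support_max N P z" using assms by (simp add: ln_mult)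
  finally show "ln (partition_fun N \<beta> P z) / \<beta> \<le> support_max N P z + ln N / \<beta>"
    using assms by (simp add: field_simps)
qed

text \<open>Cover the smaller ball by parallel slabs and translate them all into the central slab of the larger ball.\<close>
lemma measure_central_slab:
  fixes x0 e :: "'a::euclidean_space" and m :: nat
  assumes e: "e \<noteq> 0" and x0: "x0 \<bullet> e = 0" and \<delta>: "\<delta> > 0" and m: "m > 0"
  shows "measure lebesgue (ball x0 \<delta>) \<le> m * measure lebesgue {y \<in> ball x0 (2 * \<delta>). \<bar>y \<bullet> e\<bar> \<le> \<delta> * norm e / m}"
proof -
  define \<eta> where "\<eta> = \<delta> * norm e / m"
  have \<eta>: "\<eta> > 0" "m * \<eta> = \<delta> * norm e" using e \<delta> m by (auto simp: \<eta>_def)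
  \<comment> \<open>The centres of \<open>m\<close> adjacent slabs of half-width
    \<open>\<eta>\<close> that tile the interval from \<open>- \<delta> * norm e\<close> to
    \<open>\<delta> * norm e\<close>, which holds the values of \<open>x \<bullet> e\<close> on the
    small ball.\<close>
  define c where "c k = (2 * real k + 1) * \<eta> - \<delta> * norm e" for k
  define A where "A k = {x \<in> ball x0 \<delta>. \<bar>x \<bullet> e - c k\<bar> \<le> \<eta>}" for k
  define B where "B = {y \<in> ball x0 (2 * \<delta>). \<bar>y \<bullet> e\<bar> \<le> \<eta>}"
  have meas: "{y \<in> ball x0 r. \<bar>y \<bullet> e - t\<bar> \<le> \<eta>} \<in> lmeasurable" for r t
  proof -
    have "closed {y. \<bar>y \<bullet> e - t\<bar> \<le> \<eta>}" by (intro closed_Collect_le continuous_intros)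
    then have "ball x0 r \<inter> {y. \<bar>y \<bullet> e - t\<bar> \<le> \<eta>} \<in> lmeasurable"
      by (intro fmeasurable_Int_fmeasurable) auto
    then show ?thesis by (simp add: Int_def)
  qed
  have mA: "A k \<in> lmeasurable" for k unfolding A_def by (rule meas)
  have mB: "B \<in> lmeasurable" unfolding B_def using meas[of "2 * \<delta>" 0] by simp
  have AB: "measure lebesgue (A k) \<le> measure lebesgue B" if k: "k < m" for k
  proof -
    have "real k + 1 \<le> m" using k by simp
    then have "(2 * real k + 1) * \<eta> \<le> (2 * m) * \<eta>" using \<eta> by (intro mult_right_mono) auto
    moreover have "0 \<le> (2 * real k + 1) * \<eta>" using \<eta> by simp
    ultimately have ck: "\<bar>c k\<bar> \<le> \<delta> * norm e" using \<eta>(2) by (simp add: c_def abs_le_iff)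
    \<comment> \<open>The shift along \<open>e\<close> that moves slab \<open>k\<close> to level 0.
      Its length is at most \<open>\<delta>\<close>, which is why the target ball has radius
      \<open>2 * \<delta>\<close>.\<close>
    define t where "t = (- c k / (e \<bullet> e)) *\<^sub>R e"
    have te: "t \<bullet> e = - c k" using e by (simp add: t_def)
    have "norm t = \<bar>c k\<bar> / norm e" using e by (simp add: t_def dot_square_norm power2_eq_square)
    then have nt: "norm t \<le> \<delta>" using ck e by (simp add: divide_le_eq)
    have "(+) t ` A k \<subseteq> B"
    proof clarify
      fix x assume x: "x \<in> A k"
      have "dist x0 (t + x) \<le> dist x0 x + norm t"
        by (metis add.commute dist_add_cancel dist_norm dist_triangle norm_minus_commute add_diff_cancel_left')
      then show "t + x \<in> B" using x nt te by (auto simp: A_def B_def inner_add_left)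
    qed
    then have "measure lebesgue ((+) t ` A k) \<le> measure lebesgue B"
      using mA by (intro measure_mono_fmeasurable fmeasurableD measurable_translation mB)
    then show ?thesis by (simp add: measure_translation)
  qed
  have "ball x0 \<delta> \<subseteq> (\<Union>k<m. A k)"
  proof
    fix x assume x: "x \<in> ball x0 \<delta>"
    define s where "s = x \<bullet> e + \<delta> * norm e"
    have "\<bar>(x - x0) \<bullet> e\<bar> \<le> norm (x - x0) * norm e" by (rule Cauchy_Schwarz_ineq2)
    moreover have "norm (x - x0) * norm e < \<delta> * norm e"
      using x e by (intro mult_strict_right_mono) (auto simp: dist_norm norm_minus_commute)
    ultimately have "\<bar>x \<bullet> e\<bar> < \<delta> * norm e" using x0 by (simp add: inner_diff_left)
    then have s: "0 < s" "s < 2 * (m * \<eta>)" using \<eta>(2) by (auto simp: s_def)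
    define k where "k = nat \<lfloor>s / (2 * \<eta>)\<rfloor>"
    have k: "real k \<le> s / (2 * \<eta>)" "s / (2 * \<eta>) < real k + 1"
      using s \<eta> by (auto simp: k_def)
    have "s / (2 * \<eta>) < m" using s(2) \<eta>(1) by (simp add: divide_less_eq mult_ac)
    then have "real k < m" using k(1) by linarith
    moreover have "\<bar>x \<bullet> e - c k\<bar> \<le> \<eta>"
      using k \<eta>(1) by (simp add: c_def field_simps s_def abs_le_iff)
    ultimately show "x \<in> (\<Union>k<m. A k)" using x by (auto simp: A_def)
  qed
  then have "measure lebesgue (ball x0 \<delta>) \<le> measure lebesgue (\<Union>k<m. A k)"
    using mA by (intro measure_mono_fmeasurable) auto
  also have "\<dots> \<le> (\<Sum>k<m. measure lebesgue (A k))"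
    using mA by (intro measure_UNION_le) auto
  also have "\<dots> \<le> (\<Sum>k<m. measure lebesgue B)" by (intro sum_mono AB) auto
  finally show ?thesis by (simp add: B_def \<eta>_def)
qed

text \<open>A slab of thickness of order \<open>1 / \<beta>\<close>, compensated by the factor
  \<open>\<beta>\<close>. The bound depends on \<open>e\<close> only through \<open>D\<close>, so it
  is uniform along the rotation.\<close>

lemma measure_central_slab_ge:
  fixes x0 e :: "'a::euclidean_space"
  assumes e: "e \<noteq> 0" "norm e \<le> D" and x0: "x0 \<bullet> e = 0" and \<delta>: "\<delta> > 0" and \<beta>: "\<beta> \<ge> 1"
  shows "\<beta> * measure lebesgue {y \<in> ball x0 (2 * \<delta>). \<bar>y \<bullet> e\<bar> \<le> 1 / \<beta>} \<ge> measure lebesgue (ball x0 \<delta>) / (\<delta> * D + 1)"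
proof -
  \<comment> \<open>Enough slabs for the half-width to be at most \<open>1 / \<beta>\<close>.
    Rounding up costs one slab, absorbed by the \<open>+ 1\<close> in
    \<open>\<delta> * D + 1\<close> because \<open>\<beta> \<ge> 1\<close>.\<close>
  define m where "m = nat \<lceil>\<beta> * \<delta> * norm e\<rceil>"
  have pos: "\<beta> * \<delta> * norm e > 0" using assms by auto
  then have m: "\<beta> * \<delta> * norm e \<le> m" "m \<le> \<beta> * \<delta> * norm e + 1" "m > 0"
    by (auto simp: m_def)
  let ?M = "\<lambda>c. measure lebesgue {y \<in> ball x0 (2 * \<delta>). \<bar>y \<bullet> e\<bar> \<le> c}"
  have meas: "{y \<in> ball x0 (2 * \<delta>). \<bar>y \<bullet> e\<bar> \<le> c} \<in> lmeasurable" for c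
  proof -
    have "closed {y. \<bar>y \<bullet> e\<bar> \<le> c}" by (intro closed_Collect_le continuous_intros)
    then have "ball x0 (2 * \<delta>) \<inter> {y. \<bar>y \<bullet> e\<bar> \<le> c} \<in> lmeasurable"
      by (intro fmeasurable_Int_fmeasurable) auto
    then show ?thesis by (simp add: Int_def)
  qed
  have "\<delta> * norm e / m \<le> 1 / \<beta>" using m \<beta> by (simp add: field_simps)
  then have le: "?M (\<delta> * norm e / m) \<le> ?M (1 / \<beta>)"
    using meas by (intro measure_mono_fmeasurable fmeasurableD) auto
  have "\<beta> * \<delta> * norm e \<le> \<beta> * \<delta> * D" using assms by (intro mult_left_mono) auto
  moreover have "\<beta> * (\<delta> * D + 1) = \<beta> * \<delta> * D + \<beta>" by (simp add: algebra_simps)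
  ultimately have "m \<le> \<beta> * (\<delta> * D + 1)" using m(2) \<beta> by linarith
  then have "m * ?M (\<delta> * norm e / m) \<le> (\<beta> * (\<delta> * D + 1)) * ?M (1 / \<beta>)"
    using le by (intro mult_mono) auto
  then have "measure lebesgue (ball x0 \<delta>) \<le> (\<delta> * D + 1) * (\<beta> * ?M (1 / \<beta>))"
    using measure_central_slab[OF e(1) x0 \<delta> m(3)] by (simp add: mult_ac)
  moreover have "\<delta> * D + 1 > 0" using assms(2) \<delta> norm_ge_zero[of e] by (smt (verit) mult_nonneg_nonneg)
  ultimately show ?thesis by (simp add: divide_le_eq mult_ac)
qed

text \<open>Every exponent is at most that of \<open>i\<close> plus 1, and that of \<open>j\<close>
  is at least that of \<open>i\<close> minus 1: this accounts for \<open>exp 2\<close>, and the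
  number of terms for \<open>N\<close>.\<close>

lemma softmax_edge_ge:
  fixes P :: "nat \<Rightarrow> 'a::real_inner"
  assumes N: "N > 0" "i < N" "j < N" and \<beta>: "\<beta> > 0" and ij: "\<bar>z \<bullet> (P i - P j)\<bar> \<le> 1 / \<beta>"
    and others: "\<And>k. k < N \<Longrightarrow> P k \<bullet> z \<le> P i \<bullet> z + 1 / \<beta>"
  shows "softmax N \<beta> P i z \<ge> 1 / (N * exp 2)" "softmax N \<beta> P j z \<ge> 1 / (N * exp 2)"
proof -
  have "partition_fun N \<beta> P z \<le> (\<Sum>k<N. exp (\<beta> * (P i \<bullet> z) + 1))"
    unfolding partition_fun_def
  proof (intro sum_mono)
    fix k assume "k \<in> {..<N}"
    then have "\<beta> * (P k \<bullet> z) \<le> \<beta> * (P i \<bullet> z + 1 / \<beta>)" using others \<beta> by (intro mult_left_mono) auto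
    also have "\<dots> = \<beta> * (P i \<bullet> z) + 1" using \<beta> by (simp add: distrib_left)
    finally show "exp (\<beta> * (P k \<bullet> z)) \<le> exp (\<beta> * (P i \<bullet> z) + 1)" by simp
  qed
  then have Z: "partition_fun N \<beta> P z \<le> N * exp (\<beta> * (P i \<bullet> z) + 1)" by simp
  have key: "softmax N \<beta> P k z \<ge> 1 / (N * exp 2)" if "\<beta> * (P k \<bullet> z) \<ge> \<beta> * (P i \<bullet> z) - 1" for k
  proof -
    have "1 / (N * exp 2) = exp (\<beta> * (P i \<bullet> z) - 1) / (N * exp (\<beta> * (P i \<bullet> z) + 1))"
      using N by (simp add: field_simps flip: exp_add)
    also have "\<dots> \<le> exp (\<beta> * (P k \<bullet> z)) / partition_fun N \<beta> P z"
      using Z that partition_fun_pos[OF N(1)] by (intro frac_le) auto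
    finally show ?thesis by (simp add: softmax_def)
  qed
  show "softmax N \<beta> P i z \<ge> 1 / (N * exp 2)" by (rule key) simp
  have "P j \<bullet> z \<ge> P i \<bullet> z - 1 / \<beta>"
    using ij by (simp add: inner_diff_right inner_commute[of z] abs_le_iff)
  then have "\<beta> * (P j \<bullet> z) \<ge> \<beta> * (P i \<bullet> z - 1 / \<beta>)" using \<beta> by (intro mult_left_mono) auto
  then show "softmax N \<beta> P j z \<ge> 1 / (N * exp 2)" using \<beta> by (intro key) (simp add: right_diff_distrib)
qed

text \<open>The width never decreases on the quarter turn, since each pair term is
  \<open>sin \<theta> * cos \<theta>\<close> times a difference of squared distances. On the middle
  third one strict edge forces a rate of at least \<open>C0\<close>, whatever \<open>\<beta>\<close>
  is.\<close>

lemma smooth_width_rotation_gap: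
  fixes p q :: "nat \<Rightarrow> 'a::euclidean_space"
  assumes N: "N > 0" and le: "\<And>i j. i < N \<Longrightarrow> j < N \<Longrightarrow> dist (p i) (p j) \<le> dist (q i) (q j)"
    and strict: "i0 < N" "j0 < N" "dist (p i0) (p j0) < dist (q i0) (q j0)"
  obtains C where "C > 0" "\<And>\<beta>. \<beta> \<ge> 1 \<Longrightarrow>
    smooth_width N \<beta> (\<lambda>i. (p i, 0::'a)) + C \<le> smooth_width N \<beta> (\<lambda>i. (0::'a, q i))"
proof -
  define Q where "Q i = (p i, q i)" for i
  have bform_Q: "bform (Q i - Q j) (Q i - Q j) = (dist (p i) (p j))\<^sup>2 - (dist (q i) (q j))\<^sup>2" for i j
    by (simp add: bform_def Q_def dist_norm power2_norm_eq_inner)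
  obtain x y c where xyc: "x \<in> Q ` {..<N}" "y \<in> Q ` {..<N}" "bform (x - y) (x - y) < 0" "c \<bullet> x = c \<bullet> y"
    "\<And>z. z \<in> Q ` {..<N} \<Longrightarrow> z \<in> closed_segment x y \<or> c \<bullet> z < c \<bullet> x"
  proof (rule ex_strict_edge[of "Q ` {..<N}" "Q i0" "Q j0"])
    show "bform (x - y) (x - y) \<le> 0" if "x \<in> Q ` {..<N}" "y \<in> Q ` {..<N}" for x y
      using that le by (auto simp: bform_Q intro!: power_mono)
    show "bform (Q i0 - Q j0) (Q i0 - Q j0) < 0"
      using strict(3) by (simp add: bform_Q power_strict_mono)
  qed (use strict in auto)
  then obtain i j where ij: "i < N" "j < N" "x = Q i" "y = Q j" by auto
  define \<Delta> where "\<Delta> = (dist (q i) (q j))\<^sup>2 - (dist (p i) (p j))\<^sup>2"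
  have \<Delta>: "\<Delta> > 0" using xyc(3) by (simp add: \<Delta>_def ij bform_Q)
  \<comment> \<open>A positive multiple of \<open>c\<close> exposes the same edge. With
    \<open>norm a \<le> 1 / 8\<close> the point \<open>w\<close> below has norm at most 1/4, and the
    slab around it stays in the ball of radius 1/2, where \<open>bump\<close> is at least
    3/4.\<close>
  define a where "a = (1 / (8 * (norm c + 1))) *\<^sub>R c"
  have s8: "1 / (8 * (norm c + 1)) > 0" by (simp add: add_nonneg_pos)
  have "norm a = norm c / (8 * (norm c + 1))" by (simp add: a_def)
  also have "\<dots> \<le> 1 / 8" by (simp add: divide_le_eq add_nonneg_pos)
  finally have na: "norm a \<le> 1 / 8" .
  have aij: "a \<bullet> Q i = a \<bullet> Q j" using xyc(4) ij by (simp add: a_def)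
  have ak: "Q k \<in> closed_segment (Q i) (Q j) \<or> a \<bullet> Q k < a \<bullet> Q i" if "k < N" for k
  proof -
    have "c \<bullet> Q k < c \<bullet> Q i \<Longrightarrow> a \<bullet> Q k < a \<bullet> Q i"
      unfolding a_def inner_scaleR_left by (rule mult_strict_left_mono[OF _ s8])
    then show ?thesis using xyc(5)[of "Q k"] that ij by blast
  qed
  obtain \<eta> where \<eta>: "\<eta> > 0" "\<And>k. k < N \<Longrightarrow> Q k \<in> closed_segment (Q i) (Q j) \<or> a \<bullet> Q k \<le> a \<bullet> Q i - \<eta>"
  proof -
    \<comment> \<open>The inserted 1 keeps the set nonempty when every point lies on the
      edge.\<close>
    let ?G = "insert 1 ((\<lambda>k. a \<bullet> Q i - a \<bullet> Q k) ` {k. k < N \<and> a \<bullet> Q k < a \<bullet> Q i})"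
    have fin: "finite ?G" by simp
    have "Min ?G > 0" using fin by (subst Min_gr_iff) auto
    moreover have "Q k \<in> closed_segment (Q i) (Q j) \<or> a \<bullet> Q k \<le> a \<bullet> Q i - Min ?G" if "k < N" for k
    proof -
      have "a \<bullet> Q k < a \<bullet> Q i \<Longrightarrow> Min ?G \<le> a \<bullet> Q i - a \<bullet> Q k" using that fin by (intro Min_le) auto
      then show ?thesis using ak[OF that] by fastforce
    qed
    ultimately show thesis using that by blast
  qed
  obtain D where D: "D > 0" "\<And>k. k < N \<Longrightarrow> norm (Q k) \<le> D" using ex_norm_bound[of N Q] by blast
  \<comment> \<open>Slab points lie within \<open>2 * \<delta>\<close> of \<open>w\<close>, and
    differences of the moving points have norm at most \<open>2 * D\<close>. Inner products with
    them thus change by at most \<open>4 * \<delta> * D \<le> \<eta>\<close>, not enough to overturn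
    the gap.\<close>
  define \<delta> where "\<delta> = min (1 / 8) (\<eta> / (4 * D))"
  have \<delta>: "\<delta> > 0" "\<delta> \<le> 1 / 8" "4 * \<delta> * D \<le> \<eta>"
    using \<eta>(1) D(1) by (auto simp: \<delta>_def min_def field_simps)
  define P where "P \<theta> k = (cos \<theta> *\<^sub>R p k, sin \<theta> *\<^sub>R q k)" for \<theta> :: real and k
  define P' where "P' \<theta> k = ((- sin \<theta>) *\<^sub>R p k, cos \<theta> *\<^sub>R q k)" for \<theta> :: real and k
  have der: "((\<lambda>\<theta>. P \<theta> k) has_vector_derivative P' \<theta> k) (at \<theta>)" for \<theta> k
    unfolding P_def P'_def by (intro has_vector_derivative_Pair) (auto intro!: derivative_eq_intros)
  have cont: "continuous_on UNIV (\<lambda>\<theta>. P' \<theta> k)" for k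
    unfolding P'_def by (intro continuous_intros)
  have PP': "(P \<theta> k - P \<theta> l) \<bullet> (P' \<theta> k - P' \<theta> l) = sin \<theta> * cos \<theta> * ((dist (q k) (q l))\<^sup>2 - (dist (p k) (p l))\<^sup>2)" for \<theta> k l
    unfolding P_def P'_def dist_norm power2_norm_eq_inner
    by (simp add: scaleR_diff_right[symmetric] right_diff_distrib del: scaleR_minus_left)
  have normP: "norm (P \<theta> k) \<le> norm (Q k)" for \<theta> k
  proof -
    have "(cos \<theta>)\<^sup>2 * (norm (p k))\<^sup>2 \<le> 1 * (norm (p k))\<^sup>2" "(sin \<theta>)\<^sup>2 * (norm (q k))\<^sup>2 \<le> 1 * (norm (q k))\<^sup>2"
      by (intro mult_right_mono; simp add: abs_square_le_1)+
    then show ?thesis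
      by (simp add: P_def Q_def norm_Pair power_mult_distrib add_mono)
  qed
  define F where "F \<beta> \<theta> z = (bump z)\<^sup>2 / 4 * (\<beta> / 2 * (\<Sum>i<N. \<Sum>j<N. softmax N \<beta> (P \<theta>) i z * softmax N \<beta> (P \<theta>) j z *
         ((P \<theta> i - P \<theta> j) \<bullet> (P' \<theta> i - P' \<theta> j))))" for \<beta> \<theta> z
  have DF: "((\<lambda>\<theta>. smooth_width N \<beta> (P \<theta>)) has_real_derivative integral wbox (F \<beta> \<theta>)) (at \<theta>)" if "\<beta> \<ge> 1" for \<beta> \<theta>
    unfolding F_def using that by (intro smooth_width_derivative[OF N] der cont) auto
  have csoft: "continuous_on UNIV (softmax N \<beta> (P \<theta>) k)" if "k < N" for \<beta> \<theta> k
    using continuous_on_softmax[OF N that, of UNIV "\<lambda>_. P \<theta>" "\<lambda>z. z"] by (simp add: continuous_on_id)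
  have Fint: "F \<beta> \<theta> integrable_on wbox" for \<beta> \<theta>
    unfolding F_def by (intro integrable_on_wbox continuous_intros csoft) auto
  have term_nonneg: "softmax N \<beta> (P \<theta>) k z * softmax N \<beta> (P \<theta>) l z * ((P \<theta> k - P \<theta> l) \<bullet> (P' \<theta> k - P' \<theta> l)) \<ge> 0"
    if "0 \<le> \<theta>" "\<theta> \<le> pi / 2" "k < N" "l < N" for \<beta> \<theta> z k l
  proof -
    have "sin \<theta> \<ge> 0" using that by (intro sin_ge_zero) auto
    moreover have "cos \<theta> \<ge> 0" using that by (intro cos_ge_zero) auto
    moreover have "(dist (p k) (p l))\<^sup>2 \<le> (dist (q k) (q l))\<^sup>2" using le that by (intro power_mono) auto
    ultimately show ?thesis unfolding PP' by (intro mult_nonneg_nonneg softmax_nonneg N) auto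
  qed
  have Fnonneg: "F \<beta> \<theta> z \<ge> 0" if "\<beta> \<ge> 1" "0 \<le> \<theta>" "\<theta> \<le> pi / 2" for \<beta> \<theta> z
    unfolding F_def using that by (intro mult_nonneg_nonneg sum_nonneg term_nonneg) auto
  \<comment> \<open>The product of the bounds used in \<open>FS\<close>: 1/8 from the bump, 1/2 from
    \<open>\<beta> / 2\<close>, two weights \<open>1 / (N * exp 2)\<close>, and 1/4 from
    \<open>sin \<theta> * cos \<theta>\<close>.\<close>
  define K where "K = \<Delta> / (64 * (N * exp 2)\<^sup>2)"
  define C0 where "C0 = K * (measure lebesgue (ball (0::'a \<times> 'a) \<delta>) / (\<delta> * (2 * D) + 1))"
  have C0: "C0 > 0"
  proof -
    have "measure lebesgue (ball (0::'a \<times> 'a) \<delta>) > 0" using \<delta>(1) by (simp add: content_ball_pos)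
    moreover have "\<delta> * (2 * D) + 1 > 0" using \<delta> D by (simp add: add_pos_pos)
    moreover have "K > 0" using \<Delta> N by (simp add: K_def)
    ultimately show ?thesis unfolding C0_def by (intro mult_pos_pos divide_pos_pos) 
  qed
  have lower: "integral wbox (F \<beta> \<theta>) \<ge> C0" if \<beta>: "\<beta> \<ge> 1" and \<theta>: "pi / 6 \<le> \<theta>" "\<theta> \<le> pi / 3" for \<beta> \<theta>
  proof -
    have th: "0 \<le> \<theta>" "\<theta> \<le> pi / 2" using \<theta> pi_gt_zero by linarith+
    have co: "cos \<theta> \<ge> 1 / 2" using cos_monotone_0_pi_le[of \<theta> "pi / 3"] \<theta> th by (simp add: cos_60)
    have si: "sin \<theta> \<ge> 1 / 2" using sin_monotone_2pi_le[of "pi / 6" \<theta>] \<theta> th pi_gt_zero by (simp add: sin_30)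
    \<comment> \<open>Dividing the blocks by \<open>cos \<theta>\<close> and
      \<open>sin \<theta>\<close> undoes the rotation in inner products, so \<open>w\<close> exposes
      for \<open>P \<theta>\<close> the edge that \<open>a\<close> exposes for \<open>Q\<close>. The
      restriction on the angle keeps both divisors at least 1/2.\<close>
    define w where "w = (fst a /\<^sub>R cos \<theta>, snd a /\<^sub>R sin \<theta>)"
    have wP: "w \<bullet> P \<theta> k = a \<bullet> Q k" for k
    proof -
      have "cos \<theta> \<noteq> 0" "sin \<theta> \<noteq> 0" using co si by auto
      then show ?thesis by (cases a) (simp add: w_def P_def Q_def mult.assoc[symmetric])
    qed
    have nw: "norm w \<le> 1 / 4"
    proof -
      have inv2: "norm (v /\<^sub>R t) \<le> 2 * norm v" if "t \<ge> 1 / 2" for t and v :: 'a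
      proof -
        have "inverse t \<le> 2" using that le_imp_inverse_le[of "1 / 2" t] by simp
        then have "inverse t * norm v \<le> 2 * norm v" by (rule mult_right_mono) simp
        then show ?thesis using that by simp
      qed
      have "norm (fst a /\<^sub>R cos \<theta>) \<le> 2 * norm (fst a)" "norm (snd a /\<^sub>R sin \<theta>) \<le> 2 * norm (snd a)"
        by (rule inv2[OF co], rule inv2[OF si])
      then have "norm w \<le> norm (2 * norm (fst a), 2 * norm (snd a))"
        unfolding w_def norm_Pair by (intro real_sqrt_le_mono add_mono power_mono) auto
      also have "\<dots> = norm (2 *\<^sub>R a)" by (cases a) (simp add: norm_Pair)
      finally show ?thesis using na by simp
    qed
    define e where "e = P \<theta> i - P \<theta> j"
    have e0: "e \<noteq> 0"
    proof
      assume "e = 0"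
      then have "p i = p j" "q i = q j" using co si by (auto simp: e_def P_def zero_prod_def)
      then show False using \<Delta> by (simp add: \<Delta>_def)
    qed
    have eD: "norm e \<le> 2 * D"
      unfolding e_def using norm_triangle_ineq4[of "P \<theta> i" "P \<theta> j"] normP[of \<theta> i] normP[of \<theta> j] D(2)[OF ij(1)] D(2)[OF ij(2)]
      by linarith
    have we: "w \<bullet> e = 0" by (simp add: e_def inner_diff_right wP aij)
    define S where "S = {y \<in> ball w (2 * \<delta>). \<bar>y \<bullet> e\<bar> \<le> 1 / \<beta>}"
    have Sm: "S \<in> lmeasurable"
    proof -
      have "closed {y. \<bar>y \<bullet> e\<bar> \<le> 1 / \<beta>}" by (intro closed_Collect_le continuous_intros)
      then have "ball w (2 * \<delta>) \<inter> {y. \<bar>y \<bullet> e\<bar> \<le> 1 / \<beta>} \<in> lmeasurable"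
        by (intro fmeasurable_Int_fmeasurable) auto
      then show ?thesis by (simp add: S_def Int_def)
    qed
    have Sn: "norm z \<le> 1 / 2" if "z \<in> S" for z
    proof -
      have "norm (z - w) < 2 * \<delta>" using that by (simp add: S_def dist_norm norm_minus_commute)
      then show ?thesis using nw \<delta>(2) norm_triangle_sub[of z w] by linarith
    qed
    have FS: "F \<beta> \<theta> z \<ge> K * \<beta>" if zS: "z \<in> S" for z
    proof -
      have zw: "norm (z - w) < 2 * \<delta>" using zS by (simp add: S_def dist_norm norm_minus_commute)
      have "(norm z)\<^sup>2 \<le> (1 / 2)\<^sup>2" using Sn[OF zS] by (intro power_mono) auto
      then have "bump z \<ge> 3 / 4" by (simp add: bump_def dot_square_norm power2_eq_square)
      then have "(bump z)\<^sup>2 \<ge> (3 / 4)\<^sup>2" by (intro power_mono) auto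
      then have b: "(bump z)\<^sup>2 / 4 \<ge> 1 / 8" by (simp add: power2_eq_square)
      \<comment> \<open>A point on the edge segment differs from \<open>P \<theta> i\<close> by at
        most one multiple of \<open>e\<close>, worth at most \<open>1 / \<beta>\<close> in the slab;
        any other point is kept below by the gap \<open>\<eta>\<close>.\<close>
      have others: "P \<theta> k \<bullet> z \<le> P \<theta> i \<bullet> z + 1 / \<beta>" if k: "k < N" for k
        using \<eta>(2)[OF k]
      proof
        assume "Q k \<in> closed_segment (Q i) (Q j)"
        then obtain u where u: "0 \<le> u" "u \<le> 1" "Q k = (1 - u) *\<^sub>R Q i + u *\<^sub>R Q j"
          by (auto simp: closed_segment_def)
        have pq: "p k = (1 - u) *\<^sub>R p i + u *\<^sub>R p j" "q k = (1 - u) *\<^sub>R q i + u *\<^sub>R q j"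
          using u(3) by (auto simp: Q_def)
        have "P \<theta> k = P \<theta> i - u *\<^sub>R e"
          by (simp add: e_def P_def pq algebra_simps)
        then have "P \<theta> k \<bullet> z = P \<theta> i \<bullet> z - u * (z \<bullet> e)" by (simp add: inner_diff_left inner_commute[of z e])
        moreover have "\<bar>u * (z \<bullet> e)\<bar> \<le> 1 * (1 / \<beta>)"
          unfolding abs_mult using zS u by (intro mult_mono) (auto simp: S_def)
        ultimately show ?thesis by linarith
      next
        assume ka: "a \<bullet> Q k \<le> a \<bullet> Q i - \<eta>"
        have "(P \<theta> k - P \<theta> i) \<bullet> (z - w) \<le> norm (P \<theta> k - P \<theta> i) * norm (z - w)" by (rule norm_cauchy_schwarz)
        also have "\<dots> \<le> (2 * D) * (2 * \<delta>)"
          using norm_triangle_ineq4[of "P \<theta> k" "P \<theta> i"] normP[of \<theta> k] normP[of \<theta> i] D(2)[OF k] D(2)[OF ij(1)] zw D(1)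
          by (intro mult_mono) auto
        also have "\<dots> \<le> \<eta>" using \<delta>(3) by (simp add: mult_ac)
        finally have "(P \<theta> k - P \<theta> i) \<bullet> (z - w) \<le> \<eta>" .
        moreover have "(P \<theta> k - P \<theta> i) \<bullet> w = a \<bullet> Q k - a \<bullet> Q i"
          using wP by (simp add: inner_diff_right inner_commute[of _ w])
        ultimately have "P \<theta> k \<bullet> z \<le> P \<theta> i \<bullet> z"
          using ka by (simp add: inner_diff_left inner_diff_right)
        moreover have "1 / \<beta> \<ge> 0" using \<beta> by simp
        ultimately show ?thesis by linarith
      qed
      have zij: "\<bar>z \<bullet> (P \<theta> i - P \<theta> j)\<bar> \<le> 1 / \<beta>" using zS by (simp add: S_def e_def)
      have \<beta>0: "\<beta> > 0" using \<beta> by simp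
      note sm = softmax_edge_ge[OF N ij(1,2) \<beta>0 zij others]
      let ?t = "\<lambda>i j. softmax N \<beta> (P \<theta>) i z * softmax N \<beta> (P \<theta>) j z * ((P \<theta> i - P \<theta> j) \<bullet> (P' \<theta> i - P' \<theta> j))"
      have "1 / (N * exp 2) * (1 / (N * exp 2)) * (1 / 2 * (1 / 2) * \<Delta>) \<le> ?t i j"
        unfolding PP' \<Delta>_def[symmetric]
        by (intro mult_mono sm co si mult_nonneg_nonneg) (use \<Delta> co si softmax_nonneg[OF N] in auto)
      also have "\<dots> \<le> (\<Sum>j<N. ?t i j)"
        using ij term_nonneg[OF th] by (intro member_le_sum) auto
      also have "\<dots> \<le> (\<Sum>i<N. \<Sum>j<N. ?t i j)"
        using ij term_nonneg[OF th] by (intro member_le_sum[of i "{..<N}" "\<lambda>i. \<Sum>j<N. ?t i j"] sum_nonneg) auto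
      finally have sum_ge: "1 / (N * exp 2) * (1 / (N * exp 2)) * (1 / 2 * (1 / 2) * \<Delta>) \<le> (\<Sum>i<N. \<Sum>j<N. ?t i j)" .
      have "K * \<beta> = 1 / 8 * (\<beta> / 2 * (1 / (N * exp 2) * (1 / (N * exp 2)) * (1 / 2 * (1 / 2) * \<Delta>)))"
        by (simp add: K_def power2_eq_square mult_ac)
      also have "\<dots> \<le> F \<beta> \<theta> z"
        unfolding F_def using \<beta> \<Delta> by (intro mult_mono b sum_ge mult_nonneg_nonneg) auto
      finally show ?thesis .
    qed
    have Sbox: "S \<subseteq> wbox" using Sn cball_subset_wbox by force
    have "C0 \<le> K * (\<beta> * measure lebesgue S)"
    proof -
      have "measure lebesgue (ball w \<delta>) = measure lebesgue (ball (0::'a \<times> 'a) \<delta>)"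
        using measure_translation[of w "ball 0 \<delta>"] by (simp add: image_add_ball)
      then show ?thesis
        unfolding C0_def S_def
        using measure_central_slab_ge[OF e0 eD we \<delta>(1) \<beta>] \<Delta> by (intro mult_left_mono) (auto simp: K_def)
    qed
    also have "\<dots> = integral wbox (\<lambda>z. if z \<in> S then K * \<beta> else 0)"
    proof -
      have "integral wbox (\<lambda>z. if z \<in> S then K * \<beta> else 0) = integral (S \<inter> wbox) (\<lambda>z. K * \<beta>)"
        by (rule integral_restrict_Int)
      also have "S \<inter> wbox = S" using Sbox by blast
      also have "integral S (\<lambda>z. K * \<beta>) = K * \<beta> * integral S (\<lambda>z. 1)"
        using integral_mult_right[of S "K * \<beta>" "\<lambda>_. 1"] by simp
      finally show ?thesis using Sm by (simp add: lmeasure_integral)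
    qed
    also have "\<dots> \<le> integral wbox (F \<beta> \<theta>)"
    proof (rule integral_le)
      have "(\<lambda>z. K * \<beta>) integrable_on S" using Sm by (rule integrable_on_const)
      then have "(\<lambda>z. K * \<beta>) integrable_on (S \<inter> wbox)" using Sbox by (simp add: Int_absorb2)
      then show "(\<lambda>z. if z \<in> S then K * \<beta> else 0) integrable_on wbox"
        by (simp add: integrable_restrict_Int)
      show "(if z \<in> S then K * \<beta> else 0) \<le> F \<beta> \<theta> z" for z
        using FS Fnonneg[OF \<beta> th] by simp
    qed (rule Fint)
    finally show ?thesis .
  qed
  show thesis
  proof
    \<comment> \<open>The rate \<open>C0\<close> times the length of the middle third of the quarter
      turn.\<close>
    show "C0 * (pi / 6) > 0" using C0 by simp
    fix \<beta> :: real assume \<beta>: "\<beta> \<ge> 1"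
    let ?\<Phi> = "\<lambda>\<theta>. smooth_width N \<beta> (P \<theta>)"
    have mono: "?\<Phi> s \<le> ?\<Phi> t" if "0 \<le> s" "s \<le> t" "t \<le> pi / 2" for s t
    proof (rule DERIV_nonneg_imp_nondecreasing[OF that(2)])
      fix x assume "s \<le> x" "x \<le> t"
      then show "\<exists>y. (?\<Phi> has_real_derivative y) (at x) \<and> y \<ge> 0"
        using that by (intro exI[of _ "integral wbox (F \<beta> x)"] conjI DF \<beta> integral_nonneg Fint Fnonneg) auto
    qed
    have "?\<Phi> (pi / 6) - C0 * (pi / 6) \<le> ?\<Phi> (pi / 3) - C0 * (pi / 3)"
    proof (rule DERIV_nonneg_imp_nondecreasing[where f = "\<lambda>\<theta>. ?\<Phi> \<theta> - C0 * \<theta>"])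
      fix x assume x: "pi / 6 \<le> x" "x \<le> pi / 3"
      have "((\<lambda>\<theta>. ?\<Phi> \<theta> - C0 * \<theta>) has_real_derivative integral wbox (F \<beta> x) - C0) (at x)"
        by (rule DERIV_diff[OF DF[OF \<beta>]]) (auto intro!: derivative_eq_intros)
      then show "\<exists>y. ((\<lambda>\<theta>. ?\<Phi> \<theta> - C0 * \<theta>) has_real_derivative y) (at x) \<and> y \<ge> 0"
        using lower[OF \<beta> x] by (intro exI[of _ "integral wbox (F \<beta> x) - C0"]) auto
    qed simp
    moreover have "?\<Phi> 0 \<le> ?\<Phi> (pi / 6)" "?\<Phi> (pi / 3) \<le> ?\<Phi> (pi / 2)" by (intro mono; simp)+
    ultimately have "?\<Phi> 0 + C0 * (pi / 6) \<le> ?\<Phi> (pi / 2)" by linarith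
    moreover have "P 0 = (\<lambda>i. (p i, 0))" "P (pi / 2) = (\<lambda>i. (0, q i))" by (auto simp: P_def fun_eq_iff)
    ultimately show "smooth_width N \<beta> (\<lambda>i. (p i, 0::'a)) + C0 * (pi / 6) \<le> smooth_width N \<beta> (\<lambda>i. (0::'a, q i))" by simp
  qed
qed

lemma support_max_integral_strict:
  fixes p q :: "nat \<Rightarrow> 'a::euclidean_space"
  assumes N: "N > 0" and le: "\<And>i j. i < N \<Longrightarrow> j < N \<Longrightarrow> dist (p i) (p j) \<le> dist (q i) (q j)"
    and strict: "i0 < N" "j0 < N" "dist (p i0) (p j0) < dist (q i0) (q j0)"
  shows "integral wbox (\<lambda>z::'a \<times> 'a. bump z * support_max N p (fst z)) <
         integral wbox (\<lambda>z::'a \<times> 'a. bump z * support_max N q (snd z))"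
proof -
  obtain C where C: "C > 0" "\<And>\<beta>. \<beta> \<ge> 1 \<Longrightarrow>
    smooth_width N \<beta> (\<lambda>i. (p i, 0::'a)) + C \<le> smooth_width N \<beta> (\<lambda>i. (0::'a, q i))"
    using smooth_width_rotation_gap[OF N le strict] by blast
  define I where "I = integral wbox (bump :: 'a \<times> 'a \<Rightarrow> real)"
  have I0: "I \<ge> 0" unfolding I_def by (intro integral_nonneg integrable_on_wbox continuous_intros bump_nonneg)
  \<comment> \<open>The gap \<open>C\<close> is the same for all \<open>\<beta>\<close>, while
    replacing the maximum by the softmax costs at most \<open>ln N / \<beta>\<close> times the total
    weight \<open>I\<close>. This choice makes the cost smaller than the gap.\<close>
  define \<beta> where "\<beta> = 1 + 2 * (ln N * I / C)"
  have lnN: "ln N \<ge> 0" using N by simp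
  then have \<beta>: "\<beta> \<ge> 1" "\<beta> > 0" using C I0 by (auto simp: \<beta>_def add_pos_nonneg)
  have "ln N * I < \<beta> * C"
  proof -
    have "\<beta> * C = C + 2 * (ln N * I)" using C(1) by (simp add: \<beta>_def distrib_right)
    then show ?thesis using C(1) mult_nonneg_nonneg[OF lnN I0] by linarith
  qed
  then have small: "ln N / \<beta> * I < C" using \<beta> by (simp add: field_simps)
  have sm: "support_max N (\<lambda>i. (p i, 0::'a)) = (\<lambda>z. support_max N p (fst z))"
    "support_max N (\<lambda>i. (0::'a, q i)) = (\<lambda>z. support_max N q (snd z))"
    by (auto simp: support_max_def fun_eq_iff)
  have ci: "(\<lambda>z. bump z * support_max N P z) integrable_on wbox" for P :: "nat \<Rightarrow> 'a \<times> 'a"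
    by (intro integrable_on_wbox continuous_intros continuous_on_support_max N)
  have Z0: "partition_fun N \<beta> P z \<noteq> 0" for P :: "nat \<Rightarrow> 'a \<times> 'a" and z
    using partition_fun_pos[OF N, of \<beta> P z] by linarith
  have cs: "(\<lambda>z. bump z * (ln (partition_fun N \<beta> P z) / \<beta>)) integrable_on wbox" for P :: "nat \<Rightarrow> 'a \<times> 'a"
    using \<beta> by (intro integrable_on_wbox continuous_intros ballI Z0) auto
  have "integral wbox (\<lambda>z. bump z * support_max N (\<lambda>i. (p i, 0::'a)) z) \<le> smooth_width N \<beta> (\<lambda>i. (p i, 0::'a))"
    unfolding smooth_width_def
    by (intro integral_le ci cs mult_left_mono support_max_le_lse N \<beta> bump_nonneg)
  also have "\<dots> \<le> smooth_width N \<beta> (\<lambda>i. (0::'a, q i)) - C" using C(2)[OF \<beta>(1)] by simp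
  also have "smooth_width N \<beta> (\<lambda>i. (0::'a, q i)) \<le>
     integral wbox (\<lambda>z::'a \<times> 'a. bump z * support_max N (\<lambda>i. (0::'a, q i)) z + ln N / \<beta> * bump z)"
    unfolding smooth_width_def
  proof (intro integral_le cs integrable_add ci)
    show "(\<lambda>z::'a \<times> 'a. ln N / \<beta> * bump z) integrable_on wbox"
      using \<beta> by (intro integrable_on_wbox continuous_intros) auto
    fix z :: "'a \<times> 'a"
    have "bump z * (ln (partition_fun N \<beta> (\<lambda>i. (0::'a, q i)) z) / \<beta>) \<le> bump z * (support_max N (\<lambda>i. (0::'a, q i)) z + ln N / \<beta>)"
      by (intro mult_left_mono support_max_le_lse N \<beta> bump_nonneg)
    then show "bump z * (ln (partition_fun N \<beta> (\<lambda>i. (0::'a, q i)) z) / \<beta>) \<le> bump z * support_max N (\<lambda>i. (0::'a, q i)) z + ln N / \<beta> * bump z"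
      by (simp add: algebra_simps)
  qed
  also have "\<dots> = integral wbox (\<lambda>z::'a \<times> 'a. bump z * support_max N (\<lambda>i. (0::'a, q i)) z) + ln N / \<beta> * I"
    unfolding I_def
    using \<beta> by (subst integral_add) (auto intro!: ci integrable_on_wbox continuous_intros)
  finally show ?thesis using small unfolding sm by linarith
qed

section \<open>Volume asymptotics\<close>

lemma power_one_plus_expansion: "\<exists>C\<ge>0. \<forall>x::real. \<bar>x\<bar> \<le> 1 \<longrightarrow> \<bar>(1 + x) ^ n - 1 - n * x\<bar> \<le> C * x\<^sup>2"
proof (induction n)
  case (Suc n)
  then obtain C where C: "C \<ge> 0" "\<And>x::real. \<bar>x\<bar> \<le> 1 \<Longrightarrow> \<bar>(1 + x) ^ n - 1 - n * x\<bar> \<le> C * x\<^sup>2" by blast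
  have "\<bar>(1 + x) ^ Suc n - 1 - Suc n * x\<bar> \<le> (2 * C + n) * x\<^sup>2" if x: "\<bar>x\<bar> \<le> 1" for x :: real
  proof -
    have "(1 + x) ^ Suc n - 1 - Suc n * x = (1 + x) * ((1 + x) ^ n - 1 - n * x) + n * x\<^sup>2"
      by (simp add: algebra_simps power2_eq_square)
    also have "\<bar>\<dots>\<bar> \<le> \<bar>1 + x\<bar> * \<bar>(1 + x) ^ n - 1 - n * x\<bar> + n * x\<^sup>2"
      by (rule order_trans[OF abs_triangle_ineq]) (simp add: abs_mult)
    also have "\<dots> \<le> 2 * (C * x\<^sup>2) + n * x\<^sup>2"
      using x C(2)[OF x] by (intro add_right_mono mult_mono) auto
    finally show ?thesis by (simp add: algebra_simps)
  qed
  then show ?case using C(1) by (intro exI[of _ "2 * C + n"]) auto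
qed (auto intro: exI[of _ 0])

text \<open>After division by \<open>r ^ DIM('a)\<close> the volume is the integral of the power of
  \<open>1 + e u\<close>, which is expanded to first order.\<close>

lemma measure_star_body_bound:
  fixes e :: "'a::euclidean_space \<Rightarrow> real"
  assumes [measurable]: "e \<in> borel_measurable borel" and e: "\<And>u. norm u = 1 \<Longrightarrow> \<bar>e u\<bar> \<le> E" and E: "0 \<le> E" "E \<le> 1"
    and r: "r > 0" and C: "C \<ge> 0" "\<And>x::real. \<bar>x\<bar> \<le> 1 \<Longrightarrow> \<bar>(1 + x) ^ DIM('a) - 1 - DIM('a) * x\<bar> \<le> C * x\<^sup>2"
  shows "\<bar>measure lborel {x. norm x \<le> r * (1 + e (sgn x))} / r ^ DIM('a) - unit_ball_vol TYPE('a) - DIM('a) * (\<integral>u. e u \<partial>cone_measure)\<bar>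
     \<le> C * unit_ball_vol TYPE('a) * E\<^sup>2"
proof -
  interpret CM: finite_measure "cone_measure :: 'a measure" by (rule finite_measure_cone_measure)
  let ?n = "DIM('a)"
  have tot: "measure (cone_measure :: 'a measure) UNIV = unit_ball_vol TYPE('a)"
    using emeasure_cone_UNIV[where 'a = 'a] by (simp add: measure_def)
  have AEe: "AE u in cone_measure. \<bar>e u\<bar> \<le> E" by (rule AE_mp[OF AE_cone_sphere]) (use e in auto)
  have ie: "integrable cone_measure e"
    by (rule CM.integrable_const_bound[where B = E]) (use AEe in auto)
  have ip: "integrable cone_measure (\<lambda>u. (1 + e u) ^ ?n)"
  proof (rule CM.integrable_const_bound[where B = "2 ^ ?n"])
    show "AE u in cone_measure. norm ((1 + e u) ^ ?n) \<le> 2 ^ ?n"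
      using AEe
    proof eventually_elim
      case (elim u)
      then have "\<bar>1 + e u\<bar> \<le> 2" using E by linarith
      then show ?case by (simp add: power_abs power_mono)
    qed
  qed simp
  have AEnn: "AE u in cone_measure. 0 \<le> r ^ ?n * (1 + e u) ^ ?n"
    using AEe by eventually_elim (use E r in auto)
  have "emeasure lborel {x. norm x \<le> r * (1 + e (sgn x))} = (\<integral>\<^sup>+u. ennreal ((r * (1 + e u)) ^ ?n) \<partial>cone_measure)"
  proof (rule emeasure_star_body)
    fix u :: 'a assume "norm u = 1"
    then show "0 \<le> r * (1 + e u)" using e[of u] E r by auto
  qed simp
  also have "\<dots> = (\<integral>\<^sup>+u. ennreal (r ^ ?n * (1 + e u) ^ ?n) \<partial>cone_measure)" by (simp add: power_mult_distrib)
  also have "\<dots> = ennreal (\<integral>u. r ^ ?n * (1 + e u) ^ ?n \<partial>cone_measure)"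
    using ip AEnn by (intro nn_integral_eq_integral) auto
  finally have "measure lborel {x. norm x \<le> r * (1 + e (sgn x))} = (\<integral>u. r ^ ?n * (1 + e u) ^ ?n \<partial>cone_measure)"
    using AEnn by (intro measure_eq_emeasure_eq_ennreal integral_nonneg_AE) auto
  then have eq: "measure lborel {x. norm x \<le> r * (1 + e (sgn x))} / r ^ ?n = (\<integral>u. (1 + e u) ^ ?n \<partial>cone_measure)"
    using r by simp
  have "(\<integral>u. (1 + e u) ^ ?n \<partial>cone_measure) - unit_ball_vol TYPE('a) - ?n * (\<integral>u. e u \<partial>cone_measure) =
    (\<integral>u. (1 + e u) ^ ?n - 1 - ?n * e u \<partial>cone_measure)"
    using ie ip by (simp add: tot)
  also have "\<bar>\<dots>\<bar> \<le> (\<integral>u. \<bar>(1 + e u) ^ ?n - 1 - ?n * e u\<bar> \<partial>cone_measure)" by (rule integral_abs_bound)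
  also have "\<dots> \<le> (\<integral>u. C * E\<^sup>2 \<partial>(cone_measure :: 'a measure))"
  proof (rule integral_mono_AE)
    show "AE u in cone_measure. \<bar>(1 + e u) ^ ?n - 1 - ?n * e u\<bar> \<le> C * E\<^sup>2"
      using AEe
    proof eventually_elim
      case (elim u)
      have "(e u)\<^sup>2 \<le> E\<^sup>2" using elim E by (metis abs_le_square_iff abs_of_nonneg)
      then show ?case using C(2)[of "e u"] elim E C(1) by (smt (verit) mult_left_mono)
    qed
  qed (use ie ip in auto)
  finally show ?thesis unfolding eq by (simp add: tot mult_ac)
qed

text \<open>In direction \<open>u\<close> the ball about \<open>p\<close> reaches up to distance \<open>r + p \<bullet> u + O(1/r)\<close> from the origin;
  the next two lemmas are the two halves of this statement.\<close>
lemma norm_le_if_in_ball: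
  fixes x p :: "'a::real_inner"
  assumes "dist x p \<le> r" "r \<ge> 0"
  shows "norm x \<le> r + p \<bullet> sgn x"
proof -
  let ?u = "sgn x"
  have x: "x = norm x *\<^sub>R ?u" by (cases "x = 0") (simp_all add: sgn_div_norm)
  have pu: "(p \<bullet> ?u)\<^sup>2 \<le> (norm p)\<^sup>2"
    using Cauchy_Schwarz_ineq2[of p ?u] by (cases "x = 0") (auto simp: norm_sgn abs_le_square_iff[symmetric])
  have px: "x \<bullet> p = norm x * (p \<bullet> ?u)" by (subst x) (simp add: inner_commute)
  have "(dist x p)\<^sup>2 = (norm x)\<^sup>2 - 2 * (x \<bullet> p) + (norm p)\<^sup>2"
    by (simp add: dist_norm power2_norm_eq_inner inner_diff_left inner_diff_right inner_commute)
  then have "(norm x - p \<bullet> ?u)\<^sup>2 = (dist x p)\<^sup>2 - (norm p)\<^sup>2 + (p \<bullet> ?u)\<^sup>2"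
    unfolding px by (simp add: power2_eq_square algebra_simps)
  also have "\<dots> \<le> r\<^sup>2" using pu power_mono[OF assms(1) zero_le_dist, of 2] by linarith
  finally have "norm x - p \<bullet> ?u \<le> r" using assms(2) by (rule power2_le_imp_le)
  then show ?thesis by simp
qed

lemma in_ball_if_norm_le:
  fixes x p :: "'a::real_inner"
  assumes x: "norm x \<le> r + p \<bullet> sgn x - D\<^sup>2 / r" and D: "norm p \<le> D" "r \<ge> 2 * D" "r > 0"
  shows "dist x p \<le> r"
proof -
  let ?u = "sgn x"
  have D0: "D \<ge> 0" using D(1) norm_ge_zero[of p] by linarith
  have xu: "x = norm x *\<^sub>R ?u" by (cases "x = 0") (simp_all add: sgn_div_norm)
  have "\<bar>p \<bullet> ?u\<bar> \<le> norm p * norm ?u" by (rule Cauchy_Schwarz_ineq2)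
  also have "\<dots> \<le> D * 1" using D D0 by (intro mult_mono) (auto simp: norm_sgn)
  finally have pu: "\<bar>p \<bullet> ?u\<bar> \<le> D" by simp
  have px: "x \<bullet> p = norm x * (p \<bullet> ?u)" by (subst xu) (simp add: inner_commute)
  have D2: "D\<^sup>2 \<le> r\<^sup>2 / 4" using power_mono[of "2 * D" r 2] D D0 by (simp add: power_mult_distrib)
  have key: "(norm x - p \<bullet> ?u)\<^sup>2 \<le> r\<^sup>2 - D\<^sup>2"
  proof (cases "norm x - p \<bullet> ?u \<ge> 0")
    case True
    then have "(norm x - p \<bullet> ?u)\<^sup>2 \<le> (r - D\<^sup>2 / r)\<^sup>2" using x by (intro power_mono) auto
    also have "\<dots> = r\<^sup>2 - 2 * D\<^sup>2 + D\<^sup>2 * (D\<^sup>2 / r\<^sup>2)" using D(3) by (simp add: power2_eq_square field_simps)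
    also have "\<dots> \<le> r\<^sup>2 - 2 * D\<^sup>2 + D\<^sup>2 * 1"
    proof (intro add_left_mono mult_left_mono)
      have "D\<^sup>2 \<le> r\<^sup>2" using D2 zero_le_power2[of r] by linarith
      then show "D\<^sup>2 / r\<^sup>2 \<le> 1" using D(3) by (simp add: divide_le_eq)
    qed simp
    finally show ?thesis by simp
  next
    case False
    then have "\<bar>norm x - p \<bullet> ?u\<bar> \<le> \<bar>D\<bar>" using pu D0 norm_ge_zero[of x] by linarith
    then have "(norm x - p \<bullet> ?u)\<^sup>2 \<le> D\<^sup>2" by (simp only: abs_le_square_iff)
    then show ?thesis using D2 zero_le_power2[of r] by linarith
  qed
  have "(dist x p)\<^sup>2 = (norm x)\<^sup>2 - 2 * (x \<bullet> p) + (norm p)\<^sup>2"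
    by (simp add: dist_norm power2_norm_eq_inner inner_diff_left inner_diff_right inner_commute)
  then have "(dist x p)\<^sup>2 = (norm x - p \<bullet> ?u)\<^sup>2 + ((norm p)\<^sup>2 - (p \<bullet> ?u)\<^sup>2)"
    unfolding px by (simp add: power2_eq_square algebra_simps)
  also have "\<dots> \<le> (r\<^sup>2 - D\<^sup>2) + D\<^sup>2"
    using key power_mono[OF D(1) norm_ge_zero, of 2] zero_le_power2[of "p \<bullet> ?u"] by linarith
  finally have "(dist x p)\<^sup>2 \<le> r\<^sup>2" by simp
  then show ?thesis using D(3) by (intro power2_le_imp_le[of "dist x p" r]) auto
qed

text \<open>\<open>K r\<close> is squeezed between star bodies with radial functions
  \<open>r + h\<close> and \<open>r + h - D\<^sup>2 / r\<close>. Their discrepancy is of relative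
  order 1/r^2, so both have the same coefficient of 1/r.\<close>

lemma volume_expansion:
  fixes h :: "'a::euclidean_space \<Rightarrow> real" and K :: "real \<Rightarrow> 'a set"
  assumes [measurable]: "h \<in> borel_measurable borel" and h: "\<And>u. norm u = 1 \<Longrightarrow> \<bar>h u\<bar> \<le> D" and D: "D > 0"
    and K: "\<And>r. K r \<in> sets borel"
    and up: "\<And>r. r \<ge> 2 * D \<Longrightarrow> K r \<subseteq> {x. norm x \<le> r + h (sgn x)}"
    and lo: "\<And>r. r \<ge> 2 * D \<Longrightarrow> {x. norm x \<le> r + h (sgn x) - D\<^sup>2 / r} \<subseteq> K r"
  obtains C where "C \<ge> 0" "\<And>r. r \<ge> 2 * D \<Longrightarrow>
    \<bar>measure lborel (K r) / r ^ DIM('a) - unit_ball_vol TYPE('a) - DIM('a) * (\<integral>u. h u \<partial>cone_measure) / r\<bar> \<le> C / r\<^sup>2"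
proof -
  interpret CM: finite_measure "cone_measure :: 'a measure" by (rule finite_measure_cone_measure)
  let ?n = "DIM('a)" and ?\<omega> = "unit_ball_vol TYPE('a)"
  have \<omega>: "?\<omega> > 0" by (rule unit_ball_vol_pos)
  have tot: "measure (cone_measure :: 'a measure) UNIV = ?\<omega>"
    using emeasure_cone_UNIV[where 'a = 'a] by (simp add: measure_def)
  define I where "I = (\<integral>u. h u \<partial>cone_measure)"
  have ih: "integrable cone_measure h"
  proof (rule CM.integrable_const_bound[where B = D])
    show "AE u in cone_measure. norm (h u) \<le> D" by (rule AE_mp[OF AE_cone_sphere]) (use h in auto)
  qed simp
  obtain C0 where C0: "C0 \<ge> 0" "\<And>x::real. \<bar>x\<bar> \<le> 1 \<Longrightarrow> \<bar>(1 + x) ^ ?n - 1 - ?n * x\<bar> \<le> C0 * x\<^sup>2"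
    using power_one_plus_expansion[of ?n] by blast
  \<comment> \<open>The first summand bounds the shift of the mean of \<open>e2\<close> caused by
    \<open>D\<^sup>2 / r\<close>; the second is the quadratic remainder, with a 4 because
    \<open>e2\<close> is bounded by \<open>2 * (D / r)\<close>.\<close>
  define C where "C = ?n * ?\<omega> * D\<^sup>2 + 4 * C0 * ?\<omega> * D\<^sup>2"
  show thesis
  proof
    show "C \<ge> 0" using C0 \<omega> by (simp add: C_def)
    fix r assume r: "r \<ge> 2 * D"
    then have r0: "r > 0" using D by linarith
    define e1 where "e1 u = h u / r" for u
    define e2 where "e2 u = h u / r - D\<^sup>2 / r\<^sup>2" for u
    let ?S = "\<lambda>e. {x::'a. norm x \<le> r * (1 + e (sgn x))}"
    have e1r: "r * (1 + e1 u) = r + h u" and e2r: "r * (1 + e2 u) = r + h u - D\<^sup>2 / r" for u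
      using r0 by (auto simp: e1_def e2_def field_simps power2_eq_square)
    have Dr: "D / r \<le> 1 / 2" using r r0 by (simp add: field_simps)
    have m1: "e1 \<in> borel_measurable borel" "e2 \<in> borel_measurable borel"
      unfolding e1_def e2_def by measurable
    have he: "\<bar>h u / r\<bar> \<le> D / r" if "norm u = 1" for u
      using h[OF that] r0 by (simp add: divide_right_mono)
    have b1: "\<bar>e1 u\<bar> \<le> D / r" if "norm u = 1" for u using he[OF that] by (simp add: e1_def)
    have b2: "\<bar>e2 u\<bar> \<le> 2 * (D / r)" if "norm u = 1" for u
    proof -
      have "D\<^sup>2 / r\<^sup>2 = (D / r) * (D / r)" by (simp add: power2_eq_square)
      also have "\<dots> \<le> 1 * (D / r)" using Dr D r0 by (intro mult_right_mono) auto
      finally have "D\<^sup>2 / r\<^sup>2 \<le> D / r" by simp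
      moreover have "0 \<le> D\<^sup>2 / r\<^sup>2" by simp
      ultimately show ?thesis using he[OF that] unfolding e2_def by linarith
    qed
    have i1: "(\<integral>u. e1 u \<partial>cone_measure) = I / r" unfolding e1_def I_def by simp
    have i2: "(\<integral>u. e2 u \<partial>cone_measure) = I / r - ?\<omega> * (D\<^sup>2 / r\<^sup>2)"
      unfolding e2_def I_def using ih by (subst Bochner_Integration.integral_diff) (auto simp: tot mult_ac)
    have bd1: "\<bar>measure lborel (?S e1) / r ^ ?n - ?\<omega> - ?n * (I / r)\<bar> \<le> C0 * ?\<omega> * (D / r)\<^sup>2"
      using measure_star_body_bound[OF m1(1) b1 _ _ r0 C0] Dr D r0 unfolding i1 by simp
    have bd2: "\<bar>measure lborel (?S e2) / r ^ ?n - ?\<omega> - ?n * (I / r - ?\<omega> * (D\<^sup>2 / r\<^sup>2))\<bar> \<le> C0 * ?\<omega> * (2 * (D / r))\<^sup>2"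
      using measure_star_body_bound[OF m1(2) b2 _ _ r0 C0] Dr D r0 unfolding i2 by simp
    have S1: "?S e1 \<in> fmeasurable lborel"
    proof (rule fmeasurable_lborel_bounded)
      show "?S e1 \<in> sets borel" using m1 by measurable
      have "norm x \<le> r + D" if "x \<in> ?S e1" for x
      proof (cases "x = 0")
        case False
        then show ?thesis using that h[of "sgn x"] unfolding e1r by (simp add: norm_sgn)
      qed (use r0 D in simp)
      then show "bounded (?S e1)" by (auto intro: boundedI)
    qed
    have "measure lborel (K r) \<le> measure lborel (?S e1)"
      using up[OF r] K S1 by (intro measure_mono_fmeasurable) (auto simp: e1r)
    then have u: "measure lborel (K r) / r ^ ?n \<le> measure lborel (?S e1) / r ^ ?n" using r0 by (simp add: divide_right_mono)
    have "K r \<in> fmeasurable lborel"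
      using up[OF r] K by (intro fmeasurableI2[OF S1]) (auto simp: e1r)
    then have "measure lborel (?S e2) \<le> measure lborel (K r)"
      using lo[OF r] m1 by (intro measure_mono_fmeasurable) (auto simp: e2r)
    then have l: "measure lborel (?S e2) / r ^ ?n \<le> measure lborel (K r) / r ^ ?n" using r0 by (simp add: divide_right_mono)
    have c1: "C0 * ?\<omega> * (D / r)\<^sup>2 \<le> C / r\<^sup>2"
    proof -
      have "C0 * ?\<omega> * D\<^sup>2 \<le> C" using C0(1) \<omega> by (simp add: C_def)
      then have "C0 * ?\<omega> * D\<^sup>2 / r\<^sup>2 \<le> C / r\<^sup>2" by (rule divide_right_mono) simp
      then show ?thesis by (simp add: power_divide)
    qed
    have c2: "C0 * ?\<omega> * (2 * (D / r))\<^sup>2 + ?n * (?\<omega> * (D\<^sup>2 / r\<^sup>2)) = C / r\<^sup>2"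
      by (simp add: C_def power_mult_distrib power_divide add_divide_distrib mult_ac)
    show "\<bar>measure lborel (K r) / r ^ ?n - ?\<omega> - ?n * (\<integral>u. h u \<partial>cone_measure) / r\<bar> \<le> C / r\<^sup>2"
      using bd1 bd2 u l c1 c2 unfolding I_def[symmetric] times_divide_eq_right[symmetric] right_diff_distrib
      by (simp only: abs_le_iff) linarith
  qed
qed

text \<open>The leading term contributes exactly \<open>\<omega>\<close> to the quotient and the
  term in \<open>w\<close> gives the limit; a remainder of relative order 1/r^2 still vanishes after
  multiplication by \<open>r\<close>.\<close>

lemma difference_quotient_limit:
  fixes V :: "real \<Rightarrow> real"
  assumes n: "n > 0" and k: "k > 1" and R: "R > 0"
    and V: "\<And>r. r \<ge> R \<Longrightarrow> \<bar>V r / r ^ n - \<omega> - w / r\<bar> \<le> C / r\<^sup>2"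
  shows "((\<lambda>r. r * ((V (k * r) - V r) / ((k * r) ^ n - r ^ n) - \<omega>)) \<longlongrightarrow> w * ((k ^ (n - 1) - 1) / (k ^ n - 1))) at_top"
proof -
  have kn: "k ^ n > 1" using n k by (simp add: one_less_power)
  define E where "E r = V r / r ^ n - \<omega> - w / r" for r
  have V_eq: "V r = r ^ n * (\<omega> + w / r + E r)" if "r \<ge> R" for r using that R by (simp add: E_def)
  have rE: "((\<lambda>r. r * E r) \<longlongrightarrow> 0) at_top"
  proof (rule Lim_null_comparison)
    show "\<forall>\<^sub>F r in at_top. norm (r * E r) \<le> C / r"
      using eventually_ge_at_top[of R]
    proof eventually_elim
      case (elim r)
      have "\<bar>E r\<bar> \<le> C / r\<^sup>2" using V[OF elim] by (simp add: E_def)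
      then have "r * \<bar>E r\<bar> \<le> r * (C / r\<^sup>2)" using elim R by (intro mult_left_mono) auto
      then have "\<bar>r * E r\<bar> \<le> r * (C / r\<^sup>2)" using elim R by (simp add: abs_mult)
      then show ?case using elim R by (simp add: power2_eq_square)
    qed
    show "((\<lambda>r. C / r) \<longlongrightarrow> 0) at_top" by real_asymp
  qed
  have "filterlim (\<lambda>r::real. k * r) at_top at_top" using k by real_asymp
  then have "((\<lambda>r. (k * r) * E (k * r)) \<longlongrightarrow> 0) at_top" by (rule filterlim_compose[OF rE])
  then have "((\<lambda>r. w * ((k ^ (n - 1) - 1) / (k ^ n - 1)) + (k ^ n / k * ((k * r) * E (k * r)) - r * E r) / (k ^ n - 1))
     \<longlongrightarrow> w * ((k ^ (n - 1) - 1) / (k ^ n - 1)) + (k ^ n / k * 0 - 0) / (k ^ n - 1)) at_top"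
    using rE kn by (intro tendsto_intros) auto
  moreover have "\<forall>\<^sub>F r in at_top. w * ((k ^ (n - 1) - 1) / (k ^ n - 1)) + (k ^ n / k * ((k * r) * E (k * r)) - r * E r) / (k ^ n - 1) =
     r * ((V (k * r) - V r) / ((k * r) ^ n - r ^ n) - \<omega>)"
    using eventually_ge_at_top[of R]
  proof eventually_elim
    case (elim r)
    have r0: "r > 0" using elim R by simp
    have kr: "k * r \<ge> R" using elim k r0 by (smt (verit) mult_le_cancel_right1)
    have kn1: "k ^ n = k * k ^ (n - 1)" using n by (simp add: power_eq_if)
    have "V (k * r) - V r = r ^ n * (k ^ n * (\<omega> + w / (k * r) + E (k * r)) - (\<omega> + w / r + E r))"
      using V_eq[OF elim] V_eq[OF kr] by (simp add: power_mult_distrib algebra_simps)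
    moreover have "(k * r) ^ n - r ^ n = r ^ n * (k ^ n - 1)" by (simp add: power_mult_distrib algebra_simps)
    ultimately have Qe: "(V (k * r) - V r) / ((k * r) ^ n - r ^ n) = (k ^ n * (\<omega> + w / (k * r) + E (k * r)) - (\<omega> + w / r + E r)) / (k ^ n - 1)"
      using r0 by simp
    have alg: "r * ((K * (\<omega> + w / (k * r) + e2) - (\<omega> + w / r + e1)) / (K - 1) - \<omega>) =
       (K * (r * \<omega> + w / k + r * e2) - (r * \<omega> + w + r * e1) - r * \<omega> * (K - 1)) / (K - 1)"
      if "K > 1" for K e1 e2 :: real
      using r0 that k by (simp add: field_simps)
    have "r * ((V (k * r) - V r) / ((k * r) ^ n - r ^ n) - \<omega>) =
       (k ^ n * (r * \<omega> + w / k + r * E (k * r)) - (r * \<omega> + w + r * E r) - r * \<omega> * (k ^ n - 1)) / (k ^ n - 1)"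
      unfolding Qe by (rule alg[OF kn])
    also have "k ^ n * (r * \<omega> + w / k + r * E (k * r)) - (r * \<omega> + w + r * E r) - r * \<omega> * (k ^ n - 1) =
       w * (k ^ (n - 1) - 1) + (k ^ n / k * ((k * r) * E (k * r)) - r * E r)"
      using k by (simp add: kn1 field_simps)
    finally show ?case by (simp add: add_divide_distrib)
  qed
  ultimately show ?thesis by (simp add: tendsto_cong)
qed

text \<open>Divided by \<open>k - 1\<close>, numerator and denominator tend to derivatives of powers
  at 1.\<close>

lemma power_ratio_limit:
  assumes n: "n > 0"
  shows "((\<lambda>k::real. (k ^ (n - 1) - 1) / (k ^ n - 1)) \<longlongrightarrow> real (n - 1) / n) (at_right 1)"
proof -
  have d: "((\<lambda>k::real. (k ^ m - 1) / (k - 1)) \<longlongrightarrow> real m) (at_right 1)" for m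
  proof -
    have "((\<lambda>k::real. k ^ m) has_real_derivative real m) (at 1 within {1<..})"
      by (auto intro!: derivative_eq_intros)
    then show ?thesis by (simp add: has_field_derivative_iff)
  qed
  have "((\<lambda>k::real. ((k ^ (n - 1) - 1) / (k - 1)) / ((k ^ n - 1) / (k - 1))) \<longlongrightarrow> real (n - 1) / real n) (at_right 1)"
    using n by (intro tendsto_divide d) auto
  moreover have "\<forall>\<^sub>F k::real in at_right 1. ((k ^ (n - 1) - 1) / (k - 1)) / ((k ^ n - 1) / (k - 1)) = (k ^ (n - 1) - 1) / (k ^ n - 1)"
    using eventually_at_right_less[of 1] by eventually_elim simp
  ultimately show ?thesis by (rule Lim_transform_eventually)
qed

text \<open>A Tauberian step: the limit is recovered from the difference quotients by letting \<open>k\<close> tend to 1.\<close>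
lemma monotone_density_limit:
  fixes V G :: "real \<Rightarrow> real"
  defines "Q \<equiv> \<lambda>n k r. (V (k * r) - V r) / ((k * r) ^ n - r ^ n)"
  assumes n: "n > 0" and R: "R > 0"
    and V: "\<And>r. r \<ge> R \<Longrightarrow> \<bar>V r / r ^ n - \<omega> - w / r\<bar> \<le> C / r\<^sup>2"
    and G: "\<And>k r. k > 1 \<Longrightarrow> r > 0 \<Longrightarrow> (Q n k r \<le> G r \<and> G r \<le> Q n k (r / k)) \<or> (Q n k (r / k) \<le> G r \<and> G r \<le> Q n k r)"
  shows "((\<lambda>r. r * (G r - \<omega>)) \<longlongrightarrow> w * (real (n - 1) / n)) at_top"
proof (rule tendstoI)
  fix \<epsilon> :: real assume \<epsilon>: "\<epsilon> > 0"
  let ?L = "w * (real (n - 1) / n)"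
  let ?a = "\<lambda>k::real. (k ^ (n - 1) - 1) / (k ^ n - 1)"
  have "((\<lambda>k. w * ?a k) \<longlongrightarrow> ?L) (at_right 1)" by (intro tendsto_intros power_ratio_limit n)
  \<comment> \<open>The quotient based at \<open>r / k\<close> has the same limit in the variable
    \<open>r / k\<close>; rewritten in \<open>r\<close> it acquires a factor \<open>k\<close>, which
    tends to 1.\<close>
  moreover have "((\<lambda>k. k * (w * ?a k)) \<longlongrightarrow> 1 * ?L) (at_right 1)" by (intro tendsto_intros power_ratio_limit n)
  then have "((\<lambda>k. k * (w * ?a k)) \<longlongrightarrow> ?L) (at_right 1)" by (simp only: mult_1)
  ultimately have "\<forall>\<^sub>F k in at_right 1. dist (w * ?a k) ?L < \<epsilon> / 2" "\<forall>\<^sub>F k in at_right 1. dist (k * (w * ?a k)) ?L < \<epsilon> / 2"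
    using tendstoD[of _ _ "at_right 1" "\<epsilon> / 2"] half_gt_zero[OF \<epsilon>] by blast+
  then have "\<forall>\<^sub>F k in at_right 1. dist (w * ?a k) ?L < \<epsilon> / 2 \<and> dist (k * (w * ?a k)) ?L < \<epsilon> / 2 \<and> k > 1"
    by (intro eventually_conj eventually_at_right_less)
  then obtain k where k: "dist (w * ?a k) ?L < \<epsilon> / 2" "dist (k * (w * ?a k)) ?L < \<epsilon> / 2" "k > 1"
    using eventually_happens[of _ "at_right (1::real)"] trivial_limit_at_right_real[of "1::real"] by blast
  have lim1: "((\<lambda>r. r * (Q n k r - \<omega>)) \<longlongrightarrow> w * ?a k) at_top"
    unfolding Q_def by (rule difference_quotient_limit[OF n k(3) R V])
  have "filterlim (\<lambda>r::real. r / k) at_top at_top" using k(3) by real_asymp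
  then have "((\<lambda>r. (r / k) * (Q n k (r / k) - \<omega>)) \<longlongrightarrow> w * ?a k) at_top" by (rule filterlim_compose[OF lim1])
  then have "((\<lambda>r. k * ((r / k) * (Q n k (r / k) - \<omega>))) \<longlongrightarrow> k * (w * ?a k)) at_top" by (rule tendsto_mult_left)
  then have lim2: "((\<lambda>r. r * (Q n k (r / k) - \<omega>)) \<longlongrightarrow> k * (w * ?a k)) at_top" using k(3) by simp
  have "\<forall>\<^sub>F r in at_top. dist (r * (Q n k r - \<omega>)) (w * ?a k) < \<epsilon> / 2"
    "\<forall>\<^sub>F r in at_top. dist (r * (Q n k (r / k) - \<omega>)) (k * (w * ?a k)) < \<epsilon> / 2"
    by (rule tendstoD[OF lim1 half_gt_zero[OF \<epsilon>]], rule tendstoD[OF lim2 half_gt_zero[OF \<epsilon>]])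
  then show "\<forall>\<^sub>F r in at_top. dist (r * (G r - \<omega>)) ?L < \<epsilon>"
    using eventually_gt_at_top[of 0]
  proof eventually_elim
    case (elim r)
    have "dist (r * (Q n k r - \<omega>)) ?L < \<epsilon>" "dist (r * (Q n k (r / k) - \<omega>)) ?L < \<epsilon>"
      using elim(1,2) k(1,2) dist_triangle[of _ ?L] by (smt (verit) field_sum_of_halves)+
    moreover have "(r * (Q n k r - \<omega>) \<le> r * (G r - \<omega>) \<and> r * (G r - \<omega>) \<le> r * (Q n k (r / k) - \<omega>)) \<or>
       (r * (Q n k (r / k) - \<omega>) \<le> r * (G r - \<omega>) \<and> r * (G r - \<omega>) \<le> r * (Q n k r - \<omega>))"
      using G[OF k(3) elim(3)] elim(3) by (simp add: mult_left_mono)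
    ultimately show ?case unfolding dist_real_def by linarith
  qed
qed

section \<open>Strict monotonicity of the mean width\<close>

lemma measurable_support_max [measurable]:
  "N > 0 \<Longrightarrow> support_max N p \<in> borel_measurable (borel :: 'a::euclidean_space measure)"
  by (intro borel_measurable_continuous_onI continuous_on_support_max)

lemma support_max_scaleR:
  assumes "N > 0" "t \<ge> 0" shows "support_max N p (t *\<^sub>R x) = t * support_max N p x"
proof (rule antisym)
  obtain i where i: "i < N" "support_max N p (t *\<^sub>R x) = p i \<bullet> (t *\<^sub>R x)" using support_max_attained[OF assms(1)] by blast
  show "support_max N p (t *\<^sub>R x) \<le> t * support_max N p x"
    unfolding i(2) using support_max_ge[OF i(1), of p x] assms(2) by (simp add: mult_left_mono)
  obtain j where j: "j < N" "support_max N p x = p j \<bullet> x" using support_max_attained[OF assms(1)] by blast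
  show "t * support_max N p x \<le> support_max N p (t *\<^sub>R x)"
    unfolding j(2) using support_max_ge[OF j(1), of p "t *\<^sub>R x"] by simp
qed

lemma abs_support_max_le:
  assumes "N > 0" "\<And>i. i < N \<Longrightarrow> norm (p i) \<le> D" shows "\<bar>support_max N p x\<bar> \<le> D * norm x"
proof -
  obtain i where i: "i < N" "support_max N p x = p i \<bullet> x" using support_max_attained[OF assms(1)] by blast
  have "\<bar>p i \<bullet> x\<bar> \<le> norm (p i) * norm x" by (rule Cauchy_Schwarz_ineq2)
  also have "\<dots> \<le> D * norm x" using assms(2)[OF i(1)] by (simp add: mult_right_mono)
  finally show ?thesis using i by simp
qed

section \<open>Return from the doubled space to mean widths\<close>

text \<open>What is left of the weight once the direction in one block is integrated out. The extra
  factor \<open>t\<close> is the radial part of a function homogeneous of degree 1, such as a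
  support function.\<close>

definition bump_moment :: "'a::euclidean_space itself \<Rightarrow> ennreal" where
  "bump_moment T = (\<integral>\<^sup>+y. \<integral>\<^sup>+t. ennreal (max 0 (1 - t\<^sup>2 - (norm (y::'a))\<^sup>2) * t) \<partial>radial_measure TYPE('a) \<partial>lborel)"

lemma polar_bump_inner:
  fixes y :: "'a::euclidean_space" and f :: "'a \<Rightarrow> ennreal"
  assumes [measurable]: "f \<in> borel_measurable borel"
  shows "ennreal (unit_ball_vol TYPE('a)) * (\<integral>\<^sup>+x. ennreal (max 0 (1 - (norm x)\<^sup>2 - (norm y)\<^sup>2) * norm x) * f (sgn x) \<partial>lborel) =
    (\<integral>\<^sup>+u. f u \<partial>cone_measure) * (\<integral>\<^sup>+t. ennreal (max 0 (1 - t\<^sup>2 - (norm y)\<^sup>2) * t) \<partial>radial_measure TYPE('a))"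
proof -
  let ?k = "\<lambda>t. ennreal (max 0 (1 - t\<^sup>2 - (norm y)\<^sup>2) * t)"
  have "ennreal (unit_ball_vol TYPE('a)) * (\<integral>\<^sup>+x. ?k (norm x) * f (sgn x) \<partial>lborel) =
    (\<integral>\<^sup>+u. \<integral>\<^sup>+t. ?k t * f u \<partial>radial_measure TYPE('a) \<partial>cone_measure)"
    using polar_nn_integral[of "\<lambda>(u, t). ?k t * f u"] by simp
  also have "\<dots> = (\<integral>\<^sup>+u. f u * (\<integral>\<^sup>+t. ?k t \<partial>radial_measure TYPE('a)) \<partial>cone_measure)"
    by (intro nn_integral_cong, subst nn_integral_multc) (auto simp: mult.commute)
  also have "\<dots> = (\<integral>\<^sup>+u. f u \<partial>cone_measure) * (\<integral>\<^sup>+t. ?k t \<partial>radial_measure TYPE('a))"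
    by (rule nn_integral_multc) measurable
  finally show ?thesis .
qed

text \<open>Polar coordinates in one block, Fubini in the other. As \<open>bump\<close> is symmetric
  in the two blocks, both yield the same factor.\<close>

lemma polar_bump:
  fixes f :: "'a::euclidean_space \<Rightarrow> ennreal"
  assumes [measurable]: "f \<in> borel_measurable borel"
  shows "ennreal (unit_ball_vol TYPE('a)) * (\<integral>\<^sup>+z. ennreal (bump z * norm (fst (z::'a \<times> 'a))) * f (sgn (fst z)) \<partial>lborel) =
      (\<integral>\<^sup>+u. f u \<partial>cone_measure) * bump_moment TYPE('a)"
    and "ennreal (unit_ball_vol TYPE('a)) * (\<integral>\<^sup>+z. ennreal (bump z * norm (snd (z::'a \<times> 'a))) * f (sgn (snd z)) \<partial>lborel) =
      (\<integral>\<^sup>+u. f u \<partial>cone_measure) * bump_moment TYPE('a)"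
proof -
  let ?\<omega> = "ennreal (unit_ball_vol TYPE('a))"
  have bump: "bump (x, y) = max 0 (1 - (norm x)\<^sup>2 - (norm y)\<^sup>2)" for x y :: 'a
    by (simp add: bump_def power2_norm_eq_inner diff_diff_eq)
  let ?g = "\<lambda>x (y::'a). ennreal (max 0 (1 - (norm x)\<^sup>2 - (norm y)\<^sup>2) * norm x) * f (sgn x)"
  have m: "(\<lambda>z. ?g (fst z) (snd z)) \<in> borel_measurable (lborel \<Otimes>\<^sub>M lborel)"
    "(\<lambda>z. ?g (snd z) (fst z)) \<in> borel_measurable (lborel \<Otimes>\<^sub>M lborel)" by measurable
  have tot: "?\<omega> * (\<integral>\<^sup>+y. \<integral>\<^sup>+x. ?g x y \<partial>lborel \<partial>lborel) = (\<integral>\<^sup>+u. f u \<partial>cone_measure) * bump_moment TYPE('a)"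
  proof -
    have "?\<omega> * (\<integral>\<^sup>+y. \<integral>\<^sup>+x. ?g x y \<partial>lborel \<partial>lborel) = (\<integral>\<^sup>+y. ?\<omega> * (\<integral>\<^sup>+x. ?g x y \<partial>lborel) \<partial>lborel)"
      by (rule nn_integral_cmult[symmetric]) measurable
    also have "\<dots> = (\<integral>\<^sup>+y. (\<integral>\<^sup>+u. f u \<partial>cone_measure) * (\<integral>\<^sup>+t. ennreal (max 0 (1 - t\<^sup>2 - (norm (y::'a))\<^sup>2) * t) \<partial>radial_measure TYPE('a)) \<partial>lborel)"
      by (intro nn_integral_cong polar_bump_inner) simp
    also have "\<dots> = (\<integral>\<^sup>+u. f u \<partial>cone_measure) * bump_moment TYPE('a)"
      unfolding bump_moment_def
    proof (rule nn_integral_cmult)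
      interpret R: sigma_finite_measure "radial_measure TYPE('a)" by (rule sigma_finite_radial)
      show "(\<lambda>y::'a. \<integral>\<^sup>+t. ennreal (max 0 (1 - t\<^sup>2 - (norm y)\<^sup>2) * t) \<partial>radial_measure TYPE('a)) \<in> borel_measurable lborel"
        by measurable
    qed
    finally show ?thesis .
  qed
  have "(\<integral>\<^sup>+z. ennreal (bump z * norm (fst (z::'a \<times> 'a))) * f (sgn (fst z)) \<partial>lborel) = (\<integral>\<^sup>+z. ?g (fst z) (snd z) \<partial>(lborel \<Otimes>\<^sub>M lborel))"
    unfolding lborel_prod by (intro nn_integral_cong) (metis bump prod.collapse)
  also have "\<dots> = (\<integral>\<^sup>+y. \<integral>\<^sup>+x. ?g x y \<partial>lborel \<partial>lborel)"
    using lborel_pair.nn_integral_snd[OF m(1)[unfolded case_prod_beta[symmetric]]] by simp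
  finally show "?\<omega> * (\<integral>\<^sup>+z. ennreal (bump z * norm (fst (z::'a \<times> 'a))) * f (sgn (fst z)) \<partial>lborel) =
      (\<integral>\<^sup>+u. f u \<partial>cone_measure) * bump_moment TYPE('a)" using tot by simp
  have "(\<integral>\<^sup>+z. ennreal (bump z * norm (snd (z::'a \<times> 'a))) * f (sgn (snd z)) \<partial>lborel) = (\<integral>\<^sup>+z. ?g (snd z) (fst z) \<partial>(lborel \<Otimes>\<^sub>M lborel))"
    unfolding lborel_prod
  proof (intro nn_integral_cong)
    fix z :: "'a \<times> 'a"
    have "bump z = max 0 (1 - (norm (snd z))\<^sup>2 - (norm (fst z))\<^sup>2)"
      using bump[of "fst z" "snd z"] by (simp add: algebra_simps)
    then show "ennreal (bump z * norm (snd (z::'a \<times> 'a))) * f (sgn (snd z)) = ?g (snd z) (fst z)" by simp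
  qed
  also have "\<dots> = (\<integral>\<^sup>+y. \<integral>\<^sup>+x. ?g x y \<partial>lborel \<partial>lborel)"
    using lborel.nn_integral_fst[OF m(2)] by simp
  finally show "?\<omega> * (\<integral>\<^sup>+z. ennreal (bump z * norm (snd (z::'a \<times> 'a))) * f (sgn (snd z)) \<partial>lborel) =
      (\<integral>\<^sup>+u. f u \<partial>cone_measure) * bump_moment TYPE('a)" using tot by simp
qed

lemma nn_integral_wbox:
  fixes F :: "'a::euclidean_space \<Rightarrow> real"
  assumes "continuous_on UNIV F" "\<And>z. F z \<ge> 0" "\<And>z. norm z \<ge> 1 \<Longrightarrow> F z = 0"
  shows "(\<integral>\<^sup>+z. ennreal (F z) \<partial>lborel) = ennreal (integral wbox F)"
proof (rule nn_integral_has_integral_lborel)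
  have "(F has_integral integral wbox F) wbox" using assms(1) by (intro integrable_integral integrable_on_wbox)
  then show "(F has_integral integral wbox F) UNIV"
  proof (rule has_integral_on_superset)
    fix x :: 'a assume "x \<notin> wbox"
    then have "norm x > 2" using cball_subset_wbox by (metis mem_cball_0 not_le subsetD)
    then show "F x = 0" using assms(3) by simp
  qed simp
qed (use assms in \<open>auto intro!: borel_measurable_continuous_onI\<close>)

text \<open>The usual mean width times \<omega>/2: \<open>cone_measure\<close> has total mass
  \<omega>, and the width in direction \<open>u\<close> adds the support function at
  \<open>u\<close> and at \<open>- u\<close>.\<close>

definition mean_width :: "nat \<Rightarrow> (nat \<Rightarrow> 'a::euclidean_space) \<Rightarrow> real" where
  "mean_width N p = (\<integral>u. support_max N p u \<partial>cone_measure)"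

text \<open>Adding \<open>D\<close> makes the integrand nonnegative on the sphere, so that no part
  of it is cut off by \<open>ennreal\<close>.\<close>

lemma nn_integral_support_max:
  fixes p :: "nat \<Rightarrow> 'a::euclidean_space"
  assumes N: "N > 0" and D: "\<And>i. i < N \<Longrightarrow> norm (p i) \<le> D"
  shows "(\<integral>\<^sup>+u. ennreal (support_max N p u + D) \<partial>cone_measure) = ennreal (mean_width N p + D * unit_ball_vol TYPE('a))"
proof -
  interpret CM: finite_measure "cone_measure :: 'a measure" by (rule finite_measure_cone_measure)
  have tot: "measure (cone_measure :: 'a measure) UNIV = unit_ball_vol TYPE('a)"
    using emeasure_cone_UNIV[where 'a = 'a] by (simp add: measure_def)
  have b: "\<bar>support_max N p u\<bar> \<le> D" if "norm u = 1" for u using abs_support_max_le[OF N, of p D u] D that by simp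
  have AEb: "AE u in cone_measure. norm (support_max N p u) \<le> D" by (rule AE_mp[OF AE_cone_sphere]) (use b in auto)
  have i: "integrable cone_measure (support_max N p)"
    by (rule CM.integrable_const_bound[OF AEb]) (use N in measurable)
  have "(\<integral>\<^sup>+u. ennreal (support_max N p u + D) \<partial>cone_measure) = ennreal (\<integral>u. support_max N p u + D \<partial>cone_measure)"
  proof (rule nn_integral_eq_integral)
    show "integrable cone_measure (\<lambda>u. support_max N p u + D)" using i by simp
    show "AE u in cone_measure. 0 \<le> support_max N p u + D" using AEb by eventually_elim auto
  qed
  then show ?thesis using i by (simp add: mean_width_def tot mult.commute)
qed

text \<open>The negated inequality, multiplied by \<open>bump_moment\<close>, becomes an inequality
  between integrals over the doubled space that contradicts
  \<open>support_max_integral_strict\<close>. Arguing this way never divides by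
  \<open>bump_moment\<close>.\<close>

lemma mean_width_strict:
  fixes p q :: "nat \<Rightarrow> 'a::euclidean_space"
  assumes N: "N > 0" and le: "\<And>i j. i < N \<Longrightarrow> j < N \<Longrightarrow> dist (p i) (p j) \<le> dist (q i) (q j)"
    and strict: "i0 < N" "j0 < N" "dist (p i0) (p j0) < dist (q i0) (q j0)"
  shows "mean_width N p < mean_width N q"
proof (rule ccontr)
  assume "\<not> ?thesis"
  then have ge: "mean_width N q \<le> mean_width N p" by simp
  obtain D1 D2 where D12: "D1 > 0" "\<And>i. i < N \<Longrightarrow> norm (p i) \<le> D1" "D2 > 0" "\<And>i. i < N \<Longrightarrow> norm (q i) \<le> D2"
    using ex_norm_bound[of N p] ex_norm_bound[of N q] by auto
  define D where "D = max D1 D2"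
  have D: "D > 0" "\<And>i. i < N \<Longrightarrow> norm (p i) \<le> D" "\<And>i. i < N \<Longrightarrow> norm (q i) \<le> D"
    using D12 by (auto simp: D_def le_max_iff_disj less_max_iff_disj)
  let ?\<omega> = "unit_ball_vol TYPE('a)"
  have \<omega>: "?\<omega> > 0" by (rule unit_ball_vol_pos)
  note cm [continuous_intros] = continuous_on_compose2[OF continuous_on_support_max[OF N, of UNIV]]
  \<comment> \<open>Homogeneity splits off the factor \<open>norm x\<close> that
    \<open>polar_bump\<close> asks for; \<open>D * norm x\<close> is the homogeneous form of the
    added constant \<open>D\<close>.\<close>
  have hom: "norm x * (support_max N r (sgn x) + D) = support_max N r x + D * norm x" for r and x :: 'a
  proof -
    have "x = norm x *\<^sub>R sgn x" by (cases "x = 0") (simp_all add: sgn_div_norm)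
    then have "support_max N r x = norm x * support_max N r (sgn x)" using support_max_scaleR[OF N, of "norm x" r "sgn x"] by simp
    then show ?thesis by (simp add: algebra_simps)
  qed
  have nonneg: "0 \<le> support_max N r x + D * norm x" if "\<And>i. i < N \<Longrightarrow> norm (r i) \<le> D" for r and x :: 'a
  proof -
    have "\<bar>support_max N r x\<bar> \<le> D * norm x" by (rule abs_support_max_le[OF N that])
    then show ?thesis by linarith
  qed
  have J: "ennreal ?\<omega> * ennreal (integral wbox (\<lambda>z::'a \<times> 'a. bump z * (support_max N p (fst z) + D * norm (fst z)))) =
      ennreal (mean_width N p + D * ?\<omega>) * bump_moment TYPE('a)"
  proof -
    have "(\<integral>\<^sup>+z. ennreal (bump z * norm (fst (z::'a \<times> 'a))) * ennreal (support_max N p (sgn (fst z)) + D) \<partial>lborel) =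
       (\<integral>\<^sup>+z. ennreal (bump z * (support_max N p (fst z) + D * norm (fst (z::'a \<times> 'a)))) \<partial>lborel)"
      by (intro nn_integral_cong) (simp add: hom[symmetric] bump_nonneg mult.assoc flip: ennreal_mult')
    also have "\<dots> = ennreal (integral wbox (\<lambda>z::'a \<times> 'a. bump z * (support_max N p (fst z) + D * norm (fst z))))"
      using nonneg[OF D(2)] by (intro nn_integral_wbox) (auto intro!: continuous_intros simp: bump_nonneg bump_eq_0)
    finally show ?thesis
      using polar_bump(1)[of "\<lambda>u. ennreal (support_max N p u + D)"] N by (simp add: nn_integral_support_max[OF N D(2)])
  qed
  have J': "ennreal ?\<omega> * ennreal (integral wbox (\<lambda>z::'a \<times> 'a. bump z * (support_max N q (snd z) + D * norm (snd z)))) =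
      ennreal (mean_width N q + D * ?\<omega>) * bump_moment TYPE('a)"
  proof -
    have "(\<integral>\<^sup>+z. ennreal (bump z * norm (snd (z::'a \<times> 'a))) * ennreal (support_max N q (sgn (snd z)) + D) \<partial>lborel) =
       (\<integral>\<^sup>+z. ennreal (bump z * (support_max N q (snd z) + D * norm (snd (z::'a \<times> 'a)))) \<partial>lborel)"
      by (intro nn_integral_cong) (simp add: hom[symmetric] bump_nonneg mult.assoc flip: ennreal_mult')
    also have "\<dots> = ennreal (integral wbox (\<lambda>z::'a \<times> 'a. bump z * (support_max N q (snd z) + D * norm (snd z))))"
      using nonneg[OF D(3)] by (intro nn_integral_wbox) (auto intro!: continuous_intros simp: bump_nonneg bump_eq_0)
    finally show ?thesis
      using polar_bump(2)[of "\<lambda>u. ennreal (support_max N q u + D)"] N by (simp add: nn_integral_support_max[OF N D(3)])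
  qed
  let ?A1 = "integral wbox (\<lambda>z::'a \<times> 'a. bump z * norm (fst z))" and ?A2 = "integral wbox (\<lambda>z::'a \<times> 'a. bump z * norm (snd z))"
  \<comment> \<open>The auxiliary terms weigh the same in both blocks, so they cancel at the end;
    this is \<open>polar_bump\<close> for the constant 1.\<close>
  have A: "?A1 = ?A2"
  proof -
    have n: "(\<integral>\<^sup>+z. ennreal (bump z * norm (fst (z::'a \<times> 'a))) \<partial>lborel) = ennreal ?A1" "(\<integral>\<^sup>+z. ennreal (bump z * norm (snd (z::'a \<times> 'a))) \<partial>lborel) = ennreal ?A2"
      by (intro nn_integral_wbox; auto intro!: continuous_intros simp: bump_nonneg bump_eq_0)+
    have "ennreal ?\<omega> * ennreal ?A1 = ennreal ?\<omega> * ennreal ?A2"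
      using polar_bump[of "\<lambda>u::'a. 1"] n by simp
    then have "ennreal ?A1 = ennreal ?A2" using \<omega> by (simp add: ennreal_mult_cancel_left)
    moreover have "?A1 \<ge> 0" "?A2 \<ge> 0"
      by (intro integral_nonneg integrable_on_wbox; auto intro!: continuous_intros simp: bump_nonneg)+
    ultimately show ?thesis by simp
  qed
  have "ennreal (mean_width N q + D * ?\<omega>) * bump_moment TYPE('a) \<le> ennreal (mean_width N p + D * ?\<omega>) * bump_moment TYPE('a)"
    using ge by (intro mult_right_mono ennreal_leI) auto
  then have "ennreal (integral wbox (\<lambda>z::'a \<times> 'a. bump z * (support_max N q (snd z) + D * norm (snd z)))) \<le>
    ennreal (integral wbox (\<lambda>z::'a \<times> 'a. bump z * (support_max N p (fst z) + D * norm (fst z))))"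
    unfolding J[symmetric] J'[symmetric] using \<omega> by (subst (asm) ennreal_mult_le_mult_iff) auto
  moreover have "integral wbox (\<lambda>z::'a \<times> 'a. bump z * (support_max N p (fst z) + D * norm (fst z))) \<ge> 0"
    using nonneg[OF D(2)] by (intro integral_nonneg integrable_on_wbox) (auto intro!: continuous_intros simp: bump_nonneg)
  ultimately have "integral wbox (\<lambda>z::'a \<times> 'a. bump z * (support_max N q (snd z) + D * norm (snd z))) \<le>
    integral wbox (\<lambda>z::'a \<times> 'a. bump z * (support_max N p (fst z) + D * norm (fst z)))" by (simp add: ennreal_le_iff)
  moreover have "integral wbox (\<lambda>z::'a \<times> 'a. bump z * (support_max N p (fst z) + D * norm (fst z))) =
    integral wbox (\<lambda>z::'a \<times> 'a. bump z * support_max N p (fst z)) + D * ?A1"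
  proof -
    have "integral wbox (\<lambda>z::'a \<times> 'a. bump z * (support_max N p (fst z) + D * norm (fst z))) =
      integral wbox (\<lambda>z::'a \<times> 'a. bump z * support_max N p (fst z) + D * (bump z * norm (fst z)))"
      by (simp add: algebra_simps)
    also have "\<dots> = integral wbox (\<lambda>z::'a \<times> 'a. bump z * support_max N p (fst z)) + integral wbox (\<lambda>z::'a \<times> 'a. D * (bump z * norm (fst z)))"
      by (intro integral_add integrable_on_wbox) (auto intro!: continuous_intros)
    finally show ?thesis by simp
  qed
  moreover have "integral wbox (\<lambda>z::'a \<times> 'a. bump z * (support_max N q (snd z) + D * norm (snd z))) =
    integral wbox (\<lambda>z::'a \<times> 'a. bump z * support_max N q (snd z)) + D * ?A2"
  proof -
    have "integral wbox (\<lambda>z::'a \<times> 'a. bump z * (support_max N q (snd z) + D * norm (snd z))) =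
      integral wbox (\<lambda>z::'a \<times> 'a. bump z * support_max N q (snd z) + D * (bump z * norm (snd z)))"
      by (simp add: algebra_simps)
    also have "\<dots> = integral wbox (\<lambda>z::'a \<times> 'a. bump z * support_max N q (snd z)) + integral wbox (\<lambda>z::'a \<times> 'a. D * (bump z * norm (snd z)))"
      by (intro integral_add integrable_on_wbox) (auto intro!: continuous_intros)
    finally show ?thesis by simp
  qed
  ultimately show False
    using support_max_integral_strict[OF N le strict] A by simp
qed

section \<open>Boundaries, congruence and the theorem\<close>

text \<open>For intersections the minimum of the linear forms replaces the maximum. It is minus the
  maximum at the antipode, and the antipodal map preserves the cone measure.\<close>

lemma integral_support_max_uminus:
  fixes p :: "nat \<Rightarrow> 'a::euclidean_space"
  assumes N: "N > 0"
  shows "(\<integral>u. - support_max N p (- u) \<partial>cone_measure) = - mean_width N p"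
proof -
  have "distr cone_measure borel uminus = (cone_measure :: 'a measure)"
  proof (rule measure_eqI)
    fix A :: "'a set" assume "A \<in> sets (distr cone_measure borel uminus)"
    then have A [measurable]: "A \<in> sets borel" by simp
    let ?B = "\<lambda>A. {x::'a. norm x \<le> 1 \<and> sgn x \<in> A}"
    have orth: "orthogonal_transformation (uminus :: 'a \<Rightarrow> 'a)"
      by (auto simp: orthogonal_transformation_def intro!: linearI)
    have im: "uminus ` ?B A = ?B (uminus -` A)"
    proof (rule set_eqI)
      fix x :: 'a
      have "x \<in> uminus ` ?B A \<longleftrightarrow> - x \<in> ?B A" by (metis (no_types, lifting) image_iff minus_minus)
      then show "x \<in> uminus ` ?B A \<longleftrightarrow> x \<in> ?B (uminus -` A)" by (simp add: sgn_minus)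
    qed
    have mA: "uminus -` A \<in> sets borel" using measurable_sets[of uminus borel borel A] A by simp
    have "emeasure (distr cone_measure borel uminus) A = emeasure cone_measure (uminus -` A)"
      by (subst emeasure_distr) auto
    also have "\<dots> = emeasure lborel (uminus ` ?B A)" unfolding im by (rule emeasure_cone_measure[OF mA])
    also have "\<dots> = emeasure lborel (?B A)"
      using mA by (intro emeasure_lborel_orthogonal[OF orth]) (simp add: im)
    also have "\<dots> = emeasure cone_measure A" by (rule emeasure_cone_measure[symmetric]) simp
    finally show "emeasure (distr cone_measure borel uminus) A = emeasure cone_measure A" .
  qed simp
  then have "mean_width N p = (\<integral>u. support_max N p u \<partial>(distr cone_measure borel uminus))"
    by (simp add: mean_width_def)
  also have "\<dots> = (\<integral>u. support_max N p (- u) \<partial>cone_measure)"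
    using N by (intro integral_distr) measurable
  finally show ?thesis by simp
qed

section \<open>Unions and intersections of balls as level sets\<close>

lemma level_set_near_le:
  fixes p :: "nat \<Rightarrow> 'a::metric_space"
  assumes N: "N > 0" shows "level_set 1 N p {..r} = (\<Union>i<N. cball (p i) r)"
proof (rule set_eqI)
  fix x
  obtain i where i: "i < N" "x \<in> cell 1 N p i" using cell_ex[OF N] by blast
  have "dist x (p i) \<le> dist x (p j)" if "j < N" for j using i(2) that by (simp add: cell_def)
  then have "(\<exists>j<N. dist x (p j) \<le> r) \<longleftrightarrow> dist x (p i) \<le> r" using i(1) by (meson order_trans)
  then show "x \<in> level_set 1 N p {..r} \<longleftrightarrow> x \<in> (\<Union>i<N. cball (p i) r)"
    unfolding level_set_mem[OF i] by (auto simp: dist_commute)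
qed

lemma level_set_far_le:
  fixes p :: "nat \<Rightarrow> 'a::metric_space"
  assumes N: "N > 0" shows "level_set (-1) N p {..r} = (\<Inter>i<N. cball (p i) r)"
proof (rule set_eqI)
  fix x
  obtain i where i: "i < N" "x \<in> cell (-1) N p i" using cell_ex[OF N] by blast
  have "dist x (p j) \<le> dist x (p i)" if "j < N" for j using i(2) that by (simp add: cell_def)
  then have "(\<forall>j<N. dist x (p j) \<le> r) \<longleftrightarrow> dist x (p i) \<le> r" using i(1) by (meson order_trans)
  then show "x \<in> level_set (-1) N p {..r} \<longleftrightarrow> x \<in> (\<Inter>i<N. cball (p i) r)"
    unfolding level_set_mem[OF i] by (auto simp: dist_commute)
qed

text \<open>For small radii a point at distance exactly \<open>r\<close> from its nearest centre can
  be interior, for instance where the balls just close a hole. If \<open>r > 2 * D\<close>, such a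
  point has norm above \<open>D\<close>, and moving it away from the origin increases its distance
  to every centre.\<close>

lemma frontier_Union_cball:
  fixes p :: "nat \<Rightarrow> 'a::euclidean_space"
  assumes N: "N > 0" and D: "\<And>i. i < N \<Longrightarrow> norm (p i) \<le> D" and r: "r > 2 * D"
  shows "frontier (\<Union>i<N. cball (p i) r) = level_set 1 N p {r}"
proof (rule set_eqI)
  fix x
  have D0: "D \<ge> 0" using D[OF N] norm_ge_zero[of "p 0"] by linarith
  let ?K = "\<Union>i<N. cball (p i) r"
  have "closed ?K" by (intro closed_UN) auto
  then have fr: "x \<in> frontier ?K \<longleftrightarrow> x \<in> ?K \<and> x \<notin> interior ?K" by (simp add: frontier_def closure_closed)
  obtain i where i: "i < N" "x \<in> cell 1 N p i" using cell_ex[OF N] by blast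
  have min: "dist x (p i) \<le> dist x (p j)" if "j < N" for j using i(2) that by (simp add: cell_def)
  have "x \<in> frontier ?K \<longleftrightarrow> dist x (p i) = r"
  proof
    assume x: "x \<in> frontier ?K"
    then obtain j where "j < N" "dist x (p j) \<le> r" unfolding fr by (auto simp: dist_commute)
    then have "dist x (p i) \<le> r" using min by (meson order_trans)
    moreover have "\<not> dist x (p i) < r"
    proof
      assume "dist x (p i) < r"
      then have "x \<in> ball (p i) r" by (simp add: dist_commute)
      moreover have "ball (p i) r \<subseteq> interior ?K" using i(1) by (intro interior_maximal) (auto intro!: bexI[of _ i])
      ultimately show False using x unfolding fr by blast
    qed
    ultimately show "dist x (p i) = r" by simp
  next
    assume eq: "dist x (p i) = r"
    have "x \<notin> interior ?K"
    proof
      assume "x \<in> interior ?K"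
      then obtain e where e: "e > 0" "ball x e \<subseteq> ?K" by (meson mem_interior)
      have "norm x \<ge> r - D" using eq D[OF i(1)] norm_triangle_ineq4[of x "p i"] by (simp add: dist_norm)
      then have nx: "norm x > D" using r by linarith
      define t where "t = e / (2 * norm x)"
      have "norm x > 0" using nx D0 by linarith
      then have t: "t > 0" "t * norm x < e" using e(1) by (auto simp: t_def)
      have "dist x ((1 + t) *\<^sub>R x) = t * norm x" using t by (simp add: dist_norm algebra_simps)
      then have "(1 + t) *\<^sub>R x \<in> ?K" using e(2) t(2) by (metis mem_ball subsetD)
      then obtain j where j: "j < N" "dist ((1 + t) *\<^sub>R x) (p j) \<le> r" by (auto simp: dist_commute)
      have "x \<bullet> p j \<le> norm x * norm (p j)" by (rule norm_cauchy_schwarz)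
      also have "\<dots> \<le> norm x * D" using D[OF j(1)] by (intro mult_left_mono) auto
      also have "\<dots> < norm x * norm x" using nx D0 by (intro mult_strict_left_mono) auto
      finally have pos: "x \<bullet> x - x \<bullet> p j > 0" by (simp add: dot_square_norm power2_eq_square)
      have "(dist ((1 + t) *\<^sub>R x) (p j))\<^sup>2 = (dist x (p j))\<^sup>2 + 2 * t * (x \<bullet> x - x \<bullet> p j) + t\<^sup>2 * (x \<bullet> x)"
        unfolding dist_norm power2_norm_eq_inner by (simp add: algebra_simps power2_eq_square inner_commute)
      moreover have "2 * t * (x \<bullet> x - x \<bullet> p j) > 0" using t pos by simp
      moreover have "t\<^sup>2 * (x \<bullet> x) \<ge> 0" by simp
      moreover have "(dist x (p j))\<^sup>2 \<ge> r\<^sup>2" using min[OF j(1)] eq r D0 by (intro power_mono) auto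
      moreover have "(dist ((1 + t) *\<^sub>R x) (p j))\<^sup>2 \<le> r\<^sup>2" using j(2) by (intro power_mono) auto
      ultimately show False by linarith
    qed
    moreover have "x \<in> ?K" using i(1) eq by (auto simp: dist_commute intro!: bexI[of _ i])
    ultimately show "x \<in> frontier ?K" unfolding fr by blast
  qed
  then show "x \<in> frontier ?K \<longleftrightarrow> x \<in> level_set 1 N p {r}" unfolding level_set_mem[OF i] by simp
qed

text \<open>From a point whose farthest centre is at distance \<open>r\<close>, a step away from
  that centre leaves its ball.\<close>

lemma frontier_Inter_cball:
  fixes p :: "nat \<Rightarrow> 'a::euclidean_space"
  assumes N: "N > 0" and r: "r > 0"
  shows "frontier (\<Inter>i<N. cball (p i) r) = level_set (-1) N p {r}"
proof (rule set_eqI)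
  fix x
  let ?K = "\<Inter>i<N. cball (p i) r"
  have "closed ?K" by (intro closed_INT) auto
  then have fr: "x \<in> frontier ?K \<longleftrightarrow> x \<in> ?K \<and> x \<notin> interior ?K" by (simp add: frontier_def closure_closed)
  obtain i where i: "i < N" "x \<in> cell (-1) N p i" using cell_ex[OF N] by blast
  have max: "dist x (p j) \<le> dist x (p i)" if "j < N" for j using i(2) that by (simp add: cell_def)
  have "x \<in> frontier ?K \<longleftrightarrow> dist x (p i) = r"
  proof
    assume x: "x \<in> frontier ?K"
    then have "dist x (p i) \<le> r" using i(1) unfolding fr by (auto simp: dist_commute)
    moreover have "\<not> dist x (p i) < r"
    proof
      assume less: "dist x (p i) < r"
      have "dist x (p j) < r" if "j < N" for j using max[OF that] less by linarith
      then have "x \<in> (\<Inter>i<N. ball (p i) r)" by (auto simp: dist_commute)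
      moreover have "(\<Inter>i<N. ball (p i) r) \<subseteq> interior ?K" by (intro interior_maximal open_INT) (auto simp: subset_iff less_imp_le)
      ultimately show False using x unfolding fr by blast
    qed
    ultimately show "dist x (p i) = r" by simp
  next
    assume eq: "dist x (p i) = r"
    have "x \<notin> interior ?K"
    proof
      assume "x \<in> interior ?K"
      then obtain e where e: "e > 0" "ball x e \<subseteq> ?K" by (meson mem_interior)
      define t where "t = e / (2 * r)"
      have t: "t > 0" "t * r < e" using e r by (auto simp: t_def)
      have nr: "norm (x - p i) = r" using eq by (simp add: dist_norm)
      let ?y = "x + t *\<^sub>R (x - p i)"
      have "dist x ?y = t * r" using t nr by (simp add: dist_norm)
      then have "?y \<in> ball x e" using t(2) by simp
      then have "?y \<in> ?K" using e(2) by blast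
      then have "?y \<in> cball (p i) r" using i(1) by blast
      moreover have "p i - ?y = - ((1 + t) *\<^sub>R (x - p i))" by (simp add: algebra_simps)
      then have "dist (p i) ?y = (1 + t) * r" using nr t by (simp add: dist_norm)
      ultimately show False using mult_pos_pos[OF t(1) r] by (simp add: distrib_right)
    qed
    moreover have "x \<in> ?K" using max eq by (auto simp: dist_commute)
    ultimately show "x \<in> frontier ?K" unfolding fr by blast
  qed
  then show "x \<in> frontier ?K \<longleftrightarrow> x \<in> level_set (-1) N p {r}" unfolding level_set_mem[OF i] by simp
qed

section \<open>Congruence\<close>

text \<open>The reflection in the perpendicular bisector of \<open>a\<close> and \<open>b\<close>;
  \<open>m\<close> is their midpoint.\<close>

lemma reflection_isometry:
  fixes a b :: "'a::real_inner"
  assumes "a \<noteq> b"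
  obtains f where "\<And>x y. dist (f x) (f y) = dist x y" "f a = b" "\<And>x. dist x a = dist x b \<Longrightarrow> f x = x"
proof -
  define w where "w = b - a"
  define m where "m = (1 / 2) *\<^sub>R (a + b)"
  have w: "w \<bullet> w \<noteq> 0" using assms by (simp add: w_def)
  define f where "f x = x - (2 * ((x - m) \<bullet> w) / (w \<bullet> w)) *\<^sub>R w" for x
  show thesis
  proof
    fix x y :: 'a
    define z where "z = x - y"
    have fz: "f x - f y = z - (2 * (z \<bullet> w) / (w \<bullet> w)) *\<^sub>R w"
      by (simp add: f_def z_def inner_diff_left algebra_simps diff_divide_distrib)
    have "(norm (f x - f y))\<^sup>2 = (norm z)\<^sup>2"
      unfolding fz power2_norm_eq_inner using w
      by (simp add: inner_diff_left inner_diff_right inner_commute field_simps)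
    then show "dist (f x) (f y) = dist x y" by (simp add: dist_norm z_def)
  next
    have "(a - m) = - (1 / 2) *\<^sub>R w" by (simp add: m_def w_def algebra_simps flip: scaleR_add_left)
    then have "(a - m) \<bullet> w = - (w \<bullet> w) / 2" by simp
    then have "f a = a + w" using w by (simp add: f_def)
    then show "f a = b" by (simp add: w_def)
  next
    fix x :: 'a assume "dist x a = dist x b"
    then have "(norm (x - a))\<^sup>2 = (norm (x - b))\<^sup>2" by (simp add: dist_norm)
    then have "(x - m) \<bullet> w = 0"
      unfolding power2_norm_eq_inner by (simp add: m_def w_def inner_diff_left inner_diff_right inner_add_left inner_commute algebra_simps)
    then show "f x = x" by (simp add: f_def)
  qed
qed

text \<open>An isometry matching the first \<open>N\<close> points is corrected at the next one by a
  reflection. The points matched already are equidistant from the wrong image and the right one, so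
  they lie on the mirror and stay fixed.\<close>

lemma congruent_conf_if_dist_eq:
  fixes p q :: "nat \<Rightarrow> 'a::real_inner"
  assumes "\<And>i j. i < N \<Longrightarrow> j < N \<Longrightarrow> dist (p i) (p j) = dist (q i) (q j)"
  shows "congruent_conf N p q"
  using assms
proof (induction N)
  case 0
  show ?case by (auto simp: congruent_conf_def intro: exI[of _ id])
next
  case (Suc N)
  then obtain f where f: "\<And>x y. dist (f x) (f y) = dist x y" "\<And>i. i < N \<Longrightarrow> f (p i) = q i"
    unfolding congruent_conf_def by (metis less_SucI)
  show ?case
  proof (cases "f (p N) = q N")
    case True
    then show ?thesis using f unfolding congruent_conf_def by (auto simp: less_Suc_eq)
  next
    case False
    then obtain g where g: "\<And>x y. dist (g x) (g y) = dist x y" "g (f (p N)) = q N"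
      "\<And>x. dist x (f (p N)) = dist x (q N) \<Longrightarrow> g x = x" using reflection_isometry by metis
    have "g (f (p i)) = q i" if "i < N" for i
    proof -
      have "dist (q i) (f (p N)) = dist (q i) (q N)" using f(1)[of "p i" "p N"] f(2)[OF that] Suc.prems[of i N] that by simp
      then show ?thesis using g(3) f(2)[OF that] by simp
    qed
    then show ?thesis
      unfolding congruent_conf_def using f g by (intro exI[of _ "g \<circ> f"]) (auto simp: less_Suc_eq)
  qed
qed

text \<open>\<open>congruent_conf\<close> asks only for a map that preserves distances; up to a
  translation it is orthogonal, hence onto.\<close>

lemma isometry_surj:
  fixes f :: "'a::euclidean_space \<Rightarrow> 'a"
  assumes f: "\<And>x y. dist (f x) (f y) = dist x y"
  shows "surj f"
proof -
  have "orthogonal_transformation (\<lambda>x. f x - f 0)"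
    unfolding orthogonal_transformation_isometry using f by (simp add: dist_norm)
  then have "surj (\<lambda>x. f x - f 0)" by (rule orthogonal_transformation_surj)
  then have "\<exists>x. y = f x" for y
    using surjD[of "\<lambda>x. f x - f 0" "y - f 0"] by auto
  then show ?thesis by (simp add: surj_def)
qed

lemma hausdorff_measure_level_set_congruent:
  fixes p q :: "nat \<Rightarrow> 'a::euclidean_space"
  assumes "congruent_conf N p q"
  shows "hausdorff_measure s (level_set \<sigma> N p R) = hausdorff_measure s (level_set \<sigma> N q R)"
proof -
  obtain f where f: "\<And>x y. dist (f x) (f y) = dist x y" "\<And>i. i < N \<Longrightarrow> f (p i) = q i"
    using assms unfolding congruent_conf_def by blast
  have surj: "surj f" by (rule isometry_surj[OF f(1)])
  have d: "dist (f x) (q i) = dist x (p i)" if "i < N" for x i using f(1)[of x "p i"] f(2)[OF that] by simp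
  have "f x \<in> cell \<sigma> N q i \<longleftrightarrow> x \<in> cell \<sigma> N p i" if "i < N" for x i
    using that d by (auto simp: cell_def)
  then have mem: "f x \<in> level_set \<sigma> N q R \<longleftrightarrow> x \<in> level_set \<sigma> N p R" for x
    using d by (auto simp: level_set_def)
  have "f ` level_set \<sigma> N p R = level_set \<sigma> N q R"
  proof (rule set_eqI)
    fix y
    obtain x where y: "y = f x" using surj by (metis surjD)
    have "inj f"
      by (rule injI) (metis f(1) dist_eq_0_iff)
    then show "y \<in> f ` level_set \<sigma> N p R \<longleftrightarrow> y \<in> level_set \<sigma> N q R"
      unfolding y mem by (simp add: inj_image_mem_iff)
  qed
  moreover have "hausdorff_measure s (f ` level_set \<sigma> N p R) = ennreal (1 powr s) * hausdorff_measure s (level_set \<sigma> N p R)"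
    using f(1) surj by (intro hausdorff_measure_similarity) auto
  ultimately show ?thesis by simp
qed

section \<open>Asymptotics of the total angle and the comparison\<close>

lemma cell_angle_near_limit:
  fixes p :: "nat \<Rightarrow> 'a::euclidean_space"
  assumes N: "N > 0"
  shows "((\<lambda>r. r * (cell_angle 1 N p r - unit_ball_vol TYPE('a))) \<longlongrightarrow> real (DIM('a) - 1) * mean_width N p) at_top"
proof -
  let ?n = "DIM('a)"
  obtain D where D: "D > 0" "\<And>i. i < N \<Longrightarrow> norm (p i) \<le> D" using ex_norm_bound[of N p] by blast
  let ?V = "\<lambda>r. measure lborel (level_set 1 N p {..r})"
  obtain C where C: "C \<ge> 0" "\<And>r. r \<ge> 2 * D \<Longrightarrow>
    \<bar>?V r / r ^ ?n - unit_ball_vol TYPE('a) - ?n * (\<integral>u. support_max N p u \<partial>cone_measure) / r\<bar> \<le> C / r\<^sup>2"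
  proof (rule volume_expansion[of "support_max N p" D "\<lambda>r. level_set 1 N p {..r}"])
    show "support_max N p \<in> borel_measurable borel" using N by measurable
    show "\<bar>support_max N p u\<bar> \<le> D" if "norm u = 1" for u
      using abs_support_max_le[OF N, of p D u] D(2) that by simp
    show "level_set 1 N p {..r} \<in> sets borel" for r by measurable
    show "level_set 1 N p {..r} \<subseteq> {x. norm x \<le> r + support_max N p (sgn x)}" if r: "r \<ge> 2 * D" for r
    proof
      fix x assume "x \<in> level_set 1 N p {..r}"
      then obtain i where i: "i < N" "dist x (p i) \<le> r" unfolding level_set_near_le[OF N] by (auto simp: dist_commute)
      have "norm x \<le> r + p i \<bullet> sgn x" using i(2) r D by (intro norm_le_if_in_ball) auto
      then show "x \<in> {x. norm x \<le> r + support_max N p (sgn x)}" using support_max_ge[OF i(1), of p "sgn x"] by simp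
    qed
    show "{x. norm x \<le> r + support_max N p (sgn x) - D\<^sup>2 / r} \<subseteq> level_set 1 N p {..r}" if r: "r \<ge> 2 * D" for r
    proof clarify
      fix x assume x: "norm x \<le> r + support_max N p (sgn x) - D\<^sup>2 / r"
      obtain i where i: "i < N" "support_max N p (sgn x) = p i \<bullet> sgn x" using support_max_attained[OF N] by blast
      have "dist x (p i) \<le> r" using x i r D by (intro in_ball_if_norm_le[of x r "p i" D]) auto
      then show "x \<in> level_set 1 N p {..r}" unfolding level_set_near_le[OF N] using i(1) by (auto simp: dist_commute)
    qed
  qed (use D in auto)
  \<comment> \<open>The \<open>?n\<close> from the volume expansion cancels the denominator of the
    limit ratio. Here \<open>cell_angle\<close> decreases, so it lies above the quotient over
    [r, k r] and below the one over [r/k, r].\<close>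
  have "((\<lambda>r. r * (cell_angle 1 N p r - unit_ball_vol TYPE('a))) \<longlongrightarrow> (?n * mean_width N p) * (real (?n - 1) / ?n)) at_top"
  proof (rule monotone_density_limit[where R = "2 * D" and V = ?V and C = C])
    show "\<bar>?V r / r ^ ?n - unit_ball_vol TYPE('a) - ?n * mean_width N p / r\<bar> \<le> C / r\<^sup>2" if "r \<ge> 2 * D" for r
      using C(2)[OF that] by (simp add: mean_width_def)
    fix k r :: real assume k: "k > 1" and r: "r > 0"
    have kr: "r \<le> k * r" "r / k \<le> r" "k * (r / k) = r" using k r by (auto simp: field_simps)
    have pos: "(k * r) ^ ?n - r ^ ?n > 0" "r ^ ?n - (r / k) ^ ?n > 0"
      using k r by (auto intro!: power_strict_mono simp: field_simps)
    have 1: "cell_angle 1 N p r \<ge> (?V (k * r) - ?V r) / ((k * r) ^ ?n - r ^ ?n)"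
      using volume_diff_near(2)[of r "k * r" N p] r kr pos by (simp add: divide_le_eq)
    have 2: "cell_angle 1 N p r \<le> (?V r - ?V (r / k)) / (r ^ ?n - (r / k) ^ ?n)"
      using volume_diff_near(1)[of "r / k" r N p] r k kr pos by (simp add: le_divide_eq)
    show "(?V (k * r) - ?V r) / ((k * r) ^ ?n - r ^ ?n) \<le> cell_angle 1 N p r \<and>
      cell_angle 1 N p r \<le> (?V (k * (r / k)) - ?V (r / k)) / ((k * (r / k)) ^ ?n - (r / k) ^ ?n) \<or>
      (?V (k * (r / k)) - ?V (r / k)) / ((k * (r / k)) ^ ?n - (r / k) ^ ?n) \<le> cell_angle 1 N p r \<and>
      cell_angle 1 N p r \<le> (?V (k * r) - ?V r) / ((k * r) ^ ?n - r ^ ?n)"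
      unfolding kr(3) using 1 2 by blast
  qed (use D in auto)
  then show ?thesis by (simp add: mult_ac)
qed

lemma cell_angle_far_limit:
  fixes p :: "nat \<Rightarrow> 'a::euclidean_space"
  assumes N: "N > 0"
  shows "((\<lambda>r. r * (cell_angle (-1) N p r - unit_ball_vol TYPE('a))) \<longlongrightarrow> - (real (DIM('a) - 1) * mean_width N p)) at_top"
proof -
  let ?n = "DIM('a)"
  obtain D where D: "D > 0" "\<And>i. i < N \<Longrightarrow> norm (p i) \<le> D" using ex_norm_bound[of N p] by blast
  let ?V = "\<lambda>r. measure lborel (level_set (-1) N p {..r})"
  \<comment> \<open>The minimum of the linear forms \<open>p i \<bullet> u\<close>: a ray leaves the
    intersection as soon as it leaves one of the balls.\<close>
  let ?h = "\<lambda>u. - support_max N p (- u)"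
  have h_le: "?h u \<le> p i \<bullet> u" if "i < N" for i u using support_max_ge[OF that, of p "- u"] by simp
  have h_att: "\<exists>i<N. ?h u = p i \<bullet> u" for u using support_max_attained[OF N, of p "- u"] by auto
  obtain C where C: "C \<ge> 0" "\<And>r. r \<ge> 2 * D \<Longrightarrow>
    \<bar>?V r / r ^ ?n - unit_ball_vol TYPE('a) - ?n * (\<integral>u. ?h u \<partial>cone_measure) / r\<bar> \<le> C / r\<^sup>2"
  proof (rule volume_expansion[of ?h D "\<lambda>r. level_set (-1) N p {..r}"])
    show "?h \<in> borel_measurable borel" using N by measurable
    show "\<bar>?h u\<bar> \<le> D" if "norm u = 1" for u
      using abs_support_max_le[OF N, of p D "- u"] D(2) that by simp
    show "level_set (-1) N p {..r} \<in> sets borel" for r by measurable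
    show "level_set (-1) N p {..r} \<subseteq> {x. norm x \<le> r + ?h (sgn x)}" if r: "r \<ge> 2 * D" for r
    proof
      fix x assume x: "x \<in> level_set (-1) N p {..r}"
      obtain i where i: "i < N" "?h (sgn x) = p i \<bullet> sgn x" using h_att by blast
      then have "dist x (p i) \<le> r" using x unfolding level_set_far_le[OF N] by (auto simp: dist_commute)
      then have "norm x \<le> r + p i \<bullet> sgn x" using r D by (intro norm_le_if_in_ball) auto
      then show "x \<in> {x. norm x \<le> r + ?h (sgn x)}" using i(2) by simp
    qed
    show "{x. norm x \<le> r + ?h (sgn x) - D\<^sup>2 / r} \<subseteq> level_set (-1) N p {..r}" if r: "r \<ge> 2 * D" for r
    proof
      fix x assume "x \<in> {x. norm x \<le> r + ?h (sgn x) - D\<^sup>2 / r}"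
      then have x: "norm x \<le> r + ?h (sgn x) - D\<^sup>2 / r" by simp
      have "dist x (p i) \<le> r" if i: "i < N" for i
        using x h_le[OF i, of "sgn x"] r D(1) D(2)[OF i] by (intro in_ball_if_norm_le[of x r "p i" D]) auto
      then show "x \<in> level_set (-1) N p {..r}" unfolding level_set_far_le[OF N] by (auto simp: dist_commute)
    qed
  qed (use D in auto)
  \<comment> \<open>Now \<open>cell_angle\<close> increases, which is the other alternative in
    \<open>monotone_density_limit\<close>.\<close>
  have "((\<lambda>r. r * (cell_angle (-1) N p r - unit_ball_vol TYPE('a))) \<longlongrightarrow> (?n * - mean_width N p) * (real (?n - 1) / ?n)) at_top"
  proof (rule monotone_density_limit[where R = "2 * D" and V = ?V and C = C])
    show "\<bar>?V r / r ^ ?n - unit_ball_vol TYPE('a) - ?n * - mean_width N p / r\<bar> \<le> C / r\<^sup>2" if "r \<ge> 2 * D" for r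
      using C(2)[OF that] unfolding integral_support_max_uminus[OF N] .
    fix k r :: real assume k: "k > 1" and r: "r > 0"
    have kr: "r \<le> k * r" "r / k \<le> r" "k * (r / k) = r" using k r by (auto simp: field_simps)
    have pos: "(k * r) ^ ?n - r ^ ?n > 0" "r ^ ?n - (r / k) ^ ?n > 0"
      using k r by (auto intro!: power_strict_mono simp: field_simps)
    have 1: "cell_angle (-1) N p r \<le> (?V (k * r) - ?V r) / ((k * r) ^ ?n - r ^ ?n)"
      using volume_diff_far(1)[of r "k * r" N p] r kr pos by (simp add: le_divide_eq)
    have 2: "cell_angle (-1) N p r \<ge> (?V r - ?V (r / k)) / (r ^ ?n - (r / k) ^ ?n)"
      using volume_diff_far(2)[of "r / k" r N p] r k kr pos by (simp add: divide_le_eq)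
    show "(?V (k * r) - ?V r) / ((k * r) ^ ?n - r ^ ?n) \<le> cell_angle (-1) N p r \<and>
      cell_angle (-1) N p r \<le> (?V (k * (r / k)) - ?V (r / k)) / ((k * (r / k)) ^ ?n - (r / k) ^ ?n) \<or>
      (?V (k * (r / k)) - ?V (r / k)) / ((k * (r / k)) ^ ?n - (r / k) ^ ?n) \<le> cell_angle (-1) N p r \<and>
      cell_angle (-1) N p r \<le> (?V (k * r) - ?V r) / ((k * r) ^ ?n - r ^ ?n)"
      unfolding kr(3) using 1 2 by blast
  qed (use D in auto)
  then show ?thesis by (simp add: mult_ac)
qed

text \<open>Both functions tend to the same constant \<open>c\<close>, so their coefficients of
  \<open>1 / r\<close> decide.\<close>

lemma eventually_less_from_scaled_limits:
  fixes f g :: "real \<Rightarrow> real"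
  assumes "((\<lambda>r. r * (f r - c)) \<longlongrightarrow> a) at_top" "((\<lambda>r. r * (g r - c)) \<longlongrightarrow> b) at_top" "a < b"
  shows "\<forall>\<^sub>F r in at_top. f r < g r"
proof -
  have "\<forall>\<^sub>F r in at_top. r * (f r - c) < (a + b) / 2" using assms(1,3) by (intro order_tendstoD(2)) auto
  moreover have "\<forall>\<^sub>F r in at_top. r * (g r - c) > (a + b) / 2" using assms(2,3) by (intro order_tendstoD(1)) auto
  ultimately show ?thesis
    using eventually_gt_at_top[of 0]
  proof eventually_elim
    case (elim r)
    then have "r * (f r - c) < r * (g r - c)" by linarith
    then show ?case using elim(3) by simp
  qed
qed

theorem theorem5:
  fixes p q :: "nat \<Rightarrow> real ^ 'n" and N :: nat
  assumes "CARD('n) \<ge> 2"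
    and "\<And>i j. i < N \<Longrightarrow> j < N \<Longrightarrow> dist (p i) (p j) \<le> dist (q i) (q j)"
  shows "\<exists>r0 > 0. \<forall>r \<ge> r0.
    hausdorff_measure (real CARD('n) - 1) (frontier (\<Union>i<N. cball (p i) r))
      \<le> hausdorff_measure (real CARD('n) - 1) (frontier (\<Union>i<N. cball (q i) r)) \<and>
    hausdorff_measure (real CARD('n) - 1) (frontier (\<Inter>i<N. cball (p i) r))
      \<ge> hausdorff_measure (real CARD('n) - 1) (frontier (\<Inter>i<N. cball (q i) r)) \<and>
    (\<not> congruent_conf N p q \<longrightarrow>
      hausdorff_measure (real CARD('n) - 1) (frontier (\<Union>i<N. cball (p i) r))
        < hausdorff_measure (real CARD('n) - 1) (frontier (\<Union>i<N. cball (q i) r)) \<and>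
      hausdorff_measure (real CARD('n) - 1) (frontier (\<Inter>i<N. cball (p i) r))
        > hausdorff_measure (real CARD('n) - 1) (frontier (\<Inter>i<N. cball (q i) r)))"
proof (cases "N = 0")
  case True
  \<comment> \<open>With no indices the unions are \<open>{}\<close> and the intersections
    \<open>UNIV\<close> on both sides, and the strict claim is vacuous.\<close>
  then have "congruent_conf N p q" by (auto simp: congruent_conf_def intro: exI[of _ id])
  then show ?thesis using True by (intro exI[of _ 1]) simp
next
  case False
  then have N: "N > 0" by simp
  let ?s = "real CARD('n) - 1"
  obtain D1 D2 where D12: "D1 > 0" "\<And>i. i < N \<Longrightarrow> norm (p i) \<le> D1" "D2 > 0" "\<And>i. i < N \<Longrightarrow> norm (q i) \<le> D2"
    using ex_norm_bound[of N p] ex_norm_bound[of N q] by auto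
  \<comment> \<open>Beyond both thresholds \<open>2 * D1\<close> and \<open>2 * D2\<close> the
    boundaries are level sets; the 1 makes the excess strict.\<close>
  define R where "R = 2 * D1 + 2 * D2 + 1"
  have R: "R > 0" using D12 by (simp add: R_def)
  have fr: "frontier (\<Union>i<N. cball (p i) r) = level_set 1 N p {r}" "frontier (\<Union>i<N. cball (q i) r) = level_set 1 N q {r}"
    "frontier (\<Inter>i<N. cball (p i) r) = level_set (-1) N p {r}" "frontier (\<Inter>i<N. cball (q i) r) = level_set (-1) N q {r}"
    if "r \<ge> R" for r
    using that D12 R
    by (auto simp: R_def intro!: frontier_Union_cball[OF N, of p D1] frontier_Union_cball[OF N, of q D2] frontier_Inter_cball[OF N])
  show ?thesis
  proof (cases "congruent_conf N p q")
    case True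
    show ?thesis
      using R hausdorff_measure_level_set_congruent[OF True] True by (intro exI[of _ R] conjI allI impI) (simp_all add: fr)
  next
    case nc: False
    \<comment> \<open>If no pair were strictly expanded, all distances would agree and the
      configurations would be congruent.\<close>
    obtain i0 j0 where strict: "i0 < N" "j0 < N" "dist (p i0) (p j0) < dist (q i0) (q j0)"
      using nc congruent_conf_if_dist_eq[of N p q] assms(2) by (meson less_eq_real_def)
    have W: "mean_width N p < mean_width N q" by (rule mean_width_strict[OF N assms(2) strict])
    have n1: "real (DIM(real^'n) - 1) > 0" using assms(1) by simp
    obtain c where c: "c > 0" "\<And>A. A \<in> sets borel \<Longrightarrow>
      hausdorff_measure ?s (A \<inter> sphere (0::real^'n) 1) = ennreal c * emeasure cone_measure A"
      using hausdorff_measure_sphere_cone[OF assms(1)] by blast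
    have H: "hausdorff_measure ?s (level_set \<sigma> N x {r}) = ennreal (r powr ?s * c * cell_angle \<sigma> N x r)" if "r > 0" for \<sigma> r and x :: "nat \<Rightarrow> real^'n"
      using c that by (intro hausdorff_measure_level_set) auto
    have Hless: "hausdorff_measure ?s (level_set \<sigma> N x {r}) < hausdorff_measure ?s (level_set \<sigma> N y {r})"
      if "r > 0" "cell_angle \<sigma> N x r < cell_angle \<sigma> N y r" for \<sigma> r and x y :: "nat \<Rightarrow> real^'n"
    proof -
      \<comment> \<open>As \<open>ennreal\<close> cuts off at 0, the strict inequality transfers
        only once the larger side is known to be positive.\<close>
      have "cell_angle \<sigma> N x r \<ge> 0" unfolding cell_angle_def by (intro sum_nonneg) simp
      then have "0 < cell_angle \<sigma> N y r" using that(2) by linarith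
      then show ?thesis unfolding H[OF that(1)] using that c(1)
        by (intro ennreal_lessI mult_strict_left_mono mult_pos_pos) auto
    qed
    have "\<forall>\<^sub>F r in at_top. cell_angle 1 N p r < cell_angle 1 N q r"
      by (rule eventually_less_from_scaled_limits[OF cell_angle_near_limit[OF N] cell_angle_near_limit[OF N]])
        (use W n1 in simp)
    moreover have "\<forall>\<^sub>F r in at_top. cell_angle (-1) N q r < cell_angle (-1) N p r"
      by (rule eventually_less_from_scaled_limits[OF cell_angle_far_limit[OF N] cell_angle_far_limit[OF N]])
        (use W n1 in simp)
    ultimately have "\<forall>\<^sub>F r in at_top. r \<ge> R \<and> cell_angle 1 N p r < cell_angle 1 N q r \<and> cell_angle (-1) N q r < cell_angle (-1) N p r"
      by (intro eventually_conj eventually_ge_at_top)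
    then obtain r1 where r1: "\<And>r. r \<ge> r1 \<Longrightarrow> r \<ge> R \<and> cell_angle 1 N p r < cell_angle 1 N q r \<and> cell_angle (-1) N q r < cell_angle (-1) N p r"
      by (auto simp: eventually_at_top_linorder)
    have "hausdorff_measure ?s (level_set 1 N p {r}) < hausdorff_measure ?s (level_set 1 N q {r})"
      "hausdorff_measure ?s (level_set (-1) N q {r}) < hausdorff_measure ?s (level_set (-1) N p {r})" if "r \<ge> max r1 R" for r
      using r1[of r] that R by (auto intro!: Hless)
    then show ?thesis using R by (intro exI[of _ "max r1 R"]) (simp add: fr less_imp_le)
  qed
qed

end
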